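(* Let $(\rho_0,\rho_0v_0)\in\mathcal V_2(\mathbb R)$ and set $X_0:=X_{\rho_0}\in\mathcal K$, $V_0:=v_0\circ X_0\in\mathcal H_{X_0}$. A curve $(\rho_t,\rho_tv_t)\in\mathcal V_2(\mathbb R)$, $t\ge0$, is the semigroup solution $\mathscr S_t(\rho_0,\rho_0v_0)$ of the sticky particle system if and only if its monotone rearrangement $X(t)=X_{\rho_t}\in\mathcal K\subset L^2(0,1)$ satisfies one of the following three (equivalent) characterizations (the velocity field $v_t$ being then the one determined by formula (L.a) below): (L.I) $X$ is the unique strong (i.e. absolutely continuous) solution of the Cauchy problem for the subdifferential inclusion $$\frac{d}{dt}X\in-\partial I_{\mathcal K}(X)+V_0,\qquad X(0)=X_0.$$ (L.II) $X$ admits the representation formula $$X(t)=\mathsf P_{\mathcal K}(X_0+tV_0).$$ (L.III) $X$ is the unique strong solution of the rescaled gradient flow $$t\frac{d}{dt}X(t)\in-\partial I_{\mathcal K}(X(t))+X(t)-X_0,\quad\text{such that}\quad\lim_{t\downarrow0}t^{-1}(X(t)-X_0)=V_0\ \text{ in }L^2(0,1).$$ In each of these cases the curve $t\mapsto X(t)$ is Lipschitz continuous in $L^2(0,1)$ and right-differentiable at each time $t$; the velocity field $v_t$ can be recovered by the formula $$V(t)=\frac{d^+}{dt}X(t)=v_t\circ X(t)=\mathsf P_{\mathcal H_{X(t)}}(V_0)\in\mathcal H_{X(t)}\qquad\forall\,t\ge0;\tag{L.a}$$ the closed subspaces $\mathcal H_{X(t)}$ are nonincreasing, $$\mathcal H_{X(t)}\subset\mathcal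 H_{X(s)}\quad\text{if }0\le s\le t;\tag{L.b}$$ and $X,V$ satisfy the semigroup identities $$X(t)=\mathsf P_{\mathcal K}(X(s)+(t-s)V(s)),\qquad V(t)=\mathsf P_{\mathcal H_{X(t)}}(V(s))\qquad\forall\,0\le s\le t.\tag{L.c}$$
   Context: For a Borel probability measure $\rho$ on $\mathbb R$, its monotone rearrangement is $X_\rho(w):=\inf\{x:\rho((-\infty,x])>w\}$, $w\in(0,1)$. $\mathcal K\subset L^2(0,1)$ is the closed convex cone of (essentially) nondecreasing functions, identified with their right-continuous representatives; $\mathsf P_{\mathcal K}$ is the $L^2(0,1)$-projection onto $\mathcal K$; $I_{\mathcal K}$ is the indicator function of $\mathcal K$ ($0$ on $\mathcal K$, $+\infty$ elsewhere), with subdifferential $\partial I_{\mathcal K}(X)=\{\xi\in L^2(0,1):\int_0^1\xi(z-X)\,dw\le0\ \forall z\in\mathcal K\}$ for $X\in\mathcal K$ (empty if $X\notin\mathcal K$). For $X\in\mathcal K$, $\mathcal H_X\subset L^2(0,1)$ is the closed subspace of functions essentially constant in each open interval $(a,b)\subset(0,1)$ where $X$ is constant (equivalently, functions of the form $y\circ X$ with $y$ Borel, $y\in L^2_\rho(\mathbb R)$, $\rho$ the law of $X$ under Lebesgue measure on $(0,1)$), and $\mathsf P_{\mathcal H_X}$ is the orthogonal projection onto it. $\frac{d^+}{dt}$ is the right derivative. Differential inclusions hold for a.e. $t>0$; a strong solution is a (locally) absolutely continuous curve $[0,+\infty)\to L^2(0,1)$. $\mathcal P_2(\mathbb R)$: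 Borel probability measures with finite second moment, with the $L^2$-Wasserstein distance $W_2$. $L^2_\rho(\mathbb R)=L^2(\mathbb R,\rho)$. $\mathcal M(\mathbb R)$: signed Borel measures with finite total variation; weak convergence is in duality with bounded continuous functions. $\mathcal V_2(\mathbb R):=\{\mu=(\rho,\rho v)\in\mathcal P_2(\mathbb R)\times\mathcal M(\mathbb R):v\in L^2_\rho(\mathbb R)\}$ with the distance $D_2^2(\mu^1,\mu^2):=W_2^2(\rho^1,\rho^2)+\int_0^1|v^1(X_{\rho^1}(w))-v^2(X_{\rho^2}(w))|^2\,dw$. Semigroup $\mathscr S_t$. On the $D_2$-dense set $\hat{\mathcal V}(\mathbb R)$ of discrete data $\mu=(\sum_{i=1}^Nm_i\delta_{x_i},\sum_{i=1}^Nm_iv_i\delta_{x_i})$ ($m_i>0$, $\sum m_i=1$, $x_1<\dots<x_N$, $v_i\in\mathbb R$), $\mathscr S_t[\mu]:=(\sum_im_i\delta_{x_i(t)},\sum_im_iv_i(t)\delta_{x_i(t)})$, where $x_i(t)$ are continuous, piecewise linear, ordered trajectories with right-continuous piecewise constant velocities $v_i(t)$ (right derivatives of $x_i$), $x_i(0)=x_i$, $v_i(0)=v_i$; the sets $J_i(t):=\{j:x_j(t)=x_i(t)\}$ are nondecreasing in $t$; velocities are constant between the finitely many collision times $t_k$ (times at which some $J_i$ grows), and $v_i(t_k+)=\sum_{j\in J_i(t_k)}m_jv_j(t_k-)/\sum_{j\in J_i(t_k)}m_j$. On $\mathcal V_2(\mathbb R)$, $\mathscr S_t$ is the unique extension which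 is strongly-weakly continuous, i.e. such that if $D_2(\mu^n,\mu)\to0$, $\mathscr S_t[\mu^n]=(\rho^n_t,\rho^n_tv^n_t)$, $\mathscr S_t[\mu]=(\rho_t,\rho_tv_t)$, then $W_2(\rho^n_t,\rho_t)\to0$ and $\rho^n_tv^n_t\rightharpoonup\rho_tv_t$ weakly in $\mathcal M(\mathbb R)$. *)

theory Defs
  imports "HOL-Probability.Probability"
begin

section \<open>The Hilbert space of square integrable functions on the unit interval\<close>

definition square_integrable :: "'a measure \<Rightarrow> ('a \<Rightarrow> real) \<Rightarrow> bool" where
  "square_integrable M f \<longleftrightarrow> f \<in> borel_measurable M \<and> integrable M (\<lambda>x. (f x)\<^sup>2)"

lemma square_integrable_mult:
  assumes "square_integrable M f" "square_integrable M g"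
  shows "integrable M (\<lambda>x. f x * g x)"
proof (rule Bochner_Integration.integrable_bound)
  show "integrable M (\<lambda>x. (f x)\<^sup>2 + (g x)\<^sup>2)"
    using assms by (auto simp: square_integrable_def)
  show "(\<lambda>x. f x * g x) \<in> borel_measurable M"
    using assms by (auto simp: square_integrable_def)
  have "\<bar>a * b\<bar> \<le> a\<^sup>2 + b\<^sup>2" for a b :: real
  proof -
    have "2 * \<bar>a\<bar> * \<bar>b\<bar> \<le> a\<^sup>2 + b\<^sup>2"
      using sum_squares_bound[of "\<bar>a\<bar>" "\<bar>b\<bar>"] by simp
    moreover have "0 \<le> \<bar>a\<bar> * \<bar>b\<bar>"
      by simp
    ultimately show ?thesis
      unfolding abs_mult by linarith
  qed
  then show "AE x in M. norm (f x * g x) \<le> norm ((f x)\<^sup>2 + (g x)\<^sup>2)"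
    by simp
qed

lemma square_integrable_zero: "square_integrable M (\<lambda>x. 0)"
  by (simp add: square_integrable_def)

lemma square_integrable_add:
  assumes "square_integrable M f" "square_integrable M g"
  shows "square_integrable M (\<lambda>x. f x + g x)"
proof -
  have "integrable M (\<lambda>x. (f x)\<^sup>2 + (g x)\<^sup>2 + 2 * (f x * g x))"
    using assms square_integrable_mult[OF assms] by (auto simp: square_integrable_def)
  then show ?thesis
    using assms by (auto simp: square_integrable_def power2_sum mult.assoc)
qed

lemma square_integrable_scale:
  assumes "square_integrable M f"
  shows "square_integrable M (\<lambda>x. c * f x)"
  using assms by (auto simp: square_integrable_def power_mult_distrib)

lemma square_integrable_minus:
  assumes "square_integrable M f"
  shows "square_integrable M (\<lambda>x. - f x)"
  using assms by (auto simp: square_integrable_def)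

lemma square_integrable_diff:
  assumes "square_integrable M f" "square_integrable M g"
  shows "square_integrable M (\<lambda>x. f x - g x)"
  using square_integrable_add[OF assms(1) square_integrable_minus[OF assms(2)]] by simp

definition unit_lborel :: "real measure" where
  "unit_lborel = restrict_space lborel {0<..<1}"

definition l2_eq :: "(real \<Rightarrow> real) \<Rightarrow> (real \<Rightarrow> real) \<Rightarrow> bool" where
  "l2_eq f g \<longleftrightarrow> square_integrable unit_lborel f \<and> square_integrable unit_lborel g
     \<and> (AE w in unit_lborel. f w = g w)"

lemma part_equivp_l2_eq: "part_equivp l2_eq"
proof (rule part_equivpI)
  show "\<exists>f. l2_eq f f"
    using square_integrable_zero[of unit_lborel] by (auto simp: l2_eq_def)
  show "symp l2_eq"
    by (auto simp: symp_def l2_eq_def)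
  show "transp l2_eq"
  proof (rule transpI)
    fix f g h assume fg: "l2_eq f g" and gh: "l2_eq g h"
    then have "AE w in unit_lborel. f w = g w" "AE w in unit_lborel. g w = h w"
      by (simp_all add: l2_eq_def)
    then have "AE w in unit_lborel. f w = h w"
      by eventually_elim simp
    then show "l2_eq f h"
      using fg gh by (simp add: l2_eq_def)
  qed
qed

lemma l2_eq_add:
  assumes "l2_eq f f'" "l2_eq g g'"
  shows "l2_eq (\<lambda>w. f w + g w) (\<lambda>w. f' w + g' w)"
proof -
  have "AE w in unit_lborel. f w = f' w" "AE w in unit_lborel. g w = g' w"
    using assms by (simp_all add: l2_eq_def)
  then have "AE w in unit_lborel. f w + g w = f' w + g' w"
    by eventually_elim simp
  then show ?thesis
    using assms by (simp add: l2_eq_def square_integrable_add)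
qed

lemma l2_eq_diff:
  assumes "l2_eq f f'" "l2_eq g g'"
  shows "l2_eq (\<lambda>w. f w - g w) (\<lambda>w. f' w - g' w)"
proof -
  have "AE w in unit_lborel. f w = f' w" "AE w in unit_lborel. g w = g' w"
    using assms by (simp_all add: l2_eq_def)
  then have "AE w in unit_lborel. f w - g w = f' w - g' w"
    by eventually_elim simp
  then show ?thesis
    using assms by (simp add: l2_eq_def square_integrable_diff)
qed

lemma l2_eq_minus:
  assumes "l2_eq f f'"
  shows "l2_eq (\<lambda>w. - f w) (\<lambda>w. - f' w)"
proof -
  have "AE w in unit_lborel. f w = f' w"
    using assms by (simp add: l2_eq_def)
  then have "AE w in unit_lborel. - f w = - f' w"
    by eventually_elim simp
  then show ?thesis
    using assms by (simp add: l2_eq_def square_integrable_minus)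
qed

lemma l2_eq_scale:
  assumes "l2_eq f f'"
  shows "l2_eq (\<lambda>w. c * f w) (\<lambda>w. c * f' w)"
proof -
  have "AE w in unit_lborel. f w = f' w"
    using assms by (simp add: l2_eq_def)
  then have "AE w in unit_lborel. c * f w = c * f' w"
    by eventually_elim simp
  then show ?thesis
    using assms by (simp add: l2_eq_def square_integrable_scale)
qed

lemma l2_eq_integral_mult:
  assumes "l2_eq f f'" "l2_eq g g'"
  shows "(LINT w|unit_lborel. f w * g w) = (LINT w|unit_lborel. f' w * g' w)"
proof (rule integral_cong_AE)
  have "AE w in unit_lborel. f w = f' w" "AE w in unit_lborel. g w = g' w"
    using assms by (simp_all add: l2_eq_def)
  then show "AE w in unit_lborel. f w * g w = f' w * g' w"
    by eventually_elim simp
qed (use assms in \<open>auto simp: l2_eq_def square_integrable_def\<close>)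

text \<open>
  The space \<open>L\<^sup>2(0,1)\<close>. For a square integrable \<open>f\<close>, \<^term>\<open>abs_l2 f\<close> is its class modulo
  almost everywhere equality; \<^term>\<open>rep_l2 x\<close> is some representative of the class \<open>x\<close>.
\<close>

quotient_type l2 = "real \<Rightarrow> real" / partial: l2_eq
  by (rule part_equivp_l2_eq)

instantiation l2 :: real_inner
begin

lift_definition zero_l2 :: l2 is "\<lambda>w. 0"
  by (simp add: l2_eq_def square_integrable_zero)

lift_definition plus_l2 :: "l2 \<Rightarrow> l2 \<Rightarrow> l2" is "\<lambda>f g w. f w + g w"
  by (rule l2_eq_add)

lift_definition minus_l2 :: "l2 \<Rightarrow> l2 \<Rightarrow> l2" is "\<lambda>f g w. f w - g w"
  by (rule l2_eq_diff)

lift_definition uminus_l2 :: "l2 \<Rightarrow> l2" is "\<lambda>f w. - f w"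
  by (rule l2_eq_minus)

lift_definition scaleR_l2 :: "real \<Rightarrow> l2 \<Rightarrow> l2" is "\<lambda>c f w. c * f w"
  by (rule l2_eq_scale)

lift_definition inner_l2 :: "l2 \<Rightarrow> l2 \<Rightarrow> real" is "\<lambda>f g. LINT w|unit_lborel. f w * g w"
  by (rule l2_eq_integral_mult)

definition norm_l2 :: "l2 \<Rightarrow> real" where
  "norm_l2 x = sqrt (inner x x)"

definition dist_l2 :: "l2 \<Rightarrow> l2 \<Rightarrow> real" where
  "dist_l2 x y = norm (x - y)"

definition sgn_l2 :: "l2 \<Rightarrow> l2" where
  "sgn_l2 x = inverse (norm x) *\<^sub>R x"

definition uniformity_l2 :: "(l2 \<times> l2) filter" where
  "uniformity_l2 = (INF e\<in>{0<..}. principal {(x, y). dist x y < e})"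

definition open_l2 :: "l2 set \<Rightarrow> bool" where
  "open_l2 U \<longleftrightarrow> (\<forall>x\<in>U. eventually (\<lambda>(x', y). x' = x \<longrightarrow> y \<in> U) uniformity)"

instance
proof
  fix x y z :: l2 and a b :: real and U :: "l2 set"
  show "x + y + z = x + (y + z)"
    by transfer (auto simp: l2_eq_def add.assoc intro!: square_integrable_add)
  show "x + y = y + x"
    by transfer (auto simp: l2_eq_def add.commute intro!: square_integrable_add)
  show "0 + x = x"
    by transfer (auto simp: l2_eq_def)
  show "- x + x = 0"
    by transfer (auto simp: l2_eq_def square_integrable_zero)
  show "x - y = x + - y"
    by transfer (auto simp: l2_eq_def intro!: square_integrable_diff)
  show "a *\<^sub>R (x + y) = a *\<^sub>R x + a *\<^sub>R y"
    by transfer (auto simp: l2_eq_def algebra_simps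
        intro!: square_integrable_add square_integrable_scale)
  show "(a + b) *\<^sub>R x = a *\<^sub>R x + b *\<^sub>R x"
    by transfer (auto simp: l2_eq_def algebra_simps
        intro!: square_integrable_add square_integrable_scale)
  show "a *\<^sub>R b *\<^sub>R x = (a * b) *\<^sub>R x"
    by transfer (auto simp: l2_eq_def mult.assoc intro!: square_integrable_scale)
  show "1 *\<^sub>R x = x"
    by transfer (auto simp: l2_eq_def)
  show "dist x y = norm (x - y)"
    by (rule dist_l2_def)
  show "sgn x = inverse (norm x) *\<^sub>R x"
    by (rule sgn_l2_def)
  show "uniformity = (INF e\<in>{0<..}. principal {(x :: l2, y). dist x y < e})"
    by (rule uniformity_l2_def)
  show "open U \<longleftrightarrow> (\<forall>x\<in>U. eventually (\<lambda>(x', y). x' = x \<longrightarrow> y \<in> U) uniformity)"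
    by (rule open_l2_def)
  show "inner x y = inner y x"
    by transfer (simp add: mult.commute)
  show "inner (x + y) z = inner x z + inner y z"
    by transfer (simp add: l2_eq_def square_integrable_mult distrib_right)
  show "inner (a *\<^sub>R x) y = a * inner x y"
    by transfer (simp add: l2_eq_def square_integrable_mult mult.assoc)
  show "0 \<le> inner x x"
    by transfer simp
  show "inner x x = 0 \<longleftrightarrow> x = 0"
  proof transfer
    fix f assume "l2_eq f f"
    then have f: "square_integrable unit_lborel f"
      by (simp add: l2_eq_def)
    then have "(LINT w|unit_lborel. f w * f w) = 0 \<longleftrightarrow> (AE w in unit_lborel. f w * f w = 0)"
      by (intro integral_nonneg_eq_0_iff_AE square_integrable_mult) auto
    then show "(LINT w|unit_lborel. f w * f w) = 0 \<longleftrightarrow> l2_eq f (\<lambda>w. 0)"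
      using f by (simp add: l2_eq_def square_integrable_zero)
  qed
  show "norm x = sqrt (inner x x)"
    by (rule norm_l2_def)
qed

end

section \<open>Convex analysis and evolution equations\<close>

text \<open>
  The library's \<open>closest_point\<close> is restricted to locally compact spaces. The minimiser is unique
  when \<open>S\<close> is a nonempty closed convex subset of a Hilbert space.
\<close>

definition metric_proj :: "'a::real_inner set \<Rightarrow> 'a \<Rightarrow> 'a" where
  "metric_proj S x = (THE p. p \<in> S \<and> (\<forall>z\<in>S. dist x p \<le> dist x z))"

definition orth_proj :: "'a::real_inner set \<Rightarrow> 'a \<Rightarrow> 'a" where
  "orth_proj S x = (THE p. p \<in> S \<and> (\<forall>z\<in>S. inner (x - p) z = 0))"

text \<open>Subdifferential of the function which is \<open>0\<close> on \<open>C\<close> and \<open>+\<infinity>\<close> elsewhere.\<close>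

definition subdiff_indicator :: "'a::real_inner set \<Rightarrow> 'a \<Rightarrow> 'a set" where
  "subdiff_indicator C x = (if x \<in> C then {\<xi>. \<forall>z\<in>C. inner \<xi> (z - x) \<le> 0} else {})"

definition abs_continuous_on :: "real set \<Rightarrow> (real \<Rightarrow> 'a::metric_space) \<Rightarrow> bool" where
  "abs_continuous_on I f \<longleftrightarrow>
    (\<forall>\<epsilon>>0. \<exists>\<delta>>0. \<forall>(n::nat) a b.
      (\<forall>i<n. a i \<le> b i \<and> {a i..b i} \<subseteq> I) \<longrightarrow>
      (\<forall>i<n. \<forall>j<n. i \<noteq> j \<longrightarrow> {a i<..<b i} \<inter> {a j<..<b j} = {}) \<longrightarrow>
      (\<Sum>i<n. b i - a i) < \<delta> \<longrightarrow>
      (\<Sum>i<n. dist (f (a i)) (f (b i))) < \<epsilon>)"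

text \<open>
  Strong solutions on \<open>[0, \<infinity>)\<close> of a differential inclusion \<open>dX/dt \<in> F t (X t)\<close>, written with a
  relation \<open>R t x d\<close> between time, state and velocity. Only the values of \<open>X\<close> on \<open>[0, \<infinity>)\<close> matter.
\<close>

definition strong_solution ::
  "(real \<Rightarrow> 'a \<Rightarrow> 'a \<Rightarrow> bool) \<Rightarrow> (real \<Rightarrow> 'a::real_normed_vector) \<Rightarrow> bool" where
  "strong_solution R X \<longleftrightarrow>
    (\<forall>T>0. abs_continuous_on {0..T} X) \<and>
    (AE t in lborel. t > 0 \<longrightarrow> (\<exists>D. (X has_vector_derivative D) (at t) \<and> R t (X t) D))"

definition unique_forward :: "((real \<Rightarrow> 'a) \<Rightarrow> bool) \<Rightarrow> (real \<Rightarrow> 'a) \<Rightarrow> bool" where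
  "unique_forward P X \<longleftrightarrow> P X \<and> (\<forall>Y. P Y \<longrightarrow> (\<forall>t\<ge>0. Y t = X t))"

definition right_deriv :: "(real \<Rightarrow> 'a::real_normed_vector) \<Rightarrow> real \<Rightarrow> 'a" where
  "right_deriv X t = vector_derivative X (at t within {t..})"

section \<open>The cone of nondecreasing functions\<close>

definition cone_K :: "l2 set" where
  "cone_K = {abs_l2 f | f. square_integrable unit_lborel f \<and> mono_on {0<..<1} f}"

definition ess_constant :: "l2 \<Rightarrow> real set \<Rightarrow> bool" where
  "ess_constant x I \<longleftrightarrow> (\<exists>c. AE w in unit_lborel. w \<in> I \<longrightarrow> rep_l2 x w = c)"

text \<open>
  For \<open>x\<close> in the cone, the right-continuous nondecreasing representative of \<open>x\<close> is constant on an
  open interval iff \<open>x\<close> is essentially constant there.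
\<close>

definition sub_H :: "l2 \<Rightarrow> l2 set" where
  "sub_H x = {y. \<forall>a b. 0 \<le> a \<and> a < b \<and> b \<le> 1 \<and> ess_constant x {a<..<b}
     \<longrightarrow> ess_constant y {a<..<b}}"

section \<open>Measures on the real line\<close>

definition P2 :: "real measure set" where
  "P2 = {\<rho>. prob_space \<rho> \<and> sets \<rho> = sets borel \<and> integrable \<rho> (\<lambda>x. x\<^sup>2)}"

definition couplings :: "real measure \<Rightarrow> real measure \<Rightarrow> (real \<times> real) measure set" where
  "couplings \<rho>1 \<rho>2 = {\<gamma>. sets \<gamma> = sets (borel \<Otimes>\<^sub>M borel)
     \<and> distr \<gamma> borel fst = \<rho>1 \<and> distr \<gamma> borel snd = \<rho>2}"

definition W2 :: "real measure \<Rightarrow> real measure \<Rightarrow> real" where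
  "W2 \<rho>1 \<rho>2 = sqrt (INF \<gamma>\<in>couplings \<rho>1 \<rho>2. LINT p|\<gamma>. (fst p - snd p)\<^sup>2)"

definition rearr :: "real measure \<Rightarrow> real \<Rightarrow> real" where
  "rearr \<rho> w = Inf {x. measure \<rho> {..x} > w}"

definition rearr_l2 :: "real measure \<Rightarrow> l2" where
  "rearr_l2 \<rho> = abs_l2 (rearr \<rho>)"

definition lagrangian_velocity :: "real measure \<Rightarrow> (real \<Rightarrow> real) \<Rightarrow> l2" where
  "lagrangian_velocity \<rho> v = abs_l2 (v \<circ> rearr \<rho>)"

text \<open>
  Signed Borel measures are represented by their set functions, with value \<open>0\<close> on sets that are not
  Borel. A countably additive real-valued set function has finite total variation.
\<close>

type_synonym signed_measure = "real set \<Rightarrow> real"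

definition signed_measures :: "signed_measure set" where
  "signed_measures = {m. (\<forall>B. B \<notin> sets borel \<longrightarrow> m B = 0) \<and>
     (\<forall>A :: nat \<Rightarrow> real set. range A \<subseteq> sets borel \<longrightarrow> disjoint_family A
        \<longrightarrow> (\<lambda>n. m (A n)) sums m (\<Union>n. A n))}"

text \<open>Positive variation, the negative one being that of \<open>-m\<close> (Jordan decomposition).\<close>

definition pos_variation :: "signed_measure \<Rightarrow> real measure" where
  "pos_variation m =
     measure_of UNIV (sets borel) (\<lambda>B. SUP A\<in>{A \<in> sets borel. A \<subseteq> B}. ennreal (m A))"

definition signed_integral :: "signed_measure \<Rightarrow> (real \<Rightarrow> real) \<Rightarrow> real" where
  "signed_integral m \<phi> =
     (LINT x|pos_variation m. \<phi> x) - (LINT x|pos_variation (\<lambda>B. - m B). \<phi> x)"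

definition weak_conv_signed :: "(nat \<Rightarrow> signed_measure) \<Rightarrow> signed_measure \<Rightarrow> bool" where
  "weak_conv_signed M m \<longleftrightarrow>
     (\<forall>\<phi>. continuous_on UNIV \<phi> \<and> bounded (range \<phi>) \<longrightarrow>
        (\<lambda>n. signed_integral (M n) \<phi>) \<longlonglongrightarrow> signed_integral m \<phi>)"

text \<open>The signed measure \<open>\<rho> v\<close>.\<close>

definition momentum :: "real measure \<Rightarrow> (real \<Rightarrow> real) \<Rightarrow> signed_measure" where
  "momentum \<rho> v = (\<lambda>B. if B \<in> sets borel then (LINT x:B|\<rho>. v x) else 0)"

type_synonym state = "real measure \<times> signed_measure"

definition V2 :: "state set" where
  "V2 = {(\<rho>, m). \<rho> \<in> P2 \<and> m \<in> signed_measures \<and>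
     (\<exists>v. square_integrable \<rho> v \<and> m = momentum \<rho> v)}"

text \<open>The density is determined \<open>\<rho>\<close>-almost everywhere, so the choice is immaterial below.\<close>

definition velocity :: "state \<Rightarrow> real \<Rightarrow> real" where
  "velocity \<mu> = (SOME v. square_integrable (fst \<mu>) v \<and> snd \<mu> = momentum (fst \<mu>) v)"

definition D2 :: "state \<Rightarrow> state \<Rightarrow> real" where
  "D2 \<mu>1 \<mu>2 = sqrt ((W2 (fst \<mu>1) (fst \<mu>2))\<^sup>2 +
     (LINT w|unit_lborel. (velocity \<mu>1 (rearr (fst \<mu>1) w) - velocity \<mu>2 (rearr (fst \<mu>2) w))\<^sup>2))"

section \<open>The sticky particle semigroup\<close>

definition discrete_state ::
  "nat \<Rightarrow> (nat \<Rightarrow> real) \<Rightarrow> (nat \<Rightarrow> real) \<Rightarrow> (nat \<Rightarrow> real) \<Rightarrow> state" where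
  "discrete_state N m x v =
    (distr (point_measure {..<N} (\<lambda>i. ennreal (m i))) borel x,
     \<lambda>B. if B \<in> sets borel then (\<Sum>i<N. m i * v i * indicator B (x i)) else 0)"

definition discrete_data ::
  "nat \<Rightarrow> (nat \<Rightarrow> real) \<Rightarrow> (nat \<Rightarrow> real) \<Rightarrow> bool" where
  "discrete_data N m x \<longleftrightarrow>
    (\<forall>i<N. m i > 0) \<and> (\<Sum>i<N. m i) = 1 \<and> (\<forall>i<N. \<forall>j<N. i < j \<longrightarrow> x i < x j)"

definition cluster :: "nat \<Rightarrow> (nat \<Rightarrow> real \<Rightarrow> real) \<Rightarrow> nat \<Rightarrow> real \<Rightarrow> nat set" where
  "cluster N x i t = {j. j < N \<and> x j t = x i t}"

definition collision_times :: "nat \<Rightarrow> (nat \<Rightarrow> real \<Rightarrow> real) \<Rightarrow> real set" where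
  "collision_times N x =
    {t. t > 0 \<and> (\<exists>i<N. \<forall>s. 0 \<le> s \<and> s < t \<longrightarrow> cluster N x i s \<subset> cluster N x i t)}"

text \<open>
  \<open>x i t\<close> and \<open>v i t\<close> are the position and the velocity of particle \<open>i < N\<close> at time \<open>t \<ge> 0\<close>.
  Since \<open>v i\<close> is right-continuous, \<open>v i t\<close> is the outgoing velocity at a collision time \<open>t\<close>.
\<close>

definition sticky_trajectories ::
  "nat \<Rightarrow> (nat \<Rightarrow> real) \<Rightarrow> (nat \<Rightarrow> real) \<Rightarrow> (nat \<Rightarrow> real)
    \<Rightarrow> (nat \<Rightarrow> real \<Rightarrow> real) \<Rightarrow> (nat \<Rightarrow> real \<Rightarrow> real) \<Rightarrow> bool" where
  "sticky_trajectories N m x0 v0 x v \<longleftrightarrow>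
    (\<forall>i<N. x i 0 = x0 i \<and> v i 0 = v0 i \<and> continuous_on {0..} (x i)) \<and>
    (\<forall>i<N. \<forall>t\<ge>0. (x i has_real_derivative v i t) (at t within {t..})
        \<and> continuous (at_right t) (v i)) \<and>
    (\<forall>i<N. \<forall>j<N. \<forall>t\<ge>0. i \<le> j \<longrightarrow> x i t \<le> x j t) \<and>
    (\<forall>i<N. \<forall>s t. 0 \<le> s \<and> s \<le> t \<longrightarrow> cluster N x i s \<subseteq> cluster N x i t) \<and>
    finite (collision_times N x) \<and>
    (\<forall>i<N. \<forall>s t. 0 \<le> s \<and> s \<le> t \<and> {s<..t} \<inter> collision_times N x = {} \<longrightarrow>
        v i t = v i s \<and> x i t = x i s + (t - s) * v i s) \<and>
    (\<forall>i<N. \<forall>t\<in>collision_times N x.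
        v i t = (\<Sum>j\<in>cluster N x i t. m j * Lim (at_left t) (v j))
                  / (\<Sum>j\<in>cluster N x i t. m j))"

text \<open>
  The semigroup is the unique strongly-weakly continuous extension to \<^term>\<open>V2\<close> of the
  discrete evolution. It is made a total function by fixing its value outside its domain.
\<close>

definition is_sticky_semigroup :: "(real \<Rightarrow> state \<Rightarrow> state) \<Rightarrow> bool" where
  "is_sticky_semigroup S \<longleftrightarrow>
    (\<forall>t\<ge>0. \<forall>\<mu>\<in>V2. S t \<mu> \<in> V2) \<and>
    (\<forall>t \<mu>. \<not> (t \<ge> 0 \<and> \<mu> \<in> V2) \<longrightarrow> S t \<mu> = undefined) \<and>
    (\<forall>N m x0 v0 x v. discrete_data N m x0 \<and> sticky_trajectories N m x0 v0 x v \<longrightarrow>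
       (\<forall>t\<ge>0. S t (discrete_state N m x0 v0)
                = discrete_state N m (\<lambda>i. x i t) (\<lambda>i. v i t))) \<and>
    (\<forall>t\<ge>0. \<forall>\<mu>n. \<forall>\<mu>\<in>V2. (\<forall>n. \<mu>n n \<in> V2) \<and> (\<lambda>n. D2 (\<mu>n n) \<mu>) \<longlonglongrightarrow> 0 \<longrightarrow>
       (\<lambda>n. W2 (fst (S t (\<mu>n n))) (fst (S t \<mu>))) \<longlonglongrightarrow> 0 \<and>
       weak_conv_signed (\<lambda>n. snd (S t (\<mu>n n))) (snd (S t \<mu>)))"

definition sticky_semigroup :: "real \<Rightarrow> state \<Rightarrow> state" where
  "sticky_semigroup = (THE S. is_sticky_semigroup S)"

section \<open>The three characterizations\<close>

definition subdiff_flow_solution :: "l2 \<Rightarrow> l2 \<Rightarrow> (real \<Rightarrow> l2) \<Rightarrow> bool" where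
  "subdiff_flow_solution X0 V0 X \<longleftrightarrow>
    strong_solution (\<lambda>t x D. D \<in> {- \<xi> + V0 | \<xi>. \<xi> \<in> subdiff_indicator cone_K x}) X \<and> X 0 = X0"

definition proj_formula :: "l2 \<Rightarrow> l2 \<Rightarrow> (real \<Rightarrow> l2) \<Rightarrow> bool" where
  "proj_formula X0 V0 X \<longleftrightarrow> (\<forall>t\<ge>0. X t = metric_proj cone_K (X0 + t *\<^sub>R V0))"

definition rescaled_flow_solution :: "l2 \<Rightarrow> l2 \<Rightarrow> (real \<Rightarrow> l2) \<Rightarrow> bool" where
  "rescaled_flow_solution X0 V0 X \<longleftrightarrow>
    strong_solution
      (\<lambda>t x D. t *\<^sub>R D \<in> {- \<xi> + x - X0 | \<xi>. \<xi> \<in> subdiff_indicator cone_K x}) X \<and>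
    ((\<lambda>t. inverse t *\<^sub>R (X t - X0)) \<longlongrightarrow> V0) (at_right 0)"

end

theory Submission
  imports Defs
begin

text \<open>
  Write \<open>K\<close> for the cone, \<open>H\<^sub>X\<close> for the functions constant where \<open>X\<close> is, and \<open>P\<^sub>X\<close> for the projection
  onto \<open>H\<^sub>X\<close>. Four facts about \<open>X \<in> K\<close> drive the evolution: \<open>P\<^sub>X\<close> maps \<open>K\<close> into itself; \<open>P\<^sub>X Z - Z\<close> is in
  the polar cone of \<open>K\<close> for \<open>Z \<in> K\<close> (Chebyshev's inequality on each level set); \<open>H\<^sub>X\<close> is the closure of
  the directions \<open>Y\<close> with \<open>X \<plusminus> \<epsilon>Y \<in> K\<close> for some \<open>\<epsilon> > 0\<close>; hence normal vectors to \<open>K\<close> at \<open>X\<close> are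
  orthogonal to \<open>H\<^sub>X\<close>. With \<open>X(t)\<close> the projection of \<open>X\<^sub>0 + tV\<^sub>0\<close> and \<open>V(t)\<close> that of \<open>V\<^sub>0\<close> onto
  \<open>H\<^sub>X\<^sub>(\<^sub>t\<^sub>)\<close>, they show that the projection of \<open>X(s) + (t - s)V(s)\<close> lies in \<open>H\<^sub>X\<^sub>(\<^sub>s\<^sub>)\<close> and equals \<open>X(t)\<close>.
  Since \<open>|V|\<close> is nonincreasing, it is continuous off a countable set, where \<open>X\<close> is differentiable,
  and both inclusions hold because \<open>V\<^sub>0 - V(t)\<close> and \<open>P\<^sub>X\<^sub>(\<^sub>t\<^sub>)X\<^sub>0 - X\<^sub>0\<close> are normal to \<open>K\<close> at \<open>X(t)\<close>.

  A state \<open>(\<rho>, \<rho>v)\<close> corresponds to the pair \<open>(X\<^sub>\<rho>, v \<circ> X\<^sub>\<rho>)\<close>; in these coordinates \<open>W\<^sub>2\<close> and \<open>D\<^sub>2\<close> are \<open>L\<^sup>2\<close>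
  distances, and the momentum of \<open>(X(t), V(t))\<close> is already determined by \<open>V\<^sub>0\<close>, which yields the
  strong-weak continuity. For discrete data \<open>X\<^sub>0 + tV\<^sub>0 - X(t)\<close> is a nonnegative combination of the velocity
  jumps, each of which is in the polar cone because of two colliding particles the left one is faster.
\<close>

section \<open>Completeness of \<open>L\<^sup>2(0,1)\<close>\<close>

text \<open>The semigroup is given by a definite description, so existence and uniqueness of the
  extension are both at stake. Two extensions are known to agree on a discrete datum only if sticky
  trajectories start from it; these are therefore produced for every discrete datum, as coordinates
  of the projected flow of step functions rather than collision by collision.

  In limits the velocity is seen only through the momentum. It is recovered because elements of
  \<open>sub_H x\<close> are functions of \<open>x\<close>, and functions of \<open>x\<close> are
  tested by one family, the cutoffs of \<open>x\<close>: being Lipschitz they are feasible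
  directions at \<open>x\<close> in both senses, and being bounded and continuous they are
  admissible in weak convergence.

  Uniqueness for both inclusions is reduced to scalar absolutely continuous functions whose
  derivative is nonpositive almost everywhere. That these are nonincreasing is proved directly with
  a gauge, so that no Hilbert space valued curve is ever integrated.\<close>

lemma prob_space_unit_lborel: "prob_space unit_lborel"
  by (auto simp: unit_lborel_def emeasure_restrict_space space_restrict_space intro!: prob_spaceI)

interpretation U: prob_space unit_lborel
  by (rule prob_space_unit_lborel)

lemma space_unit_lborel [simp]: "space unit_lborel = {0<..<1}"
  by (simp add: unit_lborel_def space_restrict_space)

lemma sets_unit_lborel: "A \<in> sets unit_lborel \<longleftrightarrow> A \<in> sets borel \<and> A \<subseteq> {0<..<1}"
  by (auto simp: unit_lborel_def sets_restrict_space_iff)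

lemma borel_imp_measurable_unit_lborel:
  "f \<in> borel_measurable borel \<Longrightarrow> f \<in> borel_measurable unit_lborel"
  unfolding unit_lborel_def by (rule measurable_restrict_space1) simp

lemma id_measurable_unit_lborel [measurable]: "(\<lambda>w. w) \<in> borel_measurable unit_lborel"
  by (rule borel_imp_measurable_unit_lborel) simp

lemma mono_on_imp_measurable_unit_lborel:
  "mono_on {0<..<1} f \<Longrightarrow> f \<in> borel_measurable unit_lborel" for f :: "real \<Rightarrow> real"
  using borel_measurable_mono_on_fnc[of "{0<..<1}" f]
  by (simp add: unit_lborel_def cong: measurable_cong_sets restrict_space_sets_cong)

lemma AE_unit_lborel_iff: "(AE w in unit_lborel. P w) \<longleftrightarrow> (AE w in lborel. w \<in> {0<..<1} \<longrightarrow> P w)"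
  unfolding unit_lborel_def by (subst AE_restrict_space_iff) auto

lemma AE_unit_lborel_neq: "AE w in unit_lborel. w \<noteq> c"
  using AE_lborel_singleton[of c] by (simp add: AE_unit_lborel_iff eventually_mono)

lemma emeasure_unit_lborel_interval:
  assumes "0 \<le> a" "a \<le> b" "b \<le> 1"
  shows "emeasure unit_lborel {a<..<b} = ennreal (b - a)"
  using assms by (simp add: unit_lborel_def emeasure_restrict_space subset_iff)

section \<open>Stability of square integrability\<close>

lemma square_integrable_cong_AE:
  assumes "square_integrable M f" "g \<in> borel_measurable M" "AE w in M. f w = g w"
  shows "square_integrable M g"
proof -
  have "AE w in M. (f w)\<^sup>2 = (g w)\<^sup>2"
    using assms(3) by eventually_elim simp
  then show ?thesis
    using assms integrable_cong_AE_imp[of M "\<lambda>w. (f w)\<^sup>2" "\<lambda>w. (g w)\<^sup>2"]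
    by (auto simp: square_integrable_def)
qed

lemma (in finite_measure) square_integrable_bounded:
  assumes "f \<in> borel_measurable M" "AE w in M. \<bar>f w\<bar> \<le> B"
  shows "square_integrable M f"
proof -
  have "AE w in M. norm ((f w)\<^sup>2) \<le> B\<^sup>2"
    using assms(2)
  proof eventually_elim
    case (elim w)
    then show ?case
      using power_mono[of "\<bar>f w\<bar>" B 2] by simp
  qed
  then have "integrable M (\<lambda>w. (f w)\<^sup>2)"
    using assms(1) by (intro integrable_const_bound[where B="B\<^sup>2"]) auto
  then show ?thesis
    using assms(1) by (simp add: square_integrable_def)
qed

lemma (in finite_measure) square_integrable_const: "square_integrable M (\<lambda>w. c)"
  by (rule square_integrable_bounded[of _ "\<bar>c\<bar>"]) auto

lemma (in finite_measure) integrable_of_square_integrable: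
  assumes "square_integrable M f"
  shows "integrable M f"
  using square_integrable_mult[OF assms square_integrable_const[of 1]] by simp

lemma square_integrable_mult_indicator:
  assumes "square_integrable M f" "g \<in> borel_measurable M" "\<And>w. \<bar>g w\<bar> \<le> B"
  shows "square_integrable M (\<lambda>w. f w * g w)"
proof -
  have "0 \<le> B" using assms(3)[of undefined] by linarith
  have "integrable M (\<lambda>w. (f w * g w)\<^sup>2)"
  proof (rule Bochner_Integration.integrable_bound)
    show "integrable M (\<lambda>w. B\<^sup>2 * (f w)\<^sup>2)"
      using assms by (auto simp: square_integrable_def)
    have "(f w * g w)\<^sup>2 \<le> B\<^sup>2 * (f w)\<^sup>2" for w
      using power_mono[OF assms(3)[of w], of 2] 
      by (simp add: power_mult_distrib mult.commute[of "(f w)\<^sup>2"] mult_right_mono)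
    then show "AE w in M. norm ((f w * g w)\<^sup>2) \<le> norm (B\<^sup>2 * (f w)\<^sup>2)"
      by (simp add: abs_mult)
  qed (use assms in \<open>auto simp: square_integrable_def\<close>)
  then show ?thesis
    using assms by (auto simp: square_integrable_def)
qed

section \<open>Classes in \<open>L^2(0,1)\<close> and their representatives\<close>

abbreviation "sq \<equiv> square_integrable unit_lborel"

lemma sq_rep_l2 [simp, intro]: "sq (rep_l2 x)"
  using Quotient3_rep_reflp[OF Quotient3_l2, of x] by (simp add: l2_eq_def)

lemma rep_l2_measurable [measurable]: "rep_l2 x \<in> borel_measurable unit_lborel"
  using sq_rep_l2[of x] by (simp add: square_integrable_def del: sq_rep_l2)

lemma abs_rep_l2 [simp]: "abs_l2 (rep_l2 x) = x"
  by (rule Quotient3_abs_rep[OF Quotient3_l2])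

lemma abs_l2_eq_iff:
  assumes "sq f" "sq g"
  shows "abs_l2 f = abs_l2 g \<longleftrightarrow> (AE w in unit_lborel. f w = g w)"
  using Quotient3_rel[OF Quotient3_l2, of f g] assms by (auto simp: l2_eq_def)

lemma rep_abs_l2: "sq f \<Longrightarrow> AE w in unit_lborel. rep_l2 (abs_l2 f) w = f w"
  using abs_l2_eq_iff[of "rep_l2 (abs_l2 f)" f] by simp

lemma abs_l2_add: "sq f \<Longrightarrow> sq g \<Longrightarrow> abs_l2 f + abs_l2 g = abs_l2 (\<lambda>w. f w + g w)"
  by (rule plus_l2.abs_eq) (simp_all add: l2_eq_def)
lemma abs_l2_diff: "sq f \<Longrightarrow> sq g \<Longrightarrow> abs_l2 f - abs_l2 g = abs_l2 (\<lambda>w. f w - g w)"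
  by (rule minus_l2.abs_eq) (simp_all add: l2_eq_def)
lemma abs_l2_scaleR: "sq f \<Longrightarrow> c *\<^sub>R abs_l2 f = abs_l2 (\<lambda>w. c * f w)"
  by (rule scaleR_l2.abs_eq) (simp_all add: l2_eq_def)
lemma abs_l2_inner: "sq f \<Longrightarrow> sq g \<Longrightarrow> inner (abs_l2 f) (abs_l2 g) = (LINT w|unit_lborel. f w * g w)"
  by (rule inner_l2.abs_eq) (simp_all add: l2_eq_def)
lemma abs_l2_zero: "abs_l2 (\<lambda>w. 0) = 0"
  by (rule zero_l2.abs_eq[symmetric])

lemma abs_l2_norm: "sq f \<Longrightarrow> (norm (abs_l2 f))\<^sup>2 = (LINT w|unit_lborel. (f w)\<^sup>2)"
  unfolding power2_norm_eq_inner by (simp add: abs_l2_inner power2_eq_square)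

lemma inner_rep_l2: "inner x y = (LINT w|unit_lborel. rep_l2 x w * rep_l2 y w)"
  using abs_l2_inner[of "rep_l2 x" "rep_l2 y"] by simp

lemma rep_l2_diff: "AE w in unit_lborel. rep_l2 (x - y) w = rep_l2 x w - rep_l2 y w"
  using rep_abs_l2[OF square_integrable_diff[OF sq_rep_l2 sq_rep_l2], of x y] abs_l2_diff[of "rep_l2 x" "rep_l2 y"]
  by simp
text \<open>Cauchy-Schwarz against the constant \<open>1\<close>, whose norm is one because the
  interval has length one. It makes results on \<open>L^1\<close> convergence available for norm
  convergence.\<close>

lemma integral_abs_le_norm: "(LINT w|unit_lborel. \<bar>rep_l2 x w\<bar>) \<le> norm x"
proof -
  have a: "sq (\<lambda>w. \<bar>rep_l2 x w\<bar>)"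
    using sq_rep_l2[of x] by (simp add: square_integrable_def)
  have one: "sq (\<lambda>w. 1)"
    by (rule U.square_integrable_const)
  have "(norm (abs_l2 (\<lambda>w. \<bar>rep_l2 x w\<bar>)))\<^sup>2 = (norm x)\<^sup>2"
    using abs_l2_norm[OF a] abs_l2_norm[OF sq_rep_l2[of x]] by simp
  then have 1: "norm (abs_l2 (\<lambda>w. \<bar>rep_l2 x w\<bar>)) = norm x"
    by simp
  have "(norm (abs_l2 (\<lambda>w. 1)))\<^sup>2 = 1"
    using abs_l2_norm[OF one] U.prob_space by simp
  then have 2: "norm (abs_l2 (\<lambda>w. 1)) = 1"
    using norm_ge_zero[of "abs_l2 (\<lambda>w. 1)"] unfolding power2_eq_1_iff by linarith
  have "(LINT w|unit_lborel. \<bar>rep_l2 x w\<bar>) = inner (abs_l2 (\<lambda>w. \<bar>rep_l2 x w\<bar>)) (abs_l2 (\<lambda>w. 1))"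
    by (simp add: abs_l2_inner[OF a one])
  also have "\<dots> \<le> norm x"
    using norm_cauchy_schwarz[of "abs_l2 (\<lambda>w. \<bar>rep_l2 x w\<bar>)" "abs_l2 (\<lambda>w. 1)"] 1 2 by simp
  finally show ?thesis .
qed

lemma l2_tendsto_AE_subseq:
  fixes x :: "nat \<Rightarrow> l2"
  assumes "x \<longlonglongrightarrow> y"
  obtains r where "strict_mono (r :: nat \<Rightarrow> nat)"
    "AE w in unit_lborel. (\<lambda>n. rep_l2 (x (r n)) w) \<longlonglongrightarrow> rep_l2 y w"
proof -
  have n0: "(\<lambda>n. norm (x n - y)) \<longlonglongrightarrow> 0"
    using assms by (simp add: tendsto_norm_zero_iff LIM_zero)
  have le: "(LINT w|unit_lborel. \<bar>rep_l2 (x n) w - rep_l2 y w\<bar>) \<le> norm (x n - y)" for n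
  proof -
    have "(LINT w|unit_lborel. \<bar>rep_l2 (x n) w - rep_l2 y w\<bar>) = (LINT w|unit_lborel. \<bar>rep_l2 (x n - y) w\<bar>)"
      by (rule integral_cong_AE) (use rep_l2_diff[of "x n" y] in \<open>auto elim: eventually_mono\<close>)
    then show ?thesis using integral_abs_le_norm by simp
  qed
  have "(\<lambda>n. LINT w|unit_lborel. norm (rep_l2 (x n) w - rep_l2 y w)) \<longlonglongrightarrow> 0"
    by (rule tendsto_sandwich[OF _ _ tendsto_const n0])
      (intro always_eventually allI, simp, intro always_eventually allI, simp add: le)
  moreover have "integrable unit_lborel (\<lambda>w. rep_l2 (x n) w - rep_l2 y w)" for n
    by (intro Bochner_Integration.integrable_diff U.integrable_of_square_integrable sq_rep_l2)
  ultimately obtain r where r: "strict_mono r"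
    "AE w in unit_lborel. (\<lambda>n. rep_l2 (x (r n)) w - rep_l2 y w) \<longlonglongrightarrow> 0"
    using tendsto_L1_AE_subseq[of unit_lborel "\<lambda>n w. rep_l2 (x n) w - rep_l2 y w"] by auto
  show ?thesis
    by (rule that[OF r(1)]) (use r(2) in \<open>auto simp: LIM_zero_iff\<close>)
qed

text \<open>Riesz-Fischer: a subsequence with summable \<open>L^1\<close> increments converges
  almost everywhere, and Fatou's lemma upgrades the pointwise limit to a limit in norm. Existence of
  all projections below rests on this.\<close>

instance l2 :: complete_space
proof
  fix X :: "nat \<Rightarrow> l2" assume C: "Cauchy X"
  have "\<exists>N. \<forall>m\<ge>N. \<forall>n\<ge>N. norm (X m - X n) < (1/2) ^ k" for k
    using C unfolding Cauchy_def dist_norm by (metis zero_less_divide_1_iff zero_less_numeral zero_less_power)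
  then obtain N where N: "\<And>k m n. m \<ge> N k \<Longrightarrow> n \<ge> N k \<Longrightarrow> norm (X m - X n) < (1/2) ^ k"
    by metis
  \<comment> \<open>Partial sums make \<open>r\<close> nondecreasing, so \<open>r n\<close> exceeds
    \<open>N k\<close> for every \<open>n \<ge> k\<close>, which is what the bound along the tail
    uses.\<close>
  define r where "r k = (\<Sum>i\<le>k. N i)" for k
  have rN: "r k \<ge> N k" for k
    unfolding r_def by (simp add: member_le_sum)
  have rS: "r (Suc k) \<ge> N k" for k
    using rN[of k] by (simp add: r_def)
  define d where "d k w = \<bar>rep_l2 (X (r (Suc k))) w - rep_l2 (X (r k)) w\<bar>" for k w
  have d_meas [measurable]: "d k \<in> borel_measurable unit_lborel" for k
    unfolding d_def by measurable
  have "(\<integral>\<^sup>+w. ennreal (d k w) \<partial>unit_lborel) \<le> ennreal ((1/2)^k)" for k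
  proof -
    have "(\<integral>\<^sup>+w. ennreal (d k w) \<partial>unit_lborel) = ennreal (LINT w|unit_lborel. d k w)"
      unfolding d_def
      by (intro nn_integral_eq_integral Bochner_Integration.integrable_abs Bochner_Integration.integrable_diff
          U.integrable_of_square_integrable sq_rep_l2) auto
    also have "(LINT w|unit_lborel. d k w) = (LINT w|unit_lborel. \<bar>rep_l2 (X (r (Suc k)) - X (r k)) w\<bar>)"
      unfolding d_def
      by (rule integral_cong_AE) (use rep_l2_diff[of "X (r (Suc k))" "X (r k)"] in \<open>auto elim: eventually_mono\<close>)
    also have "\<dots> \<le> (1/2)^k"
      using integral_abs_le_norm[of "X (r (Suc k)) - X (r k)"] N[OF rS rN, of k] by linarith
    finally show ?thesis by (simp add: ennreal_leI)
  qed
  then have "(\<Sum>k. \<integral>\<^sup>+w. ennreal (d k w) \<partial>unit_lborel) \<le> (\<Sum>k. ennreal ((1/2)^k))"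
    by (intro suminf_le) auto
  moreover have "(\<integral>\<^sup>+w. (\<Sum>k. ennreal (d k w)) \<partial>unit_lborel) = (\<Sum>k. \<integral>\<^sup>+w. ennreal (d k w) \<partial>unit_lborel)"
    by (rule nn_integral_suminf) measurable
  ultimately have "(\<integral>\<^sup>+w. (\<Sum>k. ennreal (d k w)) \<partial>unit_lborel) \<le> (\<Sum>k. ennreal ((1/2)^k))"
    by simp
  also have "(\<Sum>k. ennreal ((1/2)^k)) = ennreal (\<Sum>k. (1/2)^k)"
    by (intro suminf_ennreal2 summable_geometric) simp_all
  finally have "(\<integral>\<^sup>+w. (\<Sum>k. ennreal (d k w)) \<partial>unit_lborel) \<noteq> \<infinity>"
    using neq_top_trans[OF ennreal_neq_top] infinity_ennreal_def by metis
  then have "AE w in unit_lborel. (\<Sum>k. ennreal (d k w)) \<noteq> \<infinity>"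
    by (intro nn_integral_PInf_AE) auto
  then have conv: "AE w in unit_lborel. convergent (\<lambda>k. rep_l2 (X (r k)) w)"
  proof eventually_elim
    case (elim w)
    then have "summable (\<lambda>k. d k w)"
      by (intro summable_suminf_not_top) (auto simp: d_def)
    then have "summable (\<lambda>k. rep_l2 (X (r (Suc k))) w - rep_l2 (X (r k)) w)"
      unfolding d_def by (rule summable_rabs_cancel)
    then have "convergent (\<lambda>n. \<Sum>k<n. rep_l2 (X (r (Suc k))) w - rep_l2 (X (r k)) w)"
      by (simp add: summable_iff_convergent)
    then have "convergent (\<lambda>n. rep_l2 (X (r n)) w - rep_l2 (X (r 0)) w)"
      by (simp add: sum_lessThan_telescope[where f="\<lambda>k. rep_l2 (X (r k)) w"])
    from convergent_add[OF this convergent_const[of "rep_l2 (X (r 0)) w"]]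
    show ?case by simp
  qed
  define f where "f w = lim (\<lambda>k. rep_l2 (X (r k)) w)" for w
  have [measurable]: "f \<in> borel_measurable unit_lborel"
    unfolding f_def by measurable
  have lim: "AE w in unit_lborel. (\<lambda>k. rep_l2 (X (r k)) w) \<longlonglongrightarrow> f w"
    using conv by eventually_elim (simp add: f_def convergent_LIMSEQ_iff)
  \<comment> \<open>Fatou's lemma carries the Cauchy bound over to the limit. The bound being
    finite, it also yields that \<open>f\<close> is square integrable.\<close>
  have key: "(\<integral>\<^sup>+w. ennreal ((f w - rep_l2 (X m) w)\<^sup>2) \<partial>unit_lborel) \<le> ennreal (((1/2)^k)\<^sup>2)"
    if "m \<ge> N k" for m k
  proof -
    have "(\<integral>\<^sup>+w. ennreal ((f w - rep_l2 (X m) w)\<^sup>2) \<partial>unit_lborel)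
      = (\<integral>\<^sup>+w. liminf (\<lambda>n. ennreal ((rep_l2 (X (r n)) w - rep_l2 (X m) w)\<^sup>2)) \<partial>unit_lborel)"
    proof (rule nn_integral_cong_AE, use lim in eventually_elim)
      case (elim w)
      then have "(\<lambda>n. ennreal ((rep_l2 (X (r n)) w - rep_l2 (X m) w)\<^sup>2)) \<longlonglongrightarrow> ennreal ((f w - rep_l2 (X m) w)\<^sup>2)"
        by (intro tendsto_intros)
      from lim_imp_Liminf[OF _ this] show ?case
        by simp
    qed
    also have "\<dots> \<le> liminf (\<lambda>n. \<integral>\<^sup>+w. ennreal ((rep_l2 (X (r n)) w - rep_l2 (X m) w)\<^sup>2) \<partial>unit_lborel)"
      by (rule nn_integral_liminf) auto
    also have "\<dots> \<le> ennreal (((1/2)^k)\<^sup>2)"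
    proof (rule Liminf_le)
      show "\<forall>\<^sub>F n in sequentially. (\<integral>\<^sup>+w. ennreal ((rep_l2 (X (r n)) w - rep_l2 (X m) w)\<^sup>2) \<partial>unit_lborel) \<le> ennreal (((1/2)^k)\<^sup>2)"
        using eventually_ge_at_top[of k]
      proof eventually_elim
        case (elim n)
        have "r n \<ge> N k"
          using elim rN[of k] unfolding r_def
          by (meson atMost_subset_iff finite_atMost le_trans sum_mono2 zero_le)
        have s: "sq (\<lambda>w. rep_l2 (X (r n)) w - rep_l2 (X m) w)"
          by (intro square_integrable_diff sq_rep_l2)
        have "(\<integral>\<^sup>+w. ennreal ((rep_l2 (X (r n)) w - rep_l2 (X m) w)\<^sup>2) \<partial>unit_lborel)
          = ennreal (LINT w|unit_lborel. (rep_l2 (X (r n)) w - rep_l2 (X m) w)\<^sup>2)"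
          using s by (intro nn_integral_eq_integral) (auto simp: square_integrable_def)
        also have "\<dots> = ennreal ((norm (X (r n) - X m))\<^sup>2)"
          using abs_l2_norm[OF s] by (simp add: abs_l2_diff[symmetric])
        also have "\<dots> \<le> ennreal (((1/2)^k)\<^sup>2)"
          using N[OF \<open>r n \<ge> N k\<close> that] by (intro ennreal_leI power_mono) auto
        finally show ?case .
      qed
    qed simp
    finally show ?thesis .
  qed
  have fd: "sq (\<lambda>w. f w - rep_l2 (X m) w)" if "m \<ge> N k" for m k
    using key[OF that] unfolding square_integrable_def
    by (auto simp: integrable_iff_bounded top_unique intro: le_less_trans)
  have f: "sq f"
    using square_integrable_add[OF fd[OF order_refl, of 0] sq_rep_l2, of "X (N 0)"] by simp
  have "norm (abs_l2 f - X m) \<le> (1/2)^k" if "m \<ge> N k" for m k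
  proof -
    have "ennreal ((norm (abs_l2 f - X m))\<^sup>2) \<le> ennreal (((1/2)^k)\<^sup>2)"
    proof -
      have "(norm (abs_l2 f - X m))\<^sup>2 = (LINT w|unit_lborel. (f w - rep_l2 (X m) w)\<^sup>2)"
        using abs_l2_norm[OF fd[OF that]] abs_l2_diff[OF f sq_rep_l2[of "X m"]] by simp
      also have "ennreal \<dots> = (\<integral>\<^sup>+w. ennreal ((f w - rep_l2 (X m) w)\<^sup>2) \<partial>unit_lborel)"
        using fd[OF that] by (subst nn_integral_eq_integral) (auto simp: square_integrable_def)
      finally show ?thesis using key[OF that] by simp
    qed
    then show ?thesis
      by (simp add: power2_le_iff_abs_le)
  qed
  then have le: "dist (X m) (abs_l2 f) \<le> (1/2)^k" if "m \<ge> N k" for m k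
    using that by (simp only: dist_norm norm_minus_commute)
  have "\<exists>N. \<forall>m\<ge>N. dist (X m) (abs_l2 f) < e" if e: "e > 0" for e
  proof -
    obtain k where "(1/2::real)^k < e"
      using real_arch_pow_inv[OF e, of "1/2"] by auto
    then show ?thesis
      using le by (intro exI[of _ "N k"]) (metis le_less_trans)
  qed
  then have "X \<longlonglongrightarrow> abs_l2 f"
    by (simp add: lim_sequentially)
  then show "convergent X"
    by (auto simp: convergent_def)
qed

section \<open>Projections in Hilbert spaces and the cone of nondecreasing functions\<close>

lemma parallelogram_midpoint:
  fixes x p q :: "'a::real_inner"
  shows "(norm (p - q))\<^sup>2 = 2 * (norm (x - p))\<^sup>2 + 2 * (norm (x - q))\<^sup>2
    - 4 * (norm (x - (1/2) *\<^sub>R (p + q)))\<^sup>2"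
proof -
  have "(norm (p - q))\<^sup>2 + 4 * (norm (x - (1/2) *\<^sub>R (p + q)))\<^sup>2 = 2 * (norm (x - p))\<^sup>2 + 2 * (norm (x - q))\<^sup>2"
    by (simp add: power2_norm_eq_inner inner_simps inner_commute algebra_simps)
  then show ?thesis by simp
qed

lemma norm_diff_scaleR_square:
  fixes a b :: "'a::real_inner"
  shows "(norm (a - u *\<^sub>R b))\<^sup>2 = (norm a)\<^sup>2 - 2 * u * inner a b + u\<^sup>2 * (norm b)\<^sup>2"
proof -
  have "u\<^sup>2 * inner b b = u * (u * inner b b)" by (simp add: power2_eq_square)
  then show ?thesis
    by (simp add: power2_norm_eq_inner inner_simps inner_commute algebra_simps)
      (simp add: power2_eq_square)
qed

lemma convex_midpoint: "convex S \<Longrightarrow> p \<in> S \<Longrightarrow> q \<in> S \<Longrightarrow> (1/2) *\<^sub>R (p + q) \<in> S"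
  using convexD[of S p q "1/2" "1/2"] by (simp add: scaleR_right_distrib)

lemma convex_inner_le_of_nearest:
  fixes S :: "'a::real_inner set"
  assumes S: "convex S" and p: "p \<in> S" "\<And>z. z \<in> S \<Longrightarrow> dist x p \<le> dist x z" and z: "z \<in> S"
  shows "inner (x - p) (z - p) \<le> 0"
proof (rule ccontr)
  assume "\<not> ?thesis"
  then have pos: "inner (x - p) (z - p) > 0" by simp
  define a where "a = inner (x - p) (z - p)"
  define b where "b = (norm (z - p))\<^sup>2"
  have "z \<noteq> p" using pos by auto
  then have b: "b > 0" by (simp add: b_def)
  \<comment> \<open>The ratio \<open>a / b\<close> minimises the distance to \<open>x\<close> on the
    line through \<open>p\<close> and \<open>z\<close>; the cap at \<open>1\<close> keeps the
    competitor on the segment, hence in \<open>S\<close>.\<close>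
  define u where "u = min 1 (a / b)"
  have u: "0 < u" "u \<le> 1" "u * b \<le> a"
    using pos b unfolding u_def a_def[symmetric] by (auto simp: min_def field_simps)
  have "p + u *\<^sub>R (z - p) \<in> S"
    using convexD_alt[OF S p(1) z, of u] u by (simp add: algebra_simps)
  from p(2)[OF this] have "(norm (x - p))\<^sup>2 \<le> (norm ((x - p) - u *\<^sub>R (z - p)))\<^sup>2"
    by (simp add: dist_norm diff_diff_eq)
  also have "\<dots> = (norm (x - p))\<^sup>2 - 2 * u * a + u\<^sup>2 * b"
    unfolding a_def b_def by (rule norm_diff_scaleR_square)
  finally have "2 * u * a \<le> u * (u * b)" by (simp add: power2_eq_square)
  then have "2 * a \<le> u * b" using u by (simp add: mult.assoc mult.left_commute)
  then show False using u pos a_def by linarith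
qed

text \<open>Adding the two inequalities and applying Cauchy-Schwarz suffices. With
  \<open>x = y\<close> it gives uniqueness of the nearest point, in general nonexpansiveness of the
  projection.\<close>

lemma norm_diff_le_of_obtuse:
  fixes x y p q :: "'a::real_inner"
  assumes "inner (x - p) (q - p) \<le> 0" "inner (y - q) (p - q) \<le> 0"
  shows "norm (p - q) \<le> norm (x - y)"
proof -
  have "(norm (p - q))\<^sup>2 \<le> inner (x - y) (p - q)"
    using assms by (simp add: power2_norm_eq_inner inner_simps inner_commute algebra_simps)
  also have "\<dots> \<le> norm (x - y) * norm (p - q)"
    by (rule norm_cauchy_schwarz)
  finally show ?thesis
    by (cases "norm (p - q) = 0") (auto simp: power2_eq_square mult_le_cancel_right)
qed

lemma nearest_point_of_obtuse:
  fixes x p z :: "'a::real_inner"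
  assumes "inner (x - p) (z - p) \<le> 0"
  shows "dist x p \<le> dist x z"
proof -
  have "(norm (x - p))\<^sup>2 \<le> (norm (x - z))\<^sup>2"
    using assms inner_ge_zero[of "z - p"]
    by (simp add: power2_norm_eq_inner inner_simps inner_commute algebra_simps)
  then show ?thesis by (simp add: dist_norm power_mono_iff)
qed

lemma metric_proj_eqI:
  fixes S :: "'a::real_inner set"
  assumes p: "p \<in> S" "\<And>z. z \<in> S \<Longrightarrow> inner (x - p) (z - p) \<le> 0" and S: "convex S"
  shows "metric_proj S x = p"
  unfolding metric_proj_def
proof (rule the_equality)
  show "p \<in> S \<and> (\<forall>z\<in>S. dist x p \<le> dist x z)"
    using p nearest_point_of_obtuse by blast
  fix q assume q: "q \<in> S \<and> (\<forall>z\<in>S. dist x q \<le> dist x z)"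
  then have "inner (x - q) (p - q) \<le> 0"
    using convex_inner_le_of_nearest[OF S, of q x p] p by blast
  then show "q = p"
    using norm_diff_le_of_obtuse[of x p q x] p(2)[of q] q by simp
qed

text \<open>Midpoints of a minimising sequence stay in \<open>S\<close>, at distance at least
  \<open>d\<close> from \<open>x\<close>; the parallelogram identity then bounds the gaps of the
  sequence, which is therefore Cauchy.\<close>

lemma nearest_point_exists:
  fixes S :: "'a::{real_inner,complete_space} set"
  assumes S: "closed S" "convex S" "S \<noteq> {}"
  obtains p where "p \<in> S" "\<And>z. z \<in> S \<Longrightarrow> dist x p \<le> dist x z"
proof -
  define d where "d = (INF z\<in>S. dist x z)"
  have bdd: "bdd_below (dist x ` S)" by (auto intro: bdd_belowI[of _ 0])
  have d0: "0 \<le> d" unfolding d_def using S(3) by (intro cINF_greatest) auto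
  have dle: "d \<le> dist x z" if "z \<in> S" for z
    unfolding d_def using that bdd by (rule cINF_lower[rotated])
  have "\<exists>z\<in>S. dist x z < d + 1 / real (Suc n)" for n
    using cINF_less_iff[OF S(3) bdd, of "d + 1 / real (Suc n)"] by (simp add: d_def)
  then obtain z where zS: "\<And>n. z n \<in> S" and z: "\<And>n. dist x (z n) < d + 1 / real (Suc n)"
    by metis
  have lim: "(\<lambda>n. dist x (z n)) \<longlonglongrightarrow> d"
  proof (rule tendsto_sandwich[of "\<lambda>_. d" _ _ "\<lambda>n. d + 1 / real (Suc n)"])
    show "(\<lambda>n. d + 1 / real (Suc n)) \<longlonglongrightarrow> d"
      using tendsto_add[OF tendsto_const[of d] LIMSEQ_Suc[OF lim_1_over_n]] by simp
    show "\<forall>\<^sub>F n in sequentially. d \<le> dist x (z n)"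
      using dle zS by (intro always_eventually) blast
    show "\<forall>\<^sub>F n in sequentially. dist x (z n) \<le> d + 1 / real (Suc n)"
      using z by (intro always_eventually allI less_imp_le)
  qed (rule tendsto_const)
  have diff: "(dist (z m) (z n))\<^sup>2 \<le> 2 * ((dist x (z m))\<^sup>2 - d\<^sup>2) + 2 * ((dist x (z n))\<^sup>2 - d\<^sup>2)" for m n
  proof -
    have "d \<le> norm (x - (1/2) *\<^sub>R (z m + z n))"
      using dle[OF convex_midpoint[OF S(2) zS zS]] by (simp add: dist_norm)
    then have "d\<^sup>2 \<le> (norm (x - (1/2) *\<^sub>R (z m + z n)))\<^sup>2"
      using d0 by (intro power_mono)
    then show ?thesis
      using parallelogram_midpoint[of "z m" "z n" x] by (simp add: dist_norm)
  qed
  have l2: "(\<lambda>n. (dist x (z n))\<^sup>2 - d\<^sup>2) \<longlonglongrightarrow> 0"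
    using tendsto_diff[OF tendsto_power[OF lim, of 2] tendsto_const[of "d\<^sup>2"]] by simp
  have "Cauchy z"
  proof (rule metric_CauchyI)
    fix e :: real assume e: "e > 0"
    then have "\<forall>\<^sub>F n in sequentially. (dist x (z n))\<^sup>2 - d\<^sup>2 < e\<^sup>2 / 4"
      using order_tendstoD(2)[OF l2, of "e\<^sup>2 / 4"] by simp
    then obtain N where N: "\<And>n. n \<ge> N \<Longrightarrow> (dist x (z n))\<^sup>2 - d\<^sup>2 < e\<^sup>2 / 4"
      by (auto simp: eventually_sequentially)
    have "dist (z m) (z n) < e" if "m \<ge> N" "n \<ge> N" for m n
    proof -
      have "(dist (z m) (z n))\<^sup>2 < e\<^sup>2"
        proof -
          have "A < E" if "A \<le> 2 * B + 2 * C" "B < E / 4" "C < E / 4" for A B C E :: real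
            using that by simp
          then show ?thesis using diff[of m n] N[OF that(1)] N[OF that(2)] by blast
        qed
      then show ?thesis using e by (intro power_less_imp_less_base[of _ 2 e]) auto
    qed
    then show "\<exists>M. \<forall>m\<ge>M. \<forall>n\<ge>M. dist (z m) (z n) < e" by blast
  qed
  then obtain p where p: "z \<longlonglongrightarrow> p"
    using Cauchy_convergent convergent_def by blast
  have "p \<in> S"
    using closed_sequentially[OF S(1)] zS p by blast
  have "dist x p = d"
    using tendsto_dist[OF tendsto_const[of x] p] lim LIMSEQ_unique by blast
  then show ?thesis
    using that[OF \<open>p \<in> S\<close>] dle by simp
qed

lemma metric_proj_props:
  fixes S :: "'a::{real_inner,complete_space} set"
  assumes S: "closed S" "convex S" "S \<noteq> {}"
  shows "metric_proj S x \<in> S" "z \<in> S \<Longrightarrow> inner (x - metric_proj S x) (z - metric_proj S x) \<le> 0"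
proof -
  obtain p where p: "p \<in> S" "\<And>z. z \<in> S \<Longrightarrow> dist x p \<le> dist x z"
    using nearest_point_exists[OF S, of x] by blast
  have i: "inner (x - p) (z - p) \<le> 0" if "z \<in> S" for z
    using convex_inner_le_of_nearest[OF S(2) p that] .
  have "metric_proj S x = p"
    by (rule metric_proj_eqI[OF p(1) i S(2)])
  then show "metric_proj S x \<in> S" "z \<in> S \<Longrightarrow> inner (x - metric_proj S x) (z - metric_proj S x) \<le> 0"
    using p(1) i by auto
qed

lemma metric_proj_nonexpansive:
  fixes S :: "'a::{real_inner,complete_space} set"
  assumes S: "closed S" "convex S" "S \<noteq> {}"
  shows "norm (metric_proj S x - metric_proj S y) \<le> norm (x - y)"
  by (intro norm_diff_le_of_obtuse metric_proj_props[OF S])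

lemma orth_proj_eqI:
  fixes S :: "'a::real_inner set"
  assumes S: "subspace S" and p: "p \<in> S" "\<And>z. z \<in> S \<Longrightarrow> inner (x - p) z = 0"
  shows "orth_proj S x = p"
  unfolding orth_proj_def
proof (rule the_equality)
  show "p \<in> S \<and> (\<forall>z\<in>S. inner (x - p) z = 0)" using p by blast
  fix q assume q: "q \<in> S \<and> (\<forall>z\<in>S. inner (x - q) z = 0)"
  have "q - p \<in> S" using q p S by (blast intro: subspace_diff)
  then have "inner (x - p) (q - p) - inner (x - q) (q - p) = 0" using p q by auto
  then have "inner (q - p) (q - p) = 0" by (simp add: inner_simps)
  then show "q = p" by simp
qed

context
  fixes S :: "'a::{real_inner,complete_space} set"
  assumes cl: "closed S" and sub: "subspace S"
begin

lemma orth_proj_mem: "orth_proj S x \<in> S"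
  and orth_proj_orthogonal: "z \<in> S \<Longrightarrow> inner (x - orth_proj S x) z = 0"
proof -
  have S: "closed S" "convex S" "S \<noteq> {}"
    using cl sub subspace_imp_convex subspace_0 by auto
  define p where "p = metric_proj S x"
  have p: "p \<in> S" unfolding p_def by (rule metric_proj_props[OF S])
  have o: "inner (x - p) z = 0" if z: "z \<in> S" for z
  proof -
    have "p + z \<in> S" "p - z \<in> S" using p z sub by (auto intro: subspace_add subspace_diff)
    then have "inner (x - p) (p + z - p) \<le> 0" "inner (x - p) (p - z - p) \<le> 0"
      using metric_proj_props(2)[OF S, of _ x] unfolding p_def by blast+
    then show ?thesis by simp
  qed
  have "orth_proj S x = p"
    by (rule orth_proj_eqI[OF sub p o])
  then show "orth_proj S x \<in> S" "z \<in> S \<Longrightarrow> inner (x - orth_proj S x) z = 0"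
    using p o by auto
qed

lemma orth_proj_self: "x \<in> S \<Longrightarrow> orth_proj S x = x"
  by (rule orth_proj_eqI[OF sub]) auto

lemma inner_orth_proj: "z \<in> S \<Longrightarrow> inner (orth_proj S x) z = inner x z"
  using orth_proj_orthogonal[of z x] by (simp add: inner_simps)

lemma orth_proj_selfadjoint: "inner (orth_proj S x) y = inner x (orth_proj S y)"
  using inner_orth_proj[OF orth_proj_mem, of x y] inner_orth_proj[OF orth_proj_mem, of y x]
  by (simp add: inner_commute)

lemma orth_proj_add: "orth_proj S (x + y) = orth_proj S x + orth_proj S y"
  by (rule orth_proj_eqI[OF sub])
    (auto intro: subspace_add[OF sub] orth_proj_mem simp: inner_simps inner_orth_proj)

lemma orth_proj_diff: "orth_proj S (x - y) = orth_proj S x - orth_proj S y"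
  by (rule orth_proj_eqI[OF sub])
    (auto intro: subspace_diff[OF sub] orth_proj_mem simp: inner_simps inner_orth_proj)

lemma orth_proj_scaleR: "orth_proj S (c *\<^sub>R x) = c *\<^sub>R orth_proj S x"
  by (rule orth_proj_eqI[OF sub])
    (auto intro: subspace_scale[OF sub] orth_proj_mem simp: inner_simps inner_orth_proj algebra_simps)

lemma norm_orth_proj_Pythagoras: "(norm x)\<^sup>2 = (norm (orth_proj S x))\<^sup>2 + (norm (x - orth_proj S x))\<^sup>2"
  using orth_proj_orthogonal[OF orth_proj_mem, of x x]
  by (simp add: power2_norm_eq_inner inner_simps inner_commute)

lemma norm_orth_proj_le: "norm (orth_proj S x) \<le> norm x"
  by (rule power2_le_imp_le) (subst norm_orth_proj_Pythagoras[of x], simp_all)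

lemma dist_orth_proj_le:
  assumes "z \<in> S" shows "norm (x - orth_proj S x) \<le> norm (x - z)"
proof -
  have "orth_proj S (x - z) = orth_proj S x - z"
    using assms by (simp add: orth_proj_diff orth_proj_self)
  then have "(norm (x - z))\<^sup>2 = (norm (orth_proj S x - z))\<^sup>2 + (norm (x - z - (orth_proj S x - z)))\<^sup>2"
    using norm_orth_proj_Pythagoras[of "x - z"] by (simp only:)
  also have "x - z - (orth_proj S x - z) = x - orth_proj S x" by simp
  finally have "(norm (x - orth_proj S x))\<^sup>2 \<le> (norm (x - z))\<^sup>2" by simp
  then show ?thesis by (rule power2_le_imp_le) simp
qed

end

lemma subspace_closure:
  fixes D :: "'a::real_normed_vector set"
  assumes "subspace D"
  shows "subspace (closure D)"
  unfolding subspace_def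
proof (intro conjI ballI allI)
  show "0 \<in> closure D" using assms subspace_0 closure_subset by blast
  fix x y assume "x \<in> closure D" "y \<in> closure D"
  then obtain u v where "\<And>n. u n \<in> D" "u \<longlonglongrightarrow> x" "\<And>n. v n \<in> D" "v \<longlonglongrightarrow> y"
    unfolding closure_sequential by blast
  then have "(\<lambda>n. u n + v n) \<longlonglongrightarrow> x + y" "\<And>n. u n + v n \<in> D"
    using assms by (auto intro: tendsto_add subspace_add)
  then show "x + y \<in> closure D"
    unfolding closure_sequential by (intro exI[of _ "\<lambda>n. u n + v n"]) blast
next
  fix c x assume "x \<in> closure D"
  then obtain u where "\<And>n. u n \<in> D" "u \<longlonglongrightarrow> x"
    unfolding closure_sequential by blast
  then have "(\<lambda>n. c *\<^sub>R u n) \<longlonglongrightarrow> c *\<^sub>R x" "\<And>n. c *\<^sub>R u n \<in> D"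
    using assms by (auto intro: tendsto_scaleR subspace_scale)
  then show "c *\<^sub>R x \<in> closure D"
    unfolding closure_sequential by (intro exI[of _ "\<lambda>n. c *\<^sub>R u n"]) blast
qed

text \<open>The residual of \<open>y\<close> after projection is orthogonal to \<open>D\<close>,
  hence by assumption to \<open>y\<close>, and also to the projection, so it is orthogonal to
  itself. Serves as density criterion for feasible directions and for dyadic step functions.\<close>

lemma in_closure_of_orthogonal:
  fixes D :: "'a::{real_inner,complete_space} set"
  assumes D: "subspace D" and y: "\<And>g. (\<And>z. z \<in> D \<Longrightarrow> inner g z = 0) \<Longrightarrow> inner g y = 0"
  shows "y \<in> closure D"
proof -
  have c: "closed (closure D)" "subspace (closure D)"
    using D by (auto intro: subspace_closure)
  define p where "p = orth_proj (closure D) y"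
  have "inner (y - p) z = 0" if "z \<in> closure D" for z
    unfolding p_def by (rule orth_proj_orthogonal[OF c that])
  then have "inner (y - p) y = 0" "inner (y - p) p = 0"
    using y[of "y - p"] orth_proj_mem[OF c] closure_subset[of D] unfolding p_def by blast+
  then have "inner (y - p) (y - p) = 0" by (simp only: inner_diff_right)
  then show ?thesis using orth_proj_mem[OF c, of y] unfolding p_def by simp
qed

lemma closed_subspace_orthogonal_complement:
  fixes G :: "'a::real_inner set"
  shows "closed {y. \<forall>g\<in>G. inner y g = 0}" "subspace {y. \<forall>g\<in>G. inner y g = 0}"
proof -
  have "{y. \<forall>g\<in>G. inner y g = 0} = (\<Inter>g\<in>G. {y. inner y g = 0})" by auto
  moreover have "closed {y. inner y g = 0}" for g :: 'a
    by (intro closed_Collect_eq continuous_intros)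
  ultimately show "closed {y. \<forall>g\<in>G. inner y g = 0}" by auto
  show "subspace {y. \<forall>g\<in>G. inner y g = 0}"
    by (auto simp: subspace_def inner_simps)
qed

text \<open>The deviation of \<open>y\<close> from its mean over the interval is itself an
  admissible test function, and orthogonality to it makes it vanish. In this dual form
  \<open>sub_H x\<close> becomes an intersection of kernels, so that it is a closed
  subspace.\<close>

lemma ess_constant_iff_orthogonal:
  assumes "0 \<le> a" "a < b" "b \<le> 1"
  shows "ess_constant y {a<..<b} \<longleftrightarrow>
    (\<forall>g. sq g \<and> (\<forall>w. w \<notin> {a<..<b} \<longrightarrow> g w = 0) \<and> (LINT w|unit_lborel. g w) = 0
       \<longrightarrow> inner y (abs_l2 g) = 0)" (is "?L \<longleftrightarrow> ?R")
proof
  assume ?L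
  then obtain c where c: "AE w in unit_lborel. w \<in> {a<..<b} \<longrightarrow> rep_l2 y w = c"
    by (auto simp: ess_constant_def)
  show ?R
  proof (intro allI impI, elim conjE)
    fix g assume g: "sq g" "\<forall>w. w \<notin> {a<..<b} \<longrightarrow> g w = 0" "(LINT w|unit_lborel. g w) = 0"
    have gm [measurable]: "g \<in> borel_measurable unit_lborel" using g by (simp add: square_integrable_def)
    have "inner y (abs_l2 g) = (LINT w|unit_lborel. rep_l2 y w * g w)"
      using abs_l2_inner[OF sq_rep_l2 g(1), of y] by simp
    also have "\<dots> = (LINT w|unit_lborel. c * g w)"
    proof (rule integral_cong_AE)
      show "AE w in unit_lborel. rep_l2 y w * g w = c * g w"
        using c
      proof eventually_elim
        case (elim w)
        then show ?case using g(2) by (cases "w \<in> {a<..<b}") auto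
      qed
    qed measurable
    finally show "inner y (abs_l2 g) = 0" using g(3) by simp
  qed
next
  assume R: ?R
  define f where "f = rep_l2 y"
  define I where "I = (indicator {a<..<b} :: real \<Rightarrow> real)"
  have [measurable]: "I \<in> borel_measurable unit_lborel" unfolding I_def
    by (rule borel_imp_measurable_unit_lborel) simp
  have Ii: "(LINT w|unit_lborel. I w) = b - a"
    using assms emeasure_unit_lborel_interval[of a b]
    by (simp add: I_def measure_def Int_absorb1 subset_iff)
  have sI: "sq I" by (rule U.square_integrable_bounded[of _ 1]) (auto simp: I_def split: split_indicator)
  have fI: "sq (\<lambda>w. f w * I w)"
    by (rule square_integrable_mult_indicator[where B=1]) (auto simp: f_def I_def split: split_indicator)
  define m where "m = (LINT w|unit_lborel. f w * I w) / (b - a)"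
  define g where "g w = f w * I w - m * I w" for w
  have g: "sq g" unfolding g_def by (intro square_integrable_diff square_integrable_scale fI sI)
  have "(LINT w|unit_lborel. g w) = (LINT w|unit_lborel. f w * I w) - m * (b - a)"
    unfolding g_def using fI sI
    by (simp add: Ii[symmetric] U.integrable_of_square_integrable)
  then have g0: "(LINT w|unit_lborel. g w) = 0" using assms by (simp add: m_def)
  have y0: "inner y (abs_l2 g) = 0"
    using R g g0 by (auto simp: g_def I_def)
  have "inner y (abs_l2 g) = (LINT w|unit_lborel. f w * g w)"
    using abs_l2_inner[OF sq_rep_l2 g, of y] by (simp add: f_def)
  also have "\<dots> = (LINT w|unit_lborel. (g w)\<^sup>2 + m * g w)"
    by (rule Bochner_Integration.integral_cong)
      (auto simp: g_def I_def power2_eq_square algebra_simps split: split_indicator)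
  also have "\<dots> = (LINT w|unit_lborel. (g w)\<^sup>2) + m * (LINT w|unit_lborel. g w)"
    using g by (simp add: U.integrable_of_square_integrable square_integrable_def)
  finally have "(LINT w|unit_lborel. (g w)\<^sup>2) = 0" using y0 g0 by simp
  then have "AE w in unit_lborel. (g w)\<^sup>2 = 0"
    using g by (subst (asm) integral_nonneg_eq_0_iff_AE) (auto simp: square_integrable_def)
  then show ?L unfolding ess_constant_def
    by (intro exI[of _ m]) (auto simp: g_def I_def f_def elim!: eventually_mono)
qed

lemma closed_sub_H: "closed (sub_H x)" and subspace_sub_H: "subspace (sub_H x)"
proof -
  define G where "G = {abs_l2 g | g. sq g \<and> (LINT w|unit_lborel. g w) = 0 \<and>
    (\<exists>a b. 0 \<le> a \<and> a < b \<and> b \<le> 1 \<and> ess_constant x {a<..<b} \<and> (\<forall>w. w \<notin> {a<..<b} \<longrightarrow> g w = 0))}"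
  have "sub_H x = {y. \<forall>g\<in>G. inner y g = 0}"
    unfolding sub_H_def G_def by (auto simp: ess_constant_iff_orthogonal)
  then show "closed (sub_H x)" "subspace (sub_H x)"
    using closed_subspace_orthogonal_complement by auto
qed

lemma self_in_sub_H: "x \<in> sub_H x"
  by (simp add: sub_H_def)

lemma sub_H_mono: "y \<in> sub_H x \<Longrightarrow> sub_H y \<subseteq> sub_H x"
  unfolding sub_H_def by blast

section \<open>Projections onto \<open>sub_H x\<close> and onto the cone\<close>

abbreviation "PH x \<equiv> orth_proj (sub_H x)"
abbreviation "PK \<equiv> metric_proj cone_K"

lemmas PH_mem = orth_proj_mem[OF closed_sub_H subspace_sub_H]
  and PH_orth = orth_proj_orthogonal[OF closed_sub_H subspace_sub_H]
  and PH_self = orth_proj_self[OF closed_sub_H subspace_sub_H]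
  and PH_inner = inner_orth_proj[OF closed_sub_H subspace_sub_H]
  and PH_selfadjoint = orth_proj_selfadjoint[OF closed_sub_H subspace_sub_H]
  and PH_add = orth_proj_add[OF closed_sub_H subspace_sub_H]
  and PH_diff = orth_proj_diff[OF closed_sub_H subspace_sub_H]
  and PH_scaleR = orth_proj_scaleR[OF closed_sub_H subspace_sub_H]
  and PH_Pythagoras = norm_orth_proj_Pythagoras[OF closed_sub_H subspace_sub_H]
  and PH_norm_le = norm_orth_proj_le[OF closed_sub_H subspace_sub_H]
  and PH_dist_le = dist_orth_proj_le[OF closed_sub_H subspace_sub_H]

text \<open>Tower property of projections onto nested subspaces, \<open>sub_H y\<close> being
  contained in \<open>sub_H x\<close>.\<close>

lemma PH_PH: "y \<in> sub_H x \<Longrightarrow> PH y (PH x v) = PH y v"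
  by (rule orth_proj_eqI[OF subspace_sub_H PH_mem])
    (use sub_H_mono[of y x] in \<open>auto simp: inner_diff_left PH_inner subset_iff\<close>)

text \<open>The running supremum over the good points extends \<open>g\<close> to a function that is
  monotone everywhere. This is the form needed for limits, since an almost everywhere limit of
  monotone functions is known to be monotone only where it exists.\<close>

lemma cone_K_AE_mono:
  assumes g: "sq g" and \<Omega>: "AE w in unit_lborel. w \<in> \<Omega>" and mono: "mono_on (\<Omega> \<inter> {0<..<1}) g"
  shows "abs_l2 g \<in> cone_K"
proof -
  \<comment> \<open>A set of full measure meets every interval. This makes the suprema below range
    over nonempty sets and provides points further right that bound them.\<close>
  have ex: "\<exists>v\<in>\<Omega>. a < v \<and> v < b" if "0 \<le> a" "a < b" "b \<le> 1" for a b
  proof (rule ccontr)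
    assume "\<not> ?thesis"
    then have "AE w in unit_lborel. w \<notin> {a<..<b}"
      using \<Omega> by (auto elim!: eventually_mono)
    then have "emeasure unit_lborel {a<..<b} = 0"
      using that by (subst (asm) AE_iff_measurable[of "{a<..<b}"]) (auto simp: sets_unit_lborel)
    then show False using emeasure_unit_lborel_interval[of a b] that by simp
  qed
  define f where "f w = (SUP v\<in>{v\<in>\<Omega>. 0 < v \<and> v \<le> w}. g v)" for w
  have ne: "{v\<in>\<Omega>. 0 < v \<and> v \<le> w} \<noteq> {}" if "0 < w" "w < 1" for w
    using ex[of 0 w] that by (auto intro: less_imp_le)
  have bdd: "bdd_above (g ` {v\<in>\<Omega>. 0 < v \<and> v \<le> w})" if w: "0 < w" "w < 1" for w
  proof -
    obtain u where u: "u \<in> \<Omega>" "w < u" "u < 1" using ex[of w 1] w by auto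
    show ?thesis
      using u w mono by (intro bdd_aboveI2[of _ _ "g u"]) (auto simp: mono_on_def)
  qed
  have fg: "f w = g w" if w: "w \<in> \<Omega>" "0 < w" "w < 1" for w
    unfolding f_def
  proof (rule antisym)
    show "(SUP v\<in>{v\<in>\<Omega>. 0 < v \<and> v \<le> w}. g v) \<le> g w"
      using ne w mono by (intro cSUP_least) (auto simp: mono_on_def)
    show "g w \<le> (SUP v\<in>{v\<in>\<Omega>. 0 < v \<and> v \<le> w}. g v)"
      using w bdd by (intro cSUP_upper) auto
  qed
  have m: "mono_on {0<..<1} f"
    unfolding f_def by (intro mono_onI cSUP_subset_mono ne bdd) auto
  have "AE w in unit_lborel. w \<in> {0<..<1}" using AE_space[of unit_lborel] by simp
  then have ae: "AE w in unit_lborel. g w = f w"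
    using \<Omega> by eventually_elim (simp add: fg)
  have "sq f"
    by (rule square_integrable_cong_AE[OF g mono_on_imp_measurable_unit_lborel[OF m] ae])
  moreover have "abs_l2 g = abs_l2 f"
    using abs_l2_eq_iff[OF g \<open>sq f\<close>] ae by simp
  ultimately show ?thesis
    unfolding cone_K_def using m by blast
qed

lemma cone_K_cases:
  assumes "x \<in> cone_K"
  obtains f where "sq f" "mono_on {0<..<1} f" "x = abs_l2 f"
  using assms by (auto simp: cone_K_def)

lemma cone_KI: "sq f \<Longrightarrow> mono_on {0<..<1} f \<Longrightarrow> abs_l2 f \<in> cone_K"
  by (auto simp: cone_K_def)

lemma closed_cone_K: "closed cone_K"
proof (unfold closed_sequential_limits, intro allI impI, elim conjE)
  fix x :: "nat \<Rightarrow> l2" and y assume x: "\<forall>n. x n \<in> cone_K" and lim: "x \<longlonglongrightarrow> y"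
  have "\<exists>f. sq f \<and> mono_on {0<..<1} f \<and> x n = abs_l2 f" for n
    using x by (auto simp: cone_K_def)
  then obtain f where f: "\<And>n. sq (f n)" "\<And>n. mono_on {0<..<1} (f n)" "\<And>n. x n = abs_l2 (f n)"
    by metis
  obtain r where r: "AE w in unit_lborel. (\<lambda>n. rep_l2 (x (r n)) w) \<longlonglongrightarrow> rep_l2 y w"
    using l2_tendsto_AE_subseq[OF lim] by blast
  have "AE w in unit_lborel. \<forall>n. rep_l2 (x n) w = f n w"
    using rep_abs_l2[OF f(1)] f(3) by (simp add: AE_all_countable)
  with r have ae: "AE w in unit_lborel. (\<lambda>n. f (r n) w) \<longlonglongrightarrow> rep_l2 y w"
    by eventually_elim simp
  have "abs_l2 (rep_l2 y) \<in> cone_K"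
  proof (rule cone_K_AE_mono[where \<Omega>="{w. (\<lambda>n. f (r n) w) \<longlonglongrightarrow> rep_l2 y w}"])
    show "mono_on ({w. (\<lambda>n. f (r n) w) \<longlonglongrightarrow> rep_l2 y w} \<inter> {0<..<1}) (rep_l2 y)"
      using f(2) by (auto simp: mono_on_def intro!: LIMSEQ_le)
  qed (use ae in auto)
  then show "y \<in> cone_K" by simp
qed

lemma cone_K_add: "x \<in> cone_K \<Longrightarrow> y \<in> cone_K \<Longrightarrow> x + y \<in> cone_K"
  by (elim cone_K_cases) (auto simp: abs_l2_add mono_on_def intro!: cone_KI square_integrable_add add_mono)

lemma cone_K_scaleR: "c \<ge> 0 \<Longrightarrow> x \<in> cone_K \<Longrightarrow> c *\<^sub>R x \<in> cone_K"
  by (elim cone_K_cases) (auto simp: abs_l2_scaleR mono_on_def intro!: cone_KI square_integrable_scale mult_left_mono)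

lemma zero_in_cone_K: "0 \<in> cone_K"
  using cone_KI[OF U.square_integrable_const[of 0]] by (simp add: abs_l2_zero mono_on_def)

lemma convex_cone_K: "convex cone_K"
  by (auto simp: convex_def intro: cone_K_add cone_K_scaleR)

lemma cone_K_nonempty: "cone_K \<noteq> {}"
  using zero_in_cone_K by blast

lemmas PK_mem = metric_proj_props(1)[OF closed_cone_K convex_cone_K cone_K_nonempty]
  and PK_nonexpansive = metric_proj_nonexpansive[OF closed_cone_K convex_cone_K cone_K_nonempty]

text \<open>Testing with \<open>0\<close> and with \<open>2 *\<^sub>R x\<close> gives complementary
  slackness: normal vectors to a cone are the elements of the polar cone orthogonal to the base
  point. Sums of normal vectors at different points are handled in this form.\<close>

lemma subdiff_cone_K_iff:
  "\<xi> \<in> subdiff_indicator cone_K x \<longleftrightarrow>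
    x \<in> cone_K \<and> inner \<xi> x = 0 \<and> (\<forall>z\<in>cone_K. inner \<xi> z \<le> 0)"
proof
  assume "\<xi> \<in> subdiff_indicator cone_K x"
  then have x: "x \<in> cone_K" and le: "\<And>z. z \<in> cone_K \<Longrightarrow> inner \<xi> (z - x) \<le> 0"
    by (auto simp: subdiff_indicator_def split: if_splits)
  have "inner \<xi> (0 - x) \<le> 0" "inner \<xi> (2 *\<^sub>R x - x) \<le> 0"
    using le[OF zero_in_cone_K] le[OF cone_K_scaleR[OF _ x, of 2]] by simp_all
  then have "inner \<xi> x = 0" by (simp add: inner_diff_right)
  then show "x \<in> cone_K \<and> inner \<xi> x = 0 \<and> (\<forall>z\<in>cone_K. inner \<xi> z \<le> 0)"
    using x le by (auto simp: inner_diff_right)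
qed (auto simp: subdiff_indicator_def inner_diff_right)

lemma PK_eq_iff: "PK g = x \<longleftrightarrow> g - x \<in> subdiff_indicator cone_K x"
proof
  assume "PK g = x"
  then show "g - x \<in> subdiff_indicator cone_K x"
    using metric_proj_props(2)[OF closed_cone_K convex_cone_K cone_K_nonempty, of _ g] PK_mem[of g]
    by (auto simp: subdiff_indicator_def)
next
  assume "g - x \<in> subdiff_indicator cone_K x"
  then show "PK g = x"
    by (intro metric_proj_eqI convex_cone_K) (auto simp: subdiff_indicator_def split: if_splits)
qed

section \<open>Functions constant on the level sets of a nondecreasing function\<close>

text \<open>The positive and negative parts of \<open>g\<close>, taken as densities, have images
  under \<open>f\<close> with the same distribution function, so the two images coincide and every
  function of \<open>f\<close> integrates to the same value against both.\<close>

lemma integral_comp_eq_zero: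
  fixes f g :: "real \<Rightarrow> real"
  assumes g: "integrable unit_lborel g" and f [measurable]: "f \<in> borel_measurable unit_lborel"
    and zero: "\<And>c. (LINT w|unit_lborel. g w * indicator {..c} (f w)) = 0"
    and u [measurable]: "u \<in> borel_measurable borel" and gu: "integrable unit_lborel (\<lambda>w. g w * u (f w))"
  shows "(LINT w|unit_lborel. g w * u (f w)) = 0"
proof -
  have [measurable]: "g \<in> borel_measurable unit_lborel" using g by simp
  \<comment> \<open>The signs \<open>s = 1\<close> and \<open>s = -1\<close> select the positive and
    the negative part of \<open>g\<close>.\<close>
  define A where "A s = distr (density unit_lborel (\<lambda>w. ennreal (max 0 (s * g w)))) borel f" for s :: real
  have gs: "integrable unit_lborel (\<lambda>w. max 0 (s * g w))" for s
    using g by (intro integrable_max) auto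
  have em: "emeasure (A s) B = ennreal (LINT w|unit_lborel. max 0 (s * g w) * indicator B (f w))"
    if [measurable]: "B \<in> sets borel" for s B
  proof -
    have "emeasure (A s) B = (\<integral>\<^sup>+w. ennreal (max 0 (s * g w)) * indicator (f -` B \<inter> space unit_lborel) w \<partial>unit_lborel)"
      unfolding A_def by (subst emeasure_distr) (auto simp: emeasure_density)
    also have "\<dots> = (\<integral>\<^sup>+w. ennreal (max 0 (s * g w) * indicator B (f w)) \<partial>unit_lborel)"
      by (rule nn_integral_cong) (auto split: split_indicator)
    also have "\<dots> = ennreal (LINT w|unit_lborel. max 0 (s * g w) * indicator B (f w))"
    proof (rule nn_integral_eq_integral)
      show "integrable unit_lborel (\<lambda>w. max 0 (s * g w) * indicator B (f w))"
        by (rule Bochner_Integration.integrable_bound[OF gs[of s]]) (auto split: split_indicator)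
    qed auto
    finally show ?thesis .
  qed
  have fin: "finite_borel_measure (A s)" for s
    using em[of UNIV s] by (auto simp: finite_borel_measure_def finite_borel_measure_axioms_def A_def intro!: finite_measureI)
  have "cdf (A 1) = cdf (A (-1))"
  proof
    fix c
    have i: "integrable unit_lborel (\<lambda>w. max 0 (s * g w) * indicator {..c} (f w))" for s
      by (rule Bochner_Integration.integrable_bound[OF gs[of s]]) (auto split: split_indicator)
    have "(LINT w|unit_lborel. max 0 (1 * g w) * indicator {..c} (f w)) - (LINT w|unit_lborel. max 0 (-1 * g w) * indicator {..c} (f w))
      = (LINT w|unit_lborel. g w * indicator {..c} (f w))"
      unfolding Bochner_Integration.integral_diff[OF i[of 1] i[of "-1"], symmetric]
      by (rule Bochner_Integration.integral_cong) (auto simp: max_def split: split_indicator)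
    then show "cdf (A 1) c = cdf (A (-1)) c"
      unfolding cdf_def measure_def by (simp add: em zero)
  qed
  then have eq: "A 1 = A (-1)"
    by (rule cdf_unique'[OF fin fin])
  have int: "integral\<^sup>L (A s) u = (LINT w|unit_lborel. max 0 (s * g w) * u (f w))" for s
    unfolding A_def by (subst integral_distr, simp, simp, subst integral_density) auto
  have i: "integrable unit_lborel (\<lambda>w. max 0 (s * g w) * u (f w))" if "\<bar>s\<bar> = 1" for s
  proof (rule Bochner_Integration.integrable_bound[OF gu])
    have "\<bar>max 0 (s * g w)\<bar> \<le> \<bar>g w\<bar>" for w
      using that abs_mult[of s "g w"] by (auto simp: max_def)
    then show "AE w in unit_lborel. norm (max 0 (s * g w) * u (f w)) \<le> norm (g w * u (f w))"
      by (auto simp: abs_mult intro!: mult_right_mono)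
  qed auto
  have "(LINT w|unit_lborel. g w * u (f w)) = (LINT w|unit_lborel. max 0 (1 * g w) * u (f w)) - (LINT w|unit_lborel. max 0 (-1 * g w) * u (f w))"
    unfolding Bochner_Integration.integral_diff[OF i[OF abs_one] i[of "-1", OF abs_minus_cancel[THEN trans, OF abs_one]], symmetric]
    by (rule Bochner_Integration.integral_cong) (auto simp: max_def)
  also have "\<dots> = 0" using eq int[of 1] int[of "-1"] by simp
  finally show ?thesis .
qed

text \<open>Antitone and Lipschitz with constant \<open>k\<close>, equal to \<open>1\<close> on
  \<open>{..c}\<close>, and converging to the indicator of that half-line as \<open>k\<close>
  grows.\<close>

definition cutoff :: "nat \<Rightarrow> real \<Rightarrow> real \<Rightarrow> real" where
  "cutoff k c x = max 0 (min 1 (1 - real k * (x - c)))"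

lemma cutoff_bounds: "0 \<le> cutoff k c x" "cutoff k c x \<le> 1"
  by (auto simp: cutoff_def)

lemma continuous_cutoff: "continuous_on UNIV (cutoff k c)"
  unfolding cutoff_def by (intro continuous_intros)

lemma cutoff_measurable [measurable]: "cutoff k c \<in> borel_measurable borel"
  by (rule borel_measurable_continuous_onI[OF continuous_cutoff])

lemma cutoff_antimono: "x \<le> y \<Longrightarrow> cutoff k c y \<le> cutoff k c x"
proof -
  assume "x \<le> y"
  then have "real k * (x - c) \<le> real k * (y - c)" by (intro mult_left_mono) auto
  then show ?thesis by (auto simp: cutoff_def)
qed

lemma cutoff_lipschitz: "x \<le> y \<Longrightarrow> cutoff k c x - cutoff k c y \<le> real k * (y - x)"
proof -
  assume "x \<le> y"
  moreover have "real k * (y - c) - real k * (x - c) = real k * (y - x)" by (simp add: algebra_simps)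
  moreover have "0 \<le> real k * (y - x)" using \<open>x \<le> y\<close> by simp
  ultimately show ?thesis unfolding cutoff_def by linarith
qed

lemma cutoff_tendsto: "(\<lambda>k. cutoff k c x) \<longlonglongrightarrow> indicator {..c} x"
proof (cases "x \<le> c")
  case True
  then have "cutoff k c x = 1" for k
    using mult_nonneg_nonpos[of "real k" "x - c"] by (simp add: cutoff_def)
  then show ?thesis using True by simp
next
  case False
  obtain N where N: "1 / (x - c) < real N" using reals_Archimedean2 by blast
  have "cutoff k c x = 0" if "k \<ge> N" for k
  proof -
    have "1 < real N * (x - c)" using N False by (simp add: field_simps)
    also have "\<dots> \<le> real k * (x - c)" using that False by (intro mult_right_mono) auto
    finally show ?thesis by (simp add: cutoff_def)
  qed
  then have "\<forall>\<^sub>F k in sequentially. cutoff k c x = 0"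
    unfolding eventually_sequentially by blast
  then show ?thesis using False by (simp add: tendsto_eventually)
qed

lemma integral_indicator_eq_zero_of_cutoff:
  assumes g: "integrable unit_lborel g" and f [measurable]: "f \<in> borel_measurable unit_lborel"
    and zero: "\<And>k c. (LINT w|unit_lborel. g w * cutoff k c (f w)) = 0"
  shows "(LINT w|unit_lborel. g w * indicator {..c} (f w)) = (0::real)"
proof -
  have [measurable]: "g \<in> borel_measurable unit_lborel" using g by simp
  have "(\<lambda>k. LINT w|unit_lborel. g w * cutoff k c (f w)) \<longlonglongrightarrow> (LINT w|unit_lborel. g w * indicator {..c} (f w))"
  proof (rule integral_dominated_convergence[where w="\<lambda>w. \<bar>g w\<bar>"])
    show "AE w in unit_lborel. (\<lambda>k. g w * cutoff k c (f w)) \<longlonglongrightarrow> g w * indicator {..c} (f w)"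
      by (intro AE_I2 tendsto_mult tendsto_const cutoff_tendsto)
    show "AE w in unit_lborel. norm (g w * cutoff k c (f w)) \<le> \<bar>g w\<bar>" for k
      using cutoff_bounds by (auto simp: abs_mult intro!: mult_left_le)
  qed (use g in auto)
  then show ?thesis
    using zero LIMSEQ_unique[OF _ tendsto_const] by (auto simp: LIMSEQ_const_iff)
qed

lemma integral_comp_eq_zero_of_cutoff:
  fixes f g :: "real \<Rightarrow> real"
  assumes "integrable unit_lborel g" "f \<in> borel_measurable unit_lborel"
    and "\<And>k c. (LINT w|unit_lborel. g w * cutoff k c (f w)) = 0"
    and "u \<in> borel_measurable borel" "integrable unit_lborel (\<lambda>w. g w * u (f w))"
  shows "(LINT w|unit_lborel. g w * u (f w)) = 0"
  by (rule integral_comp_eq_zero[OF assms(1,2) integral_indicator_eq_zero_of_cutoff[OF assms(1-3)] assms(4,5)])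

section \<open>Level sets of positive measure and averages over them\<close>

definition lev :: "(real \<Rightarrow> real) \<Rightarrow> real \<Rightarrow> real set" where
  "lev f c = {w\<in>{0<..<1}. f w = c}"

text \<open>These are the atoms of the law of \<open>f\<close>, hence countably many.\<close>

definition atoms :: "(real \<Rightarrow> real) \<Rightarrow> real set" where
  "atoms f = {c. measure unit_lborel (lev f c) > 0}"

lemma lev_Int: "lev f c \<inter> {0<..<1} = lev f c"
  by (auto simp: lev_def)

lemma lev_sets [measurable]: "f \<in> borel_measurable unit_lborel \<Longrightarrow> lev f c \<in> sets unit_lborel"
proof -
  assume [measurable]: "f \<in> borel_measurable unit_lborel"
  have "{w \<in> space unit_lborel. f w = c} \<in> sets unit_lborel" by measurable
  then show ?thesis by (simp add: lev_def)
qed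

lemma countable_atoms_f:
  assumes [measurable]: "f \<in> borel_measurable unit_lborel"
  shows "countable (atoms f)"
proof -
  interpret D: prob_space "distr unit_lborel borel f"
    by (rule U.prob_space_distr) measurable
  have v: "f -` {c} \<inter> space unit_lborel = lev f c" for c unfolding lev_def space_unit_lborel by blast
  have "measure (distr unit_lborel borel f) {c} = measure unit_lborel (lev f c)" for c
    unfolding measure_distr[OF assms borel_singleton[OF sets.empty_sets]] v ..
  then have "atoms f = {c. measure (distr unit_lborel borel f) {c} \<noteq> 0}"
    unfolding atoms_def zero_less_measure_iff by (rule_tac Collect_cong) (rule_tac arg_cong[where f="\<lambda>x. x \<noteq> 0"], rule sym)
  then show ?thesis using D.countable_support by simp
qed

lemma atoms_measurable:
  "f \<in> borel_measurable unit_lborel \<Longrightarrow> {w \<in> space unit_lborel. f w \<in> atoms f} \<in> sets unit_lborel"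
proof -
  assume f [measurable]: "f \<in> borel_measurable unit_lborel"
  have [measurable]: "atoms f \<in> sets borel"
    by (rule sets.countable[OF _ countable_atoms_f[OF f]]) simp
  show ?thesis by measurable
qed

text \<open>Only countably many levels are charged, so the exceptional null sets of the single
  levels have a null union.\<close>

lemma AE_level_cases:
  assumes f: "f \<in> borel_measurable unit_lborel"
    and 1: "\<And>c. c \<in> atoms f \<Longrightarrow> AE w in unit_lborel. w \<in> lev f c \<longrightarrow> P w"
    and 2: "AE w in unit_lborel. f w \<notin> atoms f \<longrightarrow> P w"
  shows "AE w in unit_lborel. P w"
proof -
  have "AE w in unit_lborel. \<forall>c\<in>atoms f. w \<in> lev f c \<longrightarrow> P w"
    using 1 by (intro AE_ball_countable' countable_atoms_f f)
  with 2 AE_space show ?thesis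
    by eventually_elim (auto simp: lev_def)
qed

text \<open>For monotone \<open>f\<close> a charged level is an interval up to its endpoints;
  conversely, an interval on which \<open>f\<close> is essentially constant lies, up to a null set,
  in one charged level. Overlapping intervals are thereby replaced by countably many disjoint
  sets.\<close>

lemma sub_H_iff_levels:
  assumes f: "sq f" "mono_on {0<..<1} f"
  shows "y \<in> sub_H (abs_l2 f) \<longleftrightarrow> (\<forall>c\<in>atoms f. \<exists>k. AE w in unit_lborel. w \<in> lev f c \<longrightarrow> rep_l2 y w = k)"
proof safe
  have fm [measurable]: "f \<in> borel_measurable unit_lborel" using f by (simp add: square_integrable_def)
  fix c assume y: "y \<in> sub_H (abs_l2 f)" and c: "c \<in> atoms f"
  define L where "L = lev f c"
  have L01: "L \<subseteq> {0<..<1}" by (auto simp: L_def lev_def)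
  have mL: "measure unit_lborel L > 0" using c by (simp add: atoms_def L_def)
  then have ne: "L \<noteq> {}" by auto
  have bb: "bdd_below L" "bdd_above L"
    using L01 by (auto intro!: bdd_belowI[of _ 0] bdd_aboveI[of _ 1] dest: subsetD)
  define a where "a = Inf L"
  define b where "b = Sup L"
  have Lab: "a \<le> w" "w \<le> b" if "w \<in> L" for w
    using that bb by (auto simp: a_def b_def cInf_lower cSup_upper)
  have "0 \<le> a" unfolding a_def using ne L01 by (intro cInf_greatest) auto
  have "b \<le> 1" unfolding b_def using ne L01 by (intro cSup_least) auto
  have "a < b"
  proof (rule ccontr)
    assume "\<not> a < b"
    then have "\<forall>w\<in>L. w = a" using Lab by fastforce
    then have "AE w in unit_lborel. w \<notin> L" using AE_unit_lborel_neq[of a] by (auto elim!: eventually_mono)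
    then have "emeasure unit_lborel L = 0"
      by (subst (asm) AE_iff_measurable[of L]) (use L01 in \<open>auto simp: L_def\<close>)
    then show False using mL by (simp add: measure_def)
  qed
  have ab: "w \<in> L" if w: "a < w" "w < b" for w
  proof -
    obtain u where u: "u \<in> L" "u < w" using w(1) ne bb unfolding a_def by (auto simp: cInf_less_iff)
    obtain v where v: "v \<in> L" "w < v" using w(2) ne bb unfolding b_def by (auto simp: less_cSup_iff)
    have "w \<in> {0<..<1}" using w \<open>0 \<le> a\<close> \<open>b \<le> 1\<close> by auto
    then have "f u \<le> f w" "f w \<le> f v"
      using u v L01 f(2) by (auto simp: mono_on_def subset_iff)
    then show ?thesis using u v L01 \<open>w \<in> {0<..<1}\<close> by (auto simp: L_def lev_def)
  qed
  have "ess_constant (abs_l2 f) {a<..<b}"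
    unfolding ess_constant_def using rep_abs_l2[OF f(1)]
    by (intro exI[of _ c]) (auto elim!: eventually_mono dest: ab simp: L_def lev_def)
  then have "ess_constant y {a<..<b}"
    using y \<open>0 \<le> a\<close> \<open>a < b\<close> \<open>b \<le> 1\<close> by (auto simp: sub_H_def)
  then obtain k where "AE w in unit_lborel. w \<in> {a<..<b} \<longrightarrow> rep_l2 y w = k"
    by (auto simp: ess_constant_def)
  with AE_unit_lborel_neq[of a] AE_unit_lborel_neq[of b]
  have "AE w in unit_lborel. w \<in> L \<longrightarrow> rep_l2 y w = k"
    by eventually_elim (use Lab in force)
  then show "\<exists>k. AE w in unit_lborel. w \<in> lev f c \<longrightarrow> rep_l2 y w = k" by (auto simp: L_def)
next
  have fm [measurable]: "f \<in> borel_measurable unit_lborel" using f by (simp add: square_integrable_def)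
  assume *: "\<forall>c\<in>atoms f. \<exists>k. AE w in unit_lborel. w \<in> lev f c \<longrightarrow> rep_l2 y w = k"
  show "y \<in> sub_H (abs_l2 f)" unfolding sub_H_def
  proof safe
    fix a b :: real assume ab: "0 \<le> a" "a < b" "b \<le> 1" and "ess_constant (abs_l2 f) {a<..<b}"
    then obtain c where "AE w in unit_lborel. w \<in> {a<..<b} \<longrightarrow> rep_l2 (abs_l2 f) w = c"
      by (auto simp: ess_constant_def)
    with rep_abs_l2[OF f(1)] AE_space have c: "AE w in unit_lborel. w \<in> {a<..<b} \<longrightarrow> w \<in> lev f c"
      by eventually_elim (auto simp: lev_def)
    have "measure unit_lborel {a<..<b} \<le> measure unit_lborel (lev f c)"
      using c by (intro U.finite_measure_mono_AE) auto
    then have "c \<in> atoms f"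
      using emeasure_unit_lborel_interval[of a b] ab by (simp add: atoms_def measure_def)
    then obtain k where "AE w in unit_lborel. w \<in> lev f c \<longrightarrow> rep_l2 y w = k" using * by blast
    with c have "AE w in unit_lborel. w \<in> {a<..<b} \<longrightarrow> rep_l2 y w = k" by eventually_elim auto
    then show "ess_constant y {a<..<b}" by (auto simp: ess_constant_def)
  qed
qed

lemma abs_in_sub_H_iff_levels:
  assumes f: "sq f" "mono_on {0<..<1} f" and h: "sq h"
  shows "abs_l2 h \<in> sub_H (abs_l2 f) \<longleftrightarrow> (\<forall>c\<in>atoms f. \<exists>k. AE w in unit_lborel. w \<in> lev f c \<longrightarrow> h w = k)"
proof -
  have "(AE w in unit_lborel. w \<in> lev f c \<longrightarrow> rep_l2 (abs_l2 h) w = k) \<longleftrightarrow> (AE w in unit_lborel. w \<in> lev f c \<longrightarrow> h w = k)" for c k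
  proof
    assume "AE w in unit_lborel. w \<in> lev f c \<longrightarrow> rep_l2 (abs_l2 h) w = k"
    with rep_abs_l2[OF h] show "AE w in unit_lborel. w \<in> lev f c \<longrightarrow> h w = k" by eventually_elim simp
  next
    assume "AE w in unit_lborel. w \<in> lev f c \<longrightarrow> h w = k"
    with rep_abs_l2[OF h] show "AE w in unit_lborel. w \<in> lev f c \<longrightarrow> rep_l2 (abs_l2 h) w = k" by eventually_elim simp
  qed
  then show ?thesis by (simp add: sub_H_iff_levels[OF f])
qed

lemma comp_in_sub_H:
  assumes f: "sq f" "mono_on {0<..<1} f" and u: "sq (\<lambda>w. u (f w))"
  shows "abs_l2 (\<lambda>w. u (f w)) \<in> sub_H (abs_l2 f)"
  using abs_in_sub_H_iff_levels[OF f u] by (auto simp: lev_def)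

text \<open>Off the charged levels the distribution function \<open>F\<close> of \<open>f\<close>
  inverts \<open>f\<close>, so \<open>y\<close> there is \<open>y\<close> after \<open>F\<close>
  evaluated at \<open>f\<close>; on the charged levels \<open>y\<close> is a constant that can be
  prescribed at the atom.\<close>

lemma sub_H_factor:
  assumes f: "sq f" "mono_on {0<..<1} f" and y: "y \<in> sub_H (abs_l2 f)"
  obtains u where "u \<in> borel_measurable borel" "AE w in unit_lborel. rep_l2 y w = u (f w)"
proof -
  have fm [measurable]: "f \<in> borel_measurable unit_lborel" using f by (simp add: square_integrable_def)
  obtain k where k: "\<And>c. c \<in> atoms f \<Longrightarrow> AE w in unit_lborel. w \<in> lev f c \<longrightarrow> rep_l2 y w = k c"
    using y sub_H_iff_levels[OF f] by metis
  define F where "F x = measure unit_lborel {w\<in>{0<..<1}. f w \<le> x}" for x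
  have sF [measurable]: "{w\<in>{0<..<1}. f w \<le> x} \<in> sets unit_lborel" for x
    using measurable_sets[OF fm, of "{..x}"] by (simp add: vimage_def Int_def conj_commute)
  have "mono F" unfolding F_def
    by (intro monoI U.finite_measure_mono sF) auto
  then have [measurable]: "F \<in> borel_measurable borel" by (rule borel_measurable_mono)
  \<comment> \<open>The sublevel set at \<open>f w\<close> contains \<open>{0<..w}\<close> and
    exceeds it at most by the level of \<open>w\<close>, which is null.\<close>
  have Ff: "F (f w) = w" if w: "0 < w" "w < 1" "f w \<notin> atoms f" for w
  proof -
    have s: "{0<..w} \<in> sets unit_lborel" using w by (auto simp: sets_unit_lborel)
    have m: "measure unit_lborel {0<..w} = w"
      using w by (simp add: unit_lborel_def measure_restrict_space subset_iff)
    have "measure unit_lborel {0<..w} \<le> F (f w)" unfolding F_def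
      using w f(2) by (intro U.finite_measure_mono sF) (auto simp: mono_on_def)
    moreover have "F (f w) \<le> measure unit_lborel ({0<..w} \<union> lev f (f w))" unfolding F_def
    proof (intro U.finite_measure_mono subsetI)
      fix w' assume w': "w' \<in> {wa \<in> {0<..<1}. f wa \<le> f w}"
      show "w' \<in> {0<..w} \<union> lev f (f w)"
      proof (cases "w' \<le> w")
        case False
        then have "f w \<le> f w'" using w' w f(2) by (auto simp: mono_on_def)
        then show ?thesis using w' by (auto simp: lev_def)
      qed (use w' in auto)
    qed (use s in measurable)
    moreover have "measure unit_lborel ({0<..w} \<union> lev f (f w)) \<le> measure unit_lborel {0<..w} + measure unit_lborel (lev f (f w))"
      using s by (intro measure_Un_le) auto
    moreover have "measure unit_lborel (lev f (f w)) = 0"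
      using w(3) by (simp add: atoms_def zero_less_measure_iff)
    ultimately show ?thesis using m by simp
  qed
  \<comment> \<open>The representative is measurable on the unit interval only. Extension by zero
    makes it a Borel function, as \<open>F\<close> also takes values outside the open
    interval.\<close>
  define h where "h w = indicator {0<..<1} w *\<^sub>R rep_l2 y w" for w :: real
  have [measurable]: "h \<in> borel_measurable borel"
    using rep_l2_measurable[of y] borel_measurable_restrict_space_iff[of "{0<..<1}" lborel "rep_l2 y"]
    unfolding h_def unit_lborel_def by simp
  define u where "u x = (if x \<in> atoms f then k x else h (F x))" for x
  have [measurable]: "u \<in> borel_measurable borel"
    by (rule measurable_discrete_difference[of "\<lambda>x. h (F x)" _ _ "atoms f"])
      (auto simp: u_def countable_atoms_f)
  have "AE w in unit_lborel. rep_l2 y w = u (f w)"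
  proof (rule AE_level_cases[OF fm])
    show "AE w in unit_lborel. w \<in> lev f c \<longrightarrow> rep_l2 y w = u (f w)" if "c \<in> atoms f" for c
      using k[OF that] by eventually_elim (use that in \<open>auto simp: u_def lev_def\<close>)
    show "AE w in unit_lborel. f w \<notin> atoms f \<longrightarrow> rep_l2 y w = u (f w)"
      by (rule AE_I2) (auto simp: u_def Ff h_def)
  qed
  then show ?thesis by (rule that[rotated]) measurable
qed

definition lev_avg :: "(real \<Rightarrow> real) \<Rightarrow> (real \<Rightarrow> real) \<Rightarrow> real \<Rightarrow> real" where
  "lev_avg f z c = (LINT w|unit_lborel. z w * indicator (lev f c) w) / measure unit_lborel (lev f c)"

lemma
  assumes f [measurable]: "f \<in> borel_measurable unit_lborel" and z: "integrable unit_lborel z" and c: "c \<in> atoms f"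
  shows lev_avg_le: "(\<And>w. w \<in> lev f c \<Longrightarrow> z w \<le> B) \<Longrightarrow> lev_avg f z c \<le> B"
    and lev_avg_ge: "(\<And>w. w \<in> lev f c \<Longrightarrow> B \<le> z w) \<Longrightarrow> B \<le> lev_avg f z c"
proof -
  have m: "measure unit_lborel (lev f c) > 0" using c by (simp add: atoms_def)
  have i: "integrable unit_lborel (\<lambda>w. z w * indicator (lev f c) w)"
    by (rule Bochner_Integration.integrable_bound[OF z]) (use z in \<open>auto split: split_indicator\<close>)
  have B: "(LINT w|unit_lborel. B * indicator (lev f c) w) = B * measure unit_lborel (lev f c)"
    by (simp add: lev_Int)
  have iB: "integrable unit_lborel (\<lambda>w. B * indicator (lev f c) w)"
    by (rule U.integrable_const_bound[where B="\<bar>B\<bar>"]) (auto split: split_indicator)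
  show "lev_avg f z c \<le> B" if "\<And>w. w \<in> lev f c \<Longrightarrow> z w \<le> B"
  proof -
    have "(LINT w|unit_lborel. z w * indicator (lev f c) w) \<le> (LINT w|unit_lborel. B * indicator (lev f c) w)"
      using that by (intro integral_mono i iB) (auto split: split_indicator)
    then show ?thesis using m by (simp add: lev_avg_def B lev_Int divide_le_eq)
  qed
  show "B \<le> lev_avg f z c" if "\<And>w. w \<in> lev f c \<Longrightarrow> B \<le> z w"
  proof -
    have "(LINT w|unit_lborel. B * indicator (lev f c) w) \<le> (LINT w|unit_lborel. z w * indicator (lev f c) w)"
      using that by (intro integral_mono i iB) (auto split: split_indicator)
    then show ?thesis using m by (simp add: lev_avg_def B lev_Int le_divide_eq)
  qed
qed

text \<open>For monotone \<open>f\<close> this is the conditional expectation of \<open>z\<close>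
  given \<open>f\<close>: a level that is not charged is a single point, so nothing is averaged
  there.\<close>

definition lev_proj :: "(real \<Rightarrow> real) \<Rightarrow> (real \<Rightarrow> real) \<Rightarrow> real \<Rightarrow> real" where
  "lev_proj f z w = (if f w \<in> atoms f then lev_avg f z (f w) else z w)"

text \<open>Levels of \<open>f\<close> are ordered like intervals. If \<open>w\<close> lies in a
  lower level than \<open>v\<close>, then \<open>z v\<close> dominates \<open>z\<close> on the whole
  level of \<open>w\<close> and hence its average; averaging over the level of \<open>v\<close>
  afterwards keeps the bound.\<close>

lemma mono_lev_proj:
  assumes f: "sq f" "mono_on {0<..<1} f" and z: "sq z" "mono_on {0<..<1} z"
  shows "mono_on {0<..<1} (lev_proj f z)"
proof (rule mono_onI)
  have fm: "f \<in> borel_measurable unit_lborel" using f by (simp add: square_integrable_def)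
  have zi: "integrable unit_lborel z" using z by (simp add: U.integrable_of_square_integrable)
  note le = lev_avg_le[OF fm zi] and ge = lev_avg_ge[OF fm zi]
  have fD: "v < v'" if "f v < f v'" "v \<in> {0<..<1}" "v' \<in> {0<..<1}" for v v'
    using that f(2) by (metis linorder_not_less mono_onD)
  have up: "lev_proj f z w \<le> z v" if "f w < f v" "w \<in> {0<..<1}" "v \<in> {0<..<1}" for w v
  proof -
    have *: "z w' \<le> z v" if "w' \<in> lev f (f w)" for w'
      using fD[of w' v] that \<open>f w < f v\<close> \<open>v \<in> _\<close> z(2) by (auto simp: lev_def mono_on_def)
    show ?thesis using *[of w] that by (auto simp: lev_proj_def lev_def intro!: le *)
  qed
  fix w w' :: real assume w: "w \<in> {0<..<1}" "w' \<in> {0<..<1}" "w \<le> w'"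
  then have "f w \<le> f w'" using f(2) by (simp add: mono_on_def)
  then consider "f w = f w'" | "f w < f w'" by linarith
  then show "lev_proj f z w \<le> lev_proj f z w'"
  proof cases
    case 1
    then show ?thesis using w z(2) by (auto simp: lev_proj_def mono_on_def)
  next
    case 2
    have "lev_proj f z w \<le> z v" if "v \<in> lev f (f w')" for v
      using up[of w v] 2 that w by (auto simp: lev_def)
    then show ?thesis using w 2 up[of w w'] by (auto simp: lev_proj_def[of f z w'] lev_def intro!: ge)
  qed
qed

lemma sq_indicator_mult: "sq z \<Longrightarrow> A \<in> sets unit_lborel \<Longrightarrow> sq (\<lambda>w. z w * indicator A w)"
  by (rule square_integrable_mult_indicator[where B=1]) (auto split: split_indicator)

text \<open>Orthogonality of the residual is tested levelwise. The indicator of a charged level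
  identifies the constant as the average; on the uncharged part the residual itself is an admissible
  test function and so vanishes. This gives the abstract projection a representative that is visibly
  monotone.\<close>

lemma PH_eq_lev_proj:
  assumes f: "sq f" "mono_on {0<..<1} f" and z: "sq z" "mono_on {0<..<1} z"
  shows "sq (lev_proj f z)" "PH (abs_l2 f) (abs_l2 z) = abs_l2 (lev_proj f z)"
proof -
  have fm [measurable]: "f \<in> borel_measurable unit_lborel" using f by (simp add: square_integrable_def)
  have zm [measurable]: "z \<in> borel_measurable unit_lborel" using z by (simp add: square_integrable_def)
  define P where "P = PH (abs_l2 f) (abs_l2 z)"
  define p where "p = rep_l2 P"
  have p: "sq p" "P = abs_l2 p" by (simp_all add: p_def)
  have pm [measurable]: "p \<in> borel_measurable unit_lborel" by (simp add: p_def)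
  have PH: "P \<in> sub_H (abs_l2 f)" unfolding P_def by (rule PH_mem)
  have orth: "(LINT w|unit_lborel. (z w - p w) * g w) = 0" if "sq g" "abs_l2 g \<in> sub_H (abs_l2 f)" for g
  proof -
    have "inner (abs_l2 z - P) (abs_l2 g) = 0" unfolding P_def by (rule PH_orth[OF that(2)])
    then show ?thesis using that z p by (simp add: abs_l2_diff abs_l2_inner square_integrable_diff)
  qed
  have ae: "AE w in unit_lborel. p w = lev_proj f z w"
  proof (rule AE_level_cases[OF fm])
    fix c assume c: "c \<in> atoms f"
    obtain k where k: "AE w in unit_lborel. w \<in> lev f c \<longrightarrow> p w = k"
      using PH c sub_H_iff_levels[OF f] unfolding p_def by blast
    define g where "g = (indicator (lev f c) :: real \<Rightarrow> real)"
    have [measurable]: "g \<in> borel_measurable unit_lborel" unfolding g_def by measurable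
    have g: "sq g" by (rule U.square_integrable_bounded[of _ 1]) (auto simp: g_def split: split_indicator)
    have "abs_l2 g \<in> sub_H (abs_l2 f)"
      using abs_in_sub_H_iff_levels[OF f g]
      by (auto simp: g_def lev_def indicator_def)
    from orth[OF g this] have "(LINT w|unit_lborel. z w * g w) = (LINT w|unit_lborel. p w * g w)"
      using square_integrable_mult[OF z(1) g] square_integrable_mult[OF p(1) g] by (simp add: left_diff_distrib)
    also have "\<dots> = (LINT w|unit_lborel. k * g w)"
      by (rule integral_cong_AE) (use k in \<open>auto simp: g_def split: split_indicator elim!: eventually_mono\<close>)
    also have "\<dots> = k * measure unit_lborel (lev f c)"
      by (simp add: lev_Int g_def)
    finally have "lev_avg f z c = k"
      using c by (simp add: lev_avg_def g_def atoms_def)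
    with k show "AE w in unit_lborel. w \<in> lev f c \<longrightarrow> p w = lev_proj f z w"
      by (auto simp: lev_proj_def lev_def c elim!: eventually_mono)
  next
    define A where "A = {w \<in> space unit_lborel. f w \<notin> atoms f}"
    have A [measurable]: "A \<in> sets unit_lborel"
    proof -
      have "A = space unit_lborel - {w \<in> space unit_lborel. f w \<in> atoms f}" by (auto simp: A_def)
      then show ?thesis using sets.Diff[OF sets.top atoms_measurable[OF fm]] by simp
    qed
    define g where "g w = (z w - p w) * indicator A w" for w
    have g: "sq g" unfolding g_def using z p A by (intro sq_indicator_mult square_integrable_diff)
    have "abs_l2 g \<in> sub_H (abs_l2 f)"
      using abs_in_sub_H_iff_levels[OF f g] by (auto simp: g_def lev_def A_def indicator_def intro!: exI[of _ 0] AE_I2)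
    from orth[OF g this] have "(LINT w|unit_lborel. (z w - p w) * g w) = 0" .
    also have "(\<lambda>w. (z w - p w) * g w) = (\<lambda>w. (g w)\<^sup>2)"
      by (rule ext) (auto simp: g_def power2_eq_square indicator_def)
    finally have "(LINT w|unit_lborel. (g w)\<^sup>2) = 0" .
    then have "AE w in unit_lborel. (g w)\<^sup>2 = 0"
      using g by (subst (asm) integral_nonneg_eq_0_iff_AE) (auto simp: square_integrable_def)
    then show "AE w in unit_lborel. f w \<notin> atoms f \<longrightarrow> p w = lev_proj f z w"
      using AE_space by eventually_elim (auto simp: g_def A_def lev_proj_def)
  qed
  have m: "lev_proj f z \<in> borel_measurable unit_lborel"
    by (rule mono_on_imp_measurable_unit_lborel[OF mono_lev_proj[OF f z]])
  show "sq (lev_proj f z)" by (rule square_integrable_cong_AE[OF p(1) m ae])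
  then show "PH (abs_l2 f) (abs_l2 z) = abs_l2 (lev_proj f z)"
    using abs_l2_eq_iff[OF p(1)] ae p(2) by (simp add: P_def)
qed

lemma PH_cone_K: "x \<in> cone_K \<Longrightarrow> z \<in> cone_K \<Longrightarrow> PH x z \<in> cone_K"
  by (elim cone_K_cases) (auto simp: PH_eq_lev_proj intro!: cone_KI mono_lev_proj)

text \<open>On the level, the deviation of \<open>z\<close> from its average has mean zero and
  changes sign once, from nonpositive to positive. A nondecreasing weight \<open>y\<close> therefore
  correlates with it nonnegatively.\<close>

lemma Chebyshev_level:
  assumes f: "sq f" and z: "sq z" "mono_on {0<..<1} z"
    and y: "sq y" "mono_on {0<..<1} y" and c: "c \<in> atoms f"
  shows "0 \<le> (LINT w|unit_lborel. y w * (z w - lev_avg f z c) * indicator (lev f c) w)"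
proof -
  have fm [measurable]: "f \<in> borel_measurable unit_lborel" using f by (simp add: square_integrable_def)
  have zm [measurable]: "z \<in> borel_measurable unit_lborel" using z by (simp add: square_integrable_def)
  have ym [measurable]: "y \<in> borel_measurable unit_lborel" using y by (simp add: square_integrable_def)
  define L where "L = lev f c"
  have L [measurable]: "L \<in> sets unit_lborel" unfolding L_def by measurable
  have L01: "L \<subseteq> {0<..<1}" by (auto simp: L_def lev_def)
  define a where "a = lev_avg f z c"
  define h where "h w = (z w - a) * indicator L w" for w
  have h: "sq h" unfolding h_def by (intro sq_indicator_mult square_integrable_diff z U.square_integrable_const L)
  have hm [measurable]: "h \<in> borel_measurable unit_lborel" using h by (simp add: square_integrable_def)
  have hi: "integrable unit_lborel h" by (rule U.integrable_of_square_integrable[OF h])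
  have m: "measure unit_lborel L > 0" using c by (simp add: atoms_def L_def)
  have h0: "(LINT w|unit_lborel. h w) = 0"
  proof -
    have "(LINT w|unit_lborel. h w) = (LINT w|unit_lborel. z w * indicator L w) - (LINT w|unit_lborel. a * indicator L w)"
      unfolding h_def left_diff_distrib
      by (intro Bochner_Integration.integral_diff U.integrable_of_square_integrable sq_indicator_mult z L U.square_integrable_const)
    also have "(LINT w|unit_lborel. a * indicator L w) = a * measure unit_lborel L"
      using sets.sets_into_space[OF L] by (simp add: Int_absorb2)
    also have "\<dots> = (LINT w|unit_lborel. z w * indicator L w)"
      using m by (simp add: a_def lev_avg_def L_def)
    finally show ?thesis by simp
  qed
  have goal: "(LINT w|unit_lborel. y w * (z w - lev_avg f z c) * indicator (lev f c) w) = (LINT w|unit_lborel. y w * h w)"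
    by (simp add: h_def a_def L_def mult.assoc)
  define A where "A = {w\<in>L. z w > a}"
  \<comment> \<open>If the deviation has a constant sign, its vanishing mean forces it to be zero;
    only the third case needs a threshold.\<close>
  consider "A = {}" | "L - A = {}" | "A \<noteq> {}" "L - A \<noteq> {}" by blast
  then have "0 \<le> (LINT w|unit_lborel. y w * h w)"
  proof cases
    case 3
    then obtain v where "v \<in> L - A" by blast
    then have v: "v \<in> L" "z v \<le> a" by (auto simp: A_def)
    \<comment> \<open>\<open>r\<close> separates the values of \<open>y\<close> on the two parts of
      the level. Subtracting it from \<open>y\<close> changes nothing, since \<open>h\<close> has
      mean zero, and makes the integrand nonnegative.\<close>
    define r where "r = Inf (y ` A)"
    have below: "y w \<le> y w'" if "w \<in> L - A" "w' \<in> A" for w w'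
    proof -
      have "z w < z w'" using that by (auto simp: A_def)
      have 01: "w \<in> {0<..<1}" "w' \<in> {0<..<1}" using that L01 by (auto simp: A_def)
      have "w \<le> w'"
      proof (rule ccontr)
        assume "\<not> w \<le> w'"
        then have "z w' \<le> z w" using 01 by (intro mono_onD[OF z(2)]) auto
        then show False using \<open>z w < z w'\<close> by simp
      qed
      then show ?thesis using 01 by (intro mono_onD[OF y(2)])
    qed
    have bdd: "bdd_below (y ` A)" using below[of v] v by (intro bdd_belowI2[of _ "y v"]) (auto simp: A_def)
    have r1: "r \<le> y w" if "w \<in> A" for w unfolding r_def using that bdd by (intro cINF_lower)
    have r2: "y w \<le> r" if "w \<in> L - A" for w unfolding r_def using that 3 below by (intro cINF_greatest) auto
    have "0 \<le> (LINT w|unit_lborel. (y w - r) * h w)"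
    proof (intro integral_nonneg_AE AE_I2)
      fix w
      show "0 \<le> (y w - r) * h w"
      proof (cases "w \<in> A")
        case True
        then show ?thesis using r1[OF True] by (auto simp: h_def A_def)
      next
        case False
        then show ?thesis using r2[of w] by (cases "w \<in> L") (auto simp: h_def A_def intro!: mult_nonpos_nonpos)
      qed
    qed
    also have "\<dots> = (LINT w|unit_lborel. y w * h w) - r * (LINT w|unit_lborel. h w)"
      using square_integrable_mult[OF y(1) h] hi by (simp add: left_diff_distrib)
    finally show ?thesis using h0 by simp
  next
    case 1
    then have "(LINT w|unit_lborel. - h w) = 0" "AE w in unit_lborel. 0 \<le> - h w"
      using h0 by (auto simp: h_def A_def not_less split: split_indicator)
    then have "AE w in unit_lborel. h w = 0"
      using hi by (subst (asm) integral_nonneg_eq_0_iff_AE) auto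
    then have "AE w in unit_lborel. y w * h w = 0" by eventually_elim simp
    then show ?thesis using integral_eq_zero_AE by (metis order_refl)
  next
    case 2
    then have "a \<le> z w" if "w \<in> L" for w
      using that by (auto simp: A_def intro: less_imp_le)
    then have "AE w in unit_lborel. 0 \<le> h w"
      by (auto simp: h_def split: split_indicator)
    with h0 have "AE w in unit_lborel. h w = 0"
      using hi by (subst (asm) integral_nonneg_eq_0_iff_AE) auto
    then have "AE w in unit_lborel. y w * h w = 0" by eventually_elim simp
    then show ?thesis using integral_eq_zero_AE by (metis order_refl)
  qed
  then show ?thesis using goal by simp
qed

lemma le_of_enn2real_le:
  fixes a b :: ennreal
  shows "a \<noteq> \<infinity> \<Longrightarrow> b \<noteq> \<infinity> \<Longrightarrow> enn2real a \<le> enn2real b \<Longrightarrow> a \<le> b"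
  by (cases a; cases b) auto

text \<open>The sum over levels is taken separately for the positive and the negative part, in
  extended nonnegative integrals, where countable additivity holds without any convergence argument;
  levelwise comparison then sums up.\<close>

lemma integral_nonneg_of_levels:
  fixes g :: "real \<Rightarrow> real"
  assumes f [measurable]: "f \<in> borel_measurable unit_lborel" and g: "integrable unit_lborel g"
    and 0: "\<And>w. w \<in> {0<..<1} \<Longrightarrow> f w \<notin> atoms f \<Longrightarrow> g w = 0"
    and 1: "\<And>c. c \<in> atoms f \<Longrightarrow> 0 \<le> (LINT w|unit_lborel. g w * indicator (lev f c) w)"
  shows "0 \<le> (LINT w|unit_lborel. g w)"
proof -
  have [measurable]: "g \<in> borel_measurable unit_lborel" using g by simp
  \<comment> \<open>Indices that enumerate no atom get the empty set, so finite and infinite sets of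
    atoms are treated alike.\<close>
  define B where "B n = (if n \<in> to_nat_on (atoms f) ` atoms f then lev f (from_nat_into (atoms f) n) else {})" for n
  have Bs: "B n \<in> sets unit_lborel" for n by (auto simp: B_def)
  have inj: "from_nat_into (atoms f) (to_nat_on (atoms f) c) = c" if "c \<in> atoms f" for c
    using that countable_atoms_f[OF f] by simp
  have disj: "disjoint_family B"
    by (auto simp: disjoint_family_on_def B_def lev_def inj)
  have Un: "(\<Union>n. B n) = {w\<in>{0<..<1}. f w \<in> atoms f}"
    by (auto simp: B_def lev_def inj split: if_splits)
  have split: "(\<integral>\<^sup>+w. ennreal (s * g w) \<partial>unit_lborel) = (\<Sum>n. (\<integral>\<^sup>+w\<in>B n. ennreal (s * g w) \<partial>unit_lborel))" for s :: real
  proof -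
    have "(\<integral>\<^sup>+w. ennreal (s * g w) \<partial>unit_lborel) = (\<integral>\<^sup>+w\<in>(\<Union>n. B n). ennreal (s * g w) \<partial>unit_lborel)"
      by (rule nn_integral_cong) (auto simp: Un 0 split: split_indicator)
    then show ?thesis
      using nn_integral_disjoint_family[OF _ Bs disj, of "\<lambda>w. ennreal (s * g w)"] by simp
  qed
  have int: "(LINT w|unit_lborel. h w) = enn2real (\<integral>\<^sup>+w. ennreal (h w) \<partial>unit_lborel) - enn2real (\<integral>\<^sup>+w. ennreal (- h w) \<partial>unit_lborel)"
    and fin: "(\<integral>\<^sup>+w. ennreal (h w) \<partial>unit_lborel) \<noteq> \<infinity>" "(\<integral>\<^sup>+w. ennreal (- h w) \<partial>unit_lborel) \<noteq> \<infinity>"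
    if "integrable unit_lborel h" for h
    using that real_lebesgue_integral_def[OF that] by (auto simp: real_integrable_def)
  have "(\<integral>\<^sup>+w\<in>B n. ennreal (-1 * g w) \<partial>unit_lborel) \<le> (\<integral>\<^sup>+w\<in>B n. ennreal (1 * g w) \<partial>unit_lborel)" for n
  proof (cases "n \<in> to_nat_on (atoms f) ` atoms f")
    case True
    then obtain c where c: "c \<in> atoms f" "B n = lev f c" by (auto simp: B_def inj)
    define h where "h w = g w * indicator (lev f c) w" for w
    have h: "integrable unit_lborel h" unfolding h_def
      by (rule Bochner_Integration.integrable_bound[OF g]) (auto split: split_indicator)
    have e: "(\<integral>\<^sup>+w\<in>B n. ennreal (s * g w) \<partial>unit_lborel) = (\<integral>\<^sup>+w. ennreal (s * h w) \<partial>unit_lborel)" for s :: real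
      by (rule nn_integral_cong) (auto simp: c h_def split: split_indicator)
    have "enn2real (\<integral>\<^sup>+w. ennreal (- h w) \<partial>unit_lborel) \<le> enn2real (\<integral>\<^sup>+w. ennreal (h w) \<partial>unit_lborel)"
      using 1[OF c(1)] int[OF h] by (simp add: h_def)
    then show ?thesis
      using le_of_enn2real_le[OF fin(2)[OF h] fin(1)[OF h]] unfolding e by simp
  qed (simp add: B_def)
  then have "(\<integral>\<^sup>+w. ennreal (-1 * g w) \<partial>unit_lborel) \<le> (\<integral>\<^sup>+w. ennreal (1 * g w) \<partial>unit_lborel)"
    unfolding split by (intro suminf_le) auto
  then show ?thesis
    using int[OF g] fin[OF g] by (simp add: enn2real_mono less_top)
qed

lemma PH_polar:
  assumes "x \<in> cone_K" "y \<in> cone_K" "z \<in> cone_K"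
  shows "inner (PH x y - y) z \<le> 0"
proof -
  obtain f where f: "sq f" "mono_on {0<..<1} f" "x = abs_l2 f" using assms cone_K_cases by blast
  obtain g where g: "sq g" "mono_on {0<..<1} g" "y = abs_l2 g" using assms cone_K_cases by blast
  obtain h where h: "sq h" "mono_on {0<..<1} h" "z = abs_l2 h" using assms cone_K_cases by blast
  have fm [measurable]: "f \<in> borel_measurable unit_lborel" using f by (simp add: square_integrable_def)
  note p = PH_eq_lev_proj[OF f(1,2) h(1,2)]
  have d: "sq (\<lambda>w. h w - lev_proj f h w)" by (intro square_integrable_diff h p)
  have "inner (y - PH x y) z = inner y (z - PH x z)"
    by (simp add: inner_diff_left inner_diff_right PH_selfadjoint)
  also have "\<dots> = (LINT w|unit_lborel. g w * (h w - lev_proj f h w))"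
    by (simp add: f(3) g(3) h(3) p abs_l2_diff h(1) abs_l2_inner g(1) d)
  also have "\<dots> \<ge> 0"
  proof (rule integral_nonneg_of_levels[OF fm square_integrable_mult[OF g(1) d]])
    fix c assume c: "c \<in> atoms f"
    have "(LINT w|unit_lborel. g w * (h w - lev_proj f h w) * indicator (lev f c) w)
      = (LINT w|unit_lborel. g w * (h w - lev_avg f h c) * indicator (lev f c) w)"
      by (rule Bochner_Integration.integral_cong) (auto simp: lev_proj_def lev_def c split: split_indicator)
    then show "0 \<le> (LINT w|unit_lborel. g w * (h w - lev_proj f h w) * indicator (lev f c) w)"
      using Chebyshev_level[OF f(1) h(1,2) g(1,2) c] by simp
  qed (simp add: lev_proj_def)
  finally show ?thesis by (simp add: inner_diff_left)
qed

text \<open>The lineality space of the cone of feasible directions at \<open>x\<close>.\<close>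

definition tangent_span :: "l2 \<Rightarrow> l2 set" where
  "tangent_span x = {v. \<exists>e>0. x + e *\<^sub>R v \<in> cone_K \<and> x - e *\<^sub>R v \<in> cone_K}"

lemma tangent_span_shrink:
  assumes x: "x \<in> cone_K" and e: "0 < d" "d \<le> e" and v: "x + e *\<^sub>R v \<in> cone_K"
  shows "x + d *\<^sub>R v \<in> cone_K"
proof -
  have "x + d *\<^sub>R v = (1 - d / e) *\<^sub>R x + (d / e) *\<^sub>R (x + e *\<^sub>R v)"
    using e by (simp add: algebra_simps)
  also have "\<dots> \<in> cone_K"
    using e by (intro cone_K_add cone_K_scaleR x v) (auto simp: divide_le_eq)
  finally show ?thesis .
qed

lemma subspace_tangent_span:
  assumes x: "x \<in> cone_K"
  shows "subspace (tangent_span x)"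
  unfolding subspace_def
proof (intro conjI ballI allI)
  show "0 \<in> tangent_span x" using x by (auto simp: tangent_span_def intro: exI[of _ 1])
  fix v w assume "v \<in> tangent_span x" "w \<in> tangent_span x"
  then obtain d e where d: "d > 0" "x + d *\<^sub>R v \<in> cone_K" "x + d *\<^sub>R (- v) \<in> cone_K"
    and e: "e > 0" "x + e *\<^sub>R w \<in> cone_K" "x + e *\<^sub>R (- w) \<in> cone_K"
    by (auto simp: tangent_span_def)
  define m where "m = min d e"
  have m: "m > 0" "m \<le> d" "m \<le> e" using d e by (auto simp: m_def)
  have half: "x + (m/2) *\<^sub>R (v' + w') \<in> cone_K" if "x + m *\<^sub>R v' \<in> cone_K" "x + m *\<^sub>R w' \<in> cone_K" for v' w'
  proof -
    have "x + (m/2) *\<^sub>R (v' + w') = (1/2) *\<^sub>R (x + m *\<^sub>R v') + (1/2) *\<^sub>R (x + m *\<^sub>R w')"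
      by (simp add: algebra_simps flip: scaleR_left.add)
    moreover have "\<dots> \<in> cone_K"
      by (intro cone_K_add cone_K_scaleR that) simp_all
    ultimately show ?thesis by simp
  qed
  have "x + (m/2) *\<^sub>R (v + w) \<in> cone_K" "x + (m/2) *\<^sub>R (- v + - w) \<in> cone_K"
    by (intro half tangent_span_shrink[OF x m(1,2) d(2)] tangent_span_shrink[OF x m(1,3) e(2)]
        tangent_span_shrink[OF x m(1,2) d(3)] tangent_span_shrink[OF x m(1,3) e(3)])+
  moreover have "x + (m/2) *\<^sub>R (- v + - w) = x - (m/2) *\<^sub>R (v + w)" by (simp add: algebra_simps)
  ultimately show "v + w \<in> tangent_span x"
    using m(1) by (auto simp: tangent_span_def intro!: exI[of _ "m/2"])
next
  fix c v assume "v \<in> tangent_span x"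
  then obtain d where d: "d > 0" "x + d *\<^sub>R v \<in> cone_K" "x - d *\<^sub>R v \<in> cone_K"
    by (auto simp: tangent_span_def)
  show "c *\<^sub>R v \<in> tangent_span x"
  proof (cases "c = 0")
    case True
    then show ?thesis using x by (auto simp: tangent_span_def intro: exI[of _ 1])
  next
    case False
    have "(d / \<bar>c\<bar>) *\<^sub>R (c *\<^sub>R v) = d *\<^sub>R v \<or> (d / \<bar>c\<bar>) *\<^sub>R (c *\<^sub>R v) = - (d *\<^sub>R v)"
      using False by (cases "c > 0") auto
    then show ?thesis
      using d False by (auto simp: tangent_span_def intro!: exI[of _ "d / \<bar>c\<bar>"])
  qed
qed

text \<open>A small multiple of a Lipschitz function cannot destroy the monotonicity of the
  identity, so adding it to \<open>f\<close> stays in the cone; subtracting it does too because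
  cutoffs are antitone.\<close>

lemma cutoff_in_tangent_span:
  assumes f: "sq f" "mono_on {0<..<1} f"
  shows "sq (\<lambda>w. cutoff k c (f w))" "abs_l2 (\<lambda>w. cutoff k c (f w)) \<in> tangent_span (abs_l2 f)"
proof -
  have [measurable]: "f \<in> borel_measurable unit_lborel" using f by (simp add: square_integrable_def)
  show s: "sq (\<lambda>w. cutoff k c (f w))"
    using cutoff_bounds by (intro U.square_integrable_bounded[of _ 1]) auto
  \<comment> \<open>The inverse Lipschitz constant, with \<open>+ 1\<close> to keep \<open>e\<close>
    positive also for \<open>k = 0\<close>.\<close>
  define e where "e = 1 / (real k + 1)"
  have e: "e > 0" "e * real k \<le> 1" by (auto simp: e_def field_simps)
  have 1: "x + e * cutoff k c x \<le> y + e * cutoff k c y" if "x \<le> y" for x y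
  proof -
    have "e * (cutoff k c x - cutoff k c y) \<le> e * (real k * (y - x))"
      using e cutoff_lipschitz[OF that] by (intro mult_left_mono) auto
    also have "\<dots> \<le> 1 * (y - x)" unfolding mult.assoc[symmetric] using e that by (intro mult_right_mono) auto
    finally show ?thesis by (simp add: algebra_simps)
  qed
  have 2: "x - e * cutoff k c x \<le> y - e * cutoff k c y" if "x \<le> y" for x y
    using e cutoff_antimono[OF that, of k c] that mult_left_mono[of "cutoff k c y" "cutoff k c x" e] by linarith
  have "abs_l2 f + e *\<^sub>R abs_l2 (\<lambda>w. cutoff k c (f w)) \<in> cone_K"
    using f(2) by (auto simp: abs_l2_scaleR abs_l2_add s f square_integrable_scale mono_on_def
        intro!: cone_KI square_integrable_add 1)
  moreover have "abs_l2 f - e *\<^sub>R abs_l2 (\<lambda>w. cutoff k c (f w)) \<in> cone_K"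
    using f(2) by (auto simp: abs_l2_scaleR abs_l2_diff s f square_integrable_scale mono_on_def
        intro!: cone_KI square_integrable_diff 2)
  ultimately show "abs_l2 (\<lambda>w. cutoff k c (f w)) \<in> tangent_span (abs_l2 f)"
    using e by (auto simp: tangent_span_def)
qed

text \<open>A vector orthogonal to all cutoffs of \<open>f\<close> is orthogonal to the indicators
  of its sublevel sets, hence to every square integrable function of \<open>f\<close>, and
  \<open>sub_H x\<close> consists of such functions.\<close>

lemma sub_H_subset_closure_tangent_span:
  assumes x: "x \<in> cone_K"
  shows "sub_H x \<subseteq> closure (tangent_span x)"
proof
  obtain f where f: "sq f" "mono_on {0<..<1} f" "x = abs_l2 f" using x cone_K_cases by blast
  have fm [measurable]: "f \<in> borel_measurable unit_lborel" using f by (simp add: square_integrable_def)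
  fix y assume y: "y \<in> sub_H x"
  obtain u where u [measurable]: "u \<in> borel_measurable borel" and yu: "AE w in unit_lborel. rep_l2 y w = u (f w)"
    using sub_H_factor[OF f(1,2)] y f(3) by blast
  have su: "sq (\<lambda>w. u (f w))" by (rule square_integrable_cong_AE[OF sq_rep_l2 _ yu]) measurable
  have yu': "y = abs_l2 (\<lambda>w. u (f w))" using abs_l2_eq_iff[OF sq_rep_l2 su] yu by simp
  show "y \<in> closure (tangent_span x)"
  proof (rule in_closure_of_orthogonal[OF subspace_tangent_span[OF x]])
    fix g assume g: "\<And>z. z \<in> tangent_span x \<Longrightarrow> inner g z = 0"
    have "(LINT w|unit_lborel. rep_l2 g w * u (f w)) = 0"
    proof (rule integral_comp_eq_zero_of_cutoff[OF _ fm _ u])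
      fix k c
      show "(LINT w|unit_lborel. rep_l2 g w * cutoff k c (f w)) = 0"
        using g[OF cutoff_in_tangent_span(2)[OF f(1,2), folded f(3)]]
          abs_l2_inner[OF sq_rep_l2 cutoff_in_tangent_span(1)[OF f(1,2)], of g] by simp
    qed (auto intro: U.integrable_of_square_integrable square_integrable_mult[OF sq_rep_l2 su])
    then show "inner g y = 0" using abs_l2_inner[OF sq_rep_l2 su, of g] yu' by simp
  qed
qed

section \<open>The projected flow\<close>

lemma subdiff_orthogonal_sub_H:
  assumes "\<xi> \<in> subdiff_indicator cone_K x" "y \<in> sub_H x"
  shows "inner \<xi> y = 0"
proof -
  have x: "x \<in> cone_K" "inner \<xi> x = 0" and le: "\<And>z. z \<in> cone_K \<Longrightarrow> inner \<xi> z \<le> 0"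
    using assms(1) by (auto simp: subdiff_cone_K_iff)
  have "tangent_span x \<subseteq> {y. inner \<xi> y = 0}"
  proof safe
    fix v assume "v \<in> tangent_span x"
    then obtain e where e: "e > 0" "x + e *\<^sub>R v \<in> cone_K" "x - e *\<^sub>R v \<in> cone_K"
      by (auto simp: tangent_span_def)
    have "e * inner \<xi> v \<le> 0" "e * inner \<xi> v \<ge> 0"
      using le[OF e(2)] le[OF e(3)] x(2) by (simp_all add: inner_add_right inner_diff_right)
    then show "inner \<xi> v = 0" using e(1) by (auto simp: mult_le_0_iff zero_le_mult_iff)
  qed
  moreover have "closed {y. inner \<xi> y = 0}"
    by (intro closed_Collect_eq continuous_intros)
  ultimately have "closure (tangent_span x) \<subseteq> {y. inner \<xi> y = 0}"
    by (rule closure_minimal)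
  then show ?thesis
    using sub_H_subset_closure_tangent_span[OF x(1)] assms(2) by blast
qed

lemma PH_subdiff_eq_0: "\<xi> \<in> subdiff_indicator cone_K x \<Longrightarrow> PH x \<xi> = 0"
  by (rule orth_proj_eqI[OF subspace_sub_H])
    (auto simp: subdiff_orthogonal_sub_H subspace_0[OF subspace_sub_H])

lemma PK_self: "x \<in> cone_K \<Longrightarrow> PK x = x"
  by (simp add: PK_eq_iff subdiff_cone_K_iff)

lemma PK_subdiff: "g - PK g \<in> subdiff_indicator cone_K (PK g)"
  using PK_eq_iff[of g "PK g"] by simp

text \<open>Averaging the nearest point over the levels of \<open>x\<close> keeps it in the cone
  and, as \<open>g\<close> is constant on these levels, does not move it away from \<open>g\<close>.
  By uniqueness the nearest point equals its average.\<close>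

lemma PK_in_sub_H:
  assumes x: "x \<in> cone_K" and g: "g \<in> sub_H x"
  shows "PK g \<in> sub_H x"
proof -
  define p where "p = PK g"
  define q where "q = PH x p"
  have q: "q \<in> cone_K" "q \<in> sub_H x"
    unfolding q_def p_def using PH_cone_K[OF x PK_mem] PH_mem by auto
  have "inner (g - p) (q - p) \<le> 0"
    unfolding p_def using PK_subdiff[of g] q(1) by (simp add: subdiff_indicator_def PK_mem)
  moreover have "inner (p - q) g = 0" "inner (p - q) q = 0"
    using PH_orth[OF g, of p] PH_orth[OF q(2), of p] unfolding q_def by auto
  ultimately have "inner (q - p) (q - p) \<le> 0"
    by (simp add: inner_diff_left inner_diff_right inner_commute)
  then have "inner (q - p) (q - p) = 0" by (rule antisym) simp
  then have "q = p" by simp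
  then show ?thesis using q(2) by (simp add: p_def)
qed

lemma has_vector_derivative_withinI:
  assumes "\<And>e. e > 0 \<Longrightarrow> \<exists>d>0. \<forall>s\<in>S. \<bar>s - t\<bar> < d \<longrightarrow> norm (f s - f t - (s - t) *\<^sub>R D) \<le> e * \<bar>s - t\<bar>"
  shows "(f has_vector_derivative D) (at t within S)"
  unfolding has_vector_derivative_def has_derivative_within_alt
  using assms by (auto intro: bounded_linear_scaleR_left)

lemma abs_continuous_on_lipschitz:
  assumes "C-lipschitz_on I f"
  shows "abs_continuous_on I f"
  unfolding abs_continuous_on_def
proof (intro allI impI)
  have C: "C \<ge> 0" using assms by (rule lipschitz_on_nonneg)
  fix e :: real assume e: "e > 0"
  show "\<exists>d>0. \<forall>(n::nat) a b. (\<forall>i<n. a i \<le> b i \<and> {a i..b i} \<subseteq> I) \<longrightarrow>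
     (\<forall>i<n. \<forall>j<n. i \<noteq> j \<longrightarrow> {a i<..<b i} \<inter> {a j<..<b j} = {}) \<longrightarrow>
     (\<Sum>i<n. b i - a i) < d \<longrightarrow> (\<Sum>i<n. dist (f (a i)) (f (b i))) < e"
  \<comment> \<open>The \<open>+ 1\<close> covers the Lipschitz constant \<open>0\<close>.\<close>
  proof (intro exI[of _ "e / (C + 1)"] conjI allI impI)
    show "e / (C + 1) > 0" using e C by simp
    fix n :: nat and a b :: "nat \<Rightarrow> real"
    assume ab: "\<forall>i<n. a i \<le> b i \<and> {a i..b i} \<subseteq> I" and s: "(\<Sum>i<n. b i - a i) < e / (C + 1)"
    have pos: "0 \<le> (\<Sum>i<n. b i - a i)" using ab by (intro sum_nonneg) auto
    have "(\<Sum>i<n. dist (f (a i)) (f (b i))) \<le> (\<Sum>i<n. C * (b i - a i))"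
    proof (rule sum_mono)
      fix i assume "i \<in> {..<n}"
      then have "a i \<le> b i" "{a i..b i} \<subseteq> I" using ab by auto
      then have "a i \<le> b i" "a i \<in> I" "b i \<in> I" by auto
      then show "dist (f (a i)) (f (b i)) \<le> C * (b i - a i)"
        using lipschitz_onD[OF assms, of "a i" "b i"] by (simp add: dist_real_def)
    qed
    also have "\<dots> = C * (\<Sum>i<n. b i - a i)" by (simp add: sum_distrib_left)
    also have "\<dots> \<le> (C + 1) * (\<Sum>i<n. b i - a i)" using pos by (intro mult_right_mono) auto
    also have "\<dots> < e" using s C by (simp add: field_simps)
    finally show "(\<Sum>i<n. dist (f (a i)) (f (b i))) < e" .
  qed
qed

section \<open>Semigroup property and differentiability of the projected flow\<close>

locale sticky_flow =
  fixes x0 v0 :: l2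
  assumes x0: "x0 \<in> cone_K" and v0: "v0 \<in> sub_H x0"
begin

definition "X t = PK (x0 + t *\<^sub>R v0)"
definition "V t = PH (X t) v0"

lemma X_mem: "X t \<in> cone_K"
  by (simp add: X_def PK_mem)

lemma V_mem: "V t \<in> sub_H (X t)"
  by (simp add: V_def PH_mem)

lemma X_0: "X 0 = x0"
  by (simp add: X_def PK_self x0)

lemma V_0: "V 0 = v0"
  by (simp add: V_def X_0 PH_self v0)

lemma X_subdiff: "x0 + t *\<^sub>R v0 - X t \<in> subdiff_indicator cone_K (X t)"
  unfolding X_def by (rule PK_subdiff)

text \<open>The residual of the projection is normal at \<open>X t\<close>, so
  \<open>PH (X t)\<close> annihilates it. The identity writes a multiple of the velocity through
  positions, which makes the facts about the cone applicable to velocities.\<close>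

lemma scaled_V: "t *\<^sub>R V t = X t - PH (X t) x0"
proof -
  have "PH (X t) (x0 + t *\<^sub>R v0 - X t) = 0"
    by (rule PH_subdiff_eq_0[OF X_subdiff])
  then show ?thesis
    by (simp add: V_def PH_add PH_diff PH_scaleR PH_self self_in_sub_H algebra_simps)
qed

text \<open>For \<open>t > 0\<close> the vector is, up to the factor \<open>t\<close>, the residual
  of the projection plus \<open>PH (X t) x0 - x0\<close>; both summands are in the polar cone. At
  \<open>t = 0\<close> it vanishes.\<close>

lemma v0_minus_V_subdiff:
  assumes "t \<ge> 0"
  shows "v0 - V t \<in> subdiff_indicator cone_K (X t)"
  unfolding subdiff_cone_K_iff
proof (intro conjI ballI X_mem)
  show "inner (v0 - V t) (X t) = 0"
    unfolding V_def by (rule PH_orth[OF self_in_sub_H])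
  fix z assume z: "z \<in> cone_K"
  show "inner (v0 - V t) z \<le> 0"
  proof (cases "t = 0")
    case False
    have "t *\<^sub>R (v0 - V t) = (x0 + t *\<^sub>R v0 - X t) + (PH (X t) x0 - x0)"
      using scaled_V[of t] by (simp add: algebra_simps)
    then have "t * inner (v0 - V t) z = inner (x0 + t *\<^sub>R v0 - X t) z + inner (PH (X t) x0 - x0) z"
      by (metis inner_add_left inner_scaleR_left)
    also have "\<dots> \<le> 0"
      using X_subdiff[of t] z PH_polar[OF X_mem x0 z, of t]
      unfolding subdiff_cone_K_iff by (intro add_nonpos_nonpos) blast+
    finally show ?thesis using False assms by (simp add: mult_le_0_iff)
  qed (simp add: V_0)
qed

lemma rescaled_subdiff: "X t - x0 - t *\<^sub>R V t \<in> subdiff_indicator cone_K (X t)"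
proof -
  have "X t - x0 - t *\<^sub>R V t = PH (X t) x0 - x0"
    using scaled_V[of t] by simp
  moreover have "inner (PH (X t) x0 - x0) (X t) = 0"
    using PH_orth[OF self_in_sub_H, of x0 "X t"] by (simp add: inner_diff_left)
  ultimately show ?thesis
    using PH_polar[OF X_mem x0] X_mem unfolding subdiff_cone_K_iff by metis
qed

lemma
  assumes st: "0 \<le> s" "s \<le> t"
  shows X_in_sub_H: "X t \<in> sub_H (X s)"
    and X_semigroup: "X t = PK (X s + (t - s) *\<^sub>R V s)"
proof -
  define y where "y = PK (X s + (t - s) *\<^sub>R V s)"
  have y: "y \<in> cone_K" unfolding y_def by (rule PK_mem)
  have yH: "y \<in> sub_H (X s)"
    unfolding y_def
    by (intro PK_in_sub_H X_mem subspace_add[OF subspace_sub_H] subspace_scale[OF subspace_sub_H] self_in_sub_H V_mem)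
  define \<eta> where "\<eta> = X s + (t - s) *\<^sub>R V s - y"
  have \<eta>: "\<eta> \<in> subdiff_indicator cone_K y"
    unfolding \<eta>_def y_def by (rule PK_subdiff)
  \<comment> \<open>The residual of \<open>y\<close> for the original datum at time \<open>t\<close>
    splits into the residual after restarting, the residual at time \<open>s\<close>, and the
    velocity residual at time \<open>s\<close>. The last two are normal at \<open>X s\<close>; they
    are orthogonal to \<open>y\<close> as well because \<open>y\<close> is in
    \<open>sub_H (X s)\<close>.\<close>
  have dec: "x0 + t *\<^sub>R v0 - y = \<eta> + (x0 + s *\<^sub>R v0 - X s) + (t - s) *\<^sub>R (v0 - V s)"
    by (simp add: \<eta>_def algebra_simps)
  have "x0 + t *\<^sub>R v0 - y \<in> subdiff_indicator cone_K y"
    unfolding subdiff_cone_K_iff dec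
  proof (intro conjI ballI y)
    show "inner (\<eta> + (x0 + s *\<^sub>R v0 - X s) + (t - s) *\<^sub>R (v0 - V s)) y = 0"
      using \<eta> subdiff_orthogonal_sub_H[OF X_subdiff yH] subdiff_orthogonal_sub_H[OF v0_minus_V_subdiff[OF st(1)] yH]
      by (simp add: inner_add_left subdiff_cone_K_iff)
    fix z assume z: "z \<in> cone_K"
    have "inner \<eta> z \<le> 0" "inner (x0 + s *\<^sub>R v0 - X s) z \<le> 0" "inner (v0 - V s) z \<le> 0"
      using \<eta> X_subdiff[of s] v0_minus_V_subdiff[OF st(1)] z by (auto simp: subdiff_cone_K_iff)
    moreover from this(3) have "(t - s) * inner (v0 - V s) z \<le> 0"
      using st by (simp add: mult_nonneg_nonpos)
    ultimately show "inner (\<eta> + (x0 + s *\<^sub>R v0 - X s) + (t - s) *\<^sub>R (v0 - V s)) z \<le> 0"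
      by (simp only: inner_add_left inner_scaleR_left)
  qed
  then have "X t = y" by (simp add: X_def PK_eq_iff)
  then show "X t \<in> sub_H (X s)" "X t = PK (X s + (t - s) *\<^sub>R V s)"
    using yH by (auto simp: y_def)
qed

lemma sub_H_antimono: "0 \<le> s \<Longrightarrow> s \<le> t \<Longrightarrow> sub_H (X t) \<subseteq> sub_H (X s)"
  by (intro sub_H_mono X_in_sub_H)

lemma V_semigroup: "0 \<le> s \<Longrightarrow> s \<le> t \<Longrightarrow> PH (X t) (V s) = V t"
  unfolding V_def by (intro PH_PH X_in_sub_H)

lemma X_lipschitz: "norm (X t - X s) \<le> norm v0 * \<bar>t - s\<bar>"
proof -
  have "norm (X t - X s) \<le> norm ((x0 + t *\<^sub>R v0) - (x0 + s *\<^sub>R v0))"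
    unfolding X_def by (rule PK_nonexpansive)
  also have "(x0 + t *\<^sub>R v0) - (x0 + s *\<^sub>R v0) = (t - s) *\<^sub>R v0" by (simp add: algebra_simps)
  finally show ?thesis by (simp add: mult.commute)
qed

lemma lipschitz_on_X: "(norm v0)-lipschitz_on A X"
  using X_lipschitz by (auto intro!: lipschitz_onI simp: dist_norm)

text \<open>The component of the increment in \<open>sub_H (X t)\<close> is exactly
  \<open>(t - s) *\<^sub>R V t\<close>, while the whole increment has norm at most
  \<open>(t - s) * norm (V s)\<close>; Pythagoras bounds the rest. It controls difference quotients
  from the left wherever the norm of \<open>V\<close> is continuous.\<close>

lemma increment_estimate:
  assumes st: "0 \<le> s" "s \<le> t"
  shows "(norm (X t - X s - (t - s) *\<^sub>R V t))\<^sup>2 \<le> (t - s)\<^sup>2 * ((norm (V s))\<^sup>2 - (norm (V t))\<^sup>2)"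
proof -
  have "X s + (t - s) *\<^sub>R V s - X t \<in> subdiff_indicator cone_K (X t)"
    using X_semigroup[OF st] PK_subdiff by metis
  then have "PH (X t) (X s + (t - s) *\<^sub>R V s - X t) = 0" by (rule PH_subdiff_eq_0)
  then have P: "PH (X t) (X t - X s) = (t - s) *\<^sub>R V t"
    by (simp add: V_semigroup[OF st] PH_add PH_diff PH_scaleR PH_self self_in_sub_H algebra_simps)
  have "norm (X t - X s) \<le> norm ((X s + (t - s) *\<^sub>R V s) - X s)"
    using PK_nonexpansive[of "X s + (t - s) *\<^sub>R V s" "X s"] X_semigroup[OF st] PK_self[OF X_mem, of s] by simp
  then have "norm (X t - X s) \<le> (t - s) * norm (V s)" using st by simp
  then have "(norm (X t - X s))\<^sup>2 \<le> ((t - s) * norm (V s))\<^sup>2" by (rule power_mono) simp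
  moreover have "(norm (X t - X s))\<^sup>2 = ((t - s) * norm (V t))\<^sup>2 + (norm (X t - X s - (t - s) *\<^sub>R V t))\<^sup>2"
    using PH_Pythagoras[of "X t - X s" "X t"] st unfolding P by simp
  ultimately show ?thesis by (simp add: power_mult_distrib right_diff_distrib)
qed

lemma norm_V_antimono: "0 \<le> s \<Longrightarrow> s \<le> t \<Longrightarrow> norm (V t) \<le> norm (V s)"
  using PH_norm_le[of "X t" "V s"] V_semigroup by simp

text \<open>The velocity is approximated by a feasible direction \<open>v\<close>. Points
  \<open>X t + h *\<^sub>R v\<close> lie in the cone and are fixed by the projection, so
  nonexpansiveness compares them with \<open>X (t + h)\<close>.\<close>

lemma right_derivative_estimate:
  assumes t: "t \<ge> 0" and e: "e > 0"
  shows "\<exists>d>0. \<forall>s. t \<le> s \<and> s < t + d \<longrightarrow> norm (X s - X t - (s - t) *\<^sub>R V t) \<le> e * (s - t)"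
proof -
  have "V t \<in> closure (tangent_span (X t))"
    using sub_H_subset_closure_tangent_span[OF X_mem] V_mem by blast
  \<comment> \<open>Half of \<open>e\<close>, since the error of \<open>v\<close> enters twice: in
    the nonexpansiveness estimate and in replacing \<open>v\<close> by \<open>V t\<close>.\<close>
  then obtain v where v: "v \<in> tangent_span (X t)" "dist v (V t) < e / 2"
    unfolding closure_approachable using e by (meson half_gt_zero)
  then obtain d where d: "d > 0" "X t + d *\<^sub>R v \<in> cone_K" by (auto simp: tangent_span_def)
  have "norm (X s - X t - (s - t) *\<^sub>R V t) \<le> e * (s - t)" if s: "t \<le> s" "s < t + d" for s
  proof (cases "s = t")
    case False
    define h where "h = s - t"
    have h: "0 < h" "h \<le> d" using s False by (auto simp: h_def)
    have K: "X t + h *\<^sub>R v \<in> cone_K" by (rule tangent_span_shrink[OF X_mem h d(2)])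
    have "norm (X s - (X t + h *\<^sub>R v)) \<le> norm ((X t + h *\<^sub>R V t) - (X t + h *\<^sub>R v))"
      using PK_nonexpansive[of "X t + h *\<^sub>R V t" "X t + h *\<^sub>R v"] X_semigroup[OF t s(1)] PK_self[OF K]
      by (simp add: h_def)
    also have "(X t + h *\<^sub>R V t) - (X t + h *\<^sub>R v) = h *\<^sub>R (V t - v)" by (simp add: algebra_simps)
    finally have 1: "norm (X s - (X t + h *\<^sub>R v)) \<le> h * norm (V t - v)" using h by simp
    have "X s - X t - h *\<^sub>R V t = (X s - (X t + h *\<^sub>R v)) + h *\<^sub>R (v - V t)" by (simp add: algebra_simps)
    then have "norm (X s - X t - h *\<^sub>R V t) \<le> norm (X s - (X t + h *\<^sub>R v)) + norm (h *\<^sub>R (v - V t))"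
      by (simp only: norm_triangle_ineq)
    also have "\<dots> \<le> h * norm (V t - v) + h * norm (v - V t)"
      using 1 h by (intro add_mono) simp_all
    also have "\<dots> = h * (2 * norm (v - V t))" by (simp add: norm_minus_commute)
    also have "\<dots> \<le> h * e" using v(2) h by (intro mult_left_mono) (auto simp: dist_norm)
    finally show ?thesis by (simp add: h_def mult.commute)
  qed simp
  then show ?thesis using d(1) by blast
qed

lemma X_right_derivative:
  assumes t: "t \<ge> 0"
  shows "(X has_vector_derivative V t) (at t within {t..})"
proof (rule has_vector_derivative_withinI)
  fix e :: real assume "e > 0"
  then obtain d where "d > 0" "\<forall>s. t \<le> s \<and> s < t + d \<longrightarrow> norm (X s - X t - (s - t) *\<^sub>R V t) \<le> e * (s - t)"
    using right_derivative_estimate[OF t] by blast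
  then show "\<exists>d>0. \<forall>s\<in>{t..}. \<bar>s - t\<bar> < d \<longrightarrow> norm (X s - X t - (s - t) *\<^sub>R V t) \<le> e * \<bar>s - t\<bar>"
    by (intro exI[of _ d]) auto
qed

text \<open>To the right of \<open>t\<close> the one-sided estimate suffices; to the left,
  continuity makes the drop of the squared norm in \<open>increment_estimate\<close> smaller than
  \<open>e\<close> squared.\<close>

lemma X_derivative_of_continuity:
  assumes t: "t > 0" and cont: "continuous (at t within {0<..}) (\<lambda>s. - (norm (V s))\<^sup>2)"
  shows "(X has_vector_derivative V t) (at t)"
proof (rule has_vector_derivative_withinI)
  fix e :: real assume e: "e > 0"
  obtain d1 where d1: "d1 > 0" "\<forall>s. t \<le> s \<and> s < t + d1 \<longrightarrow> norm (X s - X t - (s - t) *\<^sub>R V t) \<le> e * (s - t)"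
    using right_derivative_estimate[OF _ e] t by (meson less_imp_le)
  obtain d2 where d2: "d2 > 0" "\<forall>s\<in>{0<..}. dist s t < d2 \<longrightarrow> dist (- (norm (V s))\<^sup>2) (- (norm (V t))\<^sup>2) < e\<^sup>2"
    using cont e unfolding continuous_within_eps_delta by (meson zero_less_power)
  show "\<exists>d>0. \<forall>s\<in>UNIV. \<bar>s - t\<bar> < d \<longrightarrow> norm (X s - X t - (s - t) *\<^sub>R V t) \<le> e * \<bar>s - t\<bar>"
  proof (intro exI[of _ "min t (min d1 d2)"] conjI ballI impI)
    fix s assume s: "\<bar>s - t\<bar> < min t (min d1 d2)"
    show "norm (X s - X t - (s - t) *\<^sub>R V t) \<le> e * \<bar>s - t\<bar>"
    proof (cases "t \<le> s")
      case True
      then show ?thesis using d1 s by auto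
    next
      case False
      then have s': "0 \<le> s" "s \<le> t" "0 < s" using s by auto
      have "(norm (V s))\<^sup>2 - (norm (V t))\<^sup>2 \<le> e\<^sup>2"
        using d2(2) s s' by (force simp: dist_real_def)
      then have "(t - s)\<^sup>2 * ((norm (V s))\<^sup>2 - (norm (V t))\<^sup>2) \<le> (t - s)\<^sup>2 * e\<^sup>2"
        by (rule mult_left_mono) simp
      with increment_estimate[OF s'(1,2)]
      have "(norm (X t - X s - (t - s) *\<^sub>R V t))\<^sup>2 \<le> (e * (t - s))\<^sup>2"
        by (simp add: power_mult_distrib mult.commute)
      then have "norm (X t - X s - (t - s) *\<^sub>R V t) \<le> e * (t - s)"
        by (rule power2_le_imp_le) (use e s' in simp)
      moreover have "X s - X t - (s - t) *\<^sub>R V t = - (X t - X s - (t - s) *\<^sub>R V t)"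
        by (simp add: algebra_simps)
      ultimately show ?thesis using s' by (simp only: norm_minus_cancel) auto
    qed
  qed (use t d1 d2 in auto)
qed

lemma AE_X_derivative: "AE t in lborel. t > 0 \<longrightarrow> (X has_vector_derivative V t) (at t)"
proof -
  \<comment> \<open>The minus sign makes the function nondecreasing, so that its discontinuities are
    countable.\<close>
  define N where "N s = - (norm (V s))\<^sup>2" for s
  have "mono_on {0<..} N"
    unfolding N_def by (intro mono_onI) (auto intro!: power_mono norm_V_antimono)
  then have c: "countable {t\<in>{0<..}. \<not> continuous (at t within {0<..}) N}"
    by (rule mono_on_ctble_discont)
  have "AE t in lborel. t \<notin> {t\<in>{0<..}. \<not> continuous (at t within {0<..}) N}"
    by (rule AE_not_in[OF countable_imp_null_set_lborel[OF c]])
  then show ?thesis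
    by eventually_elim (auto simp: N_def[abs_def] intro: X_derivative_of_continuity)
qed

lemma strong_solution_X:
  assumes "\<And>t. t > 0 \<Longrightarrow> R t (X t) (V t)"
  shows "strong_solution R X"
  unfolding strong_solution_def
proof (intro conjI allI impI)
  show "abs_continuous_on {0..T} X" for T
    by (rule abs_continuous_on_lipschitz[OF lipschitz_on_X])
  show "AE t in lborel. t > 0 \<longrightarrow> (\<exists>D. (X has_vector_derivative D) (at t) \<and> R t (X t) D)"
    using AE_X_derivative by eventually_elim (use assms in blast)
qed

lemma subdiff_flow_solution_X: "subdiff_flow_solution x0 v0 X"
  unfolding subdiff_flow_solution_def
proof (intro conjI strong_solution_X X_0)
  fix t :: real assume "t > 0"
  then show "V t \<in> {- \<xi> + v0 | \<xi>. \<xi> \<in> subdiff_indicator cone_K (X t)}"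
    using v0_minus_V_subdiff[of t] by (auto intro!: exI[of _ "v0 - V t"])
qed

lemma rescaled_flow_solution_X: "rescaled_flow_solution x0 v0 X"
  unfolding rescaled_flow_solution_def
proof (intro conjI strong_solution_X)
  fix t :: real assume "t > 0"
  show "t *\<^sub>R V t \<in> {- \<xi> + X t - x0 | \<xi>. \<xi> \<in> subdiff_indicator cone_K (X t)}"
    using rescaled_subdiff[of t] by (auto intro!: exI[of _ "X t - x0 - t *\<^sub>R V t"])
next
  show "((\<lambda>t. inverse t *\<^sub>R (X t - x0)) \<longlongrightarrow> v0) (at_right 0)"
  proof (rule tendstoI)
    fix e :: real assume e: "e > 0"
    then obtain d where d: "d > 0" "\<forall>s. 0 \<le> s \<and> s < 0 + d \<longrightarrow> norm (X s - X 0 - (s - 0) *\<^sub>R V 0) \<le> (e/2) * (s - 0)"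
      using right_derivative_estimate[of 0 "e/2"] by auto
    have "dist (inverse t *\<^sub>R (X t - x0)) v0 < e" if t: "0 < t" "t < d" for t
    proof -
      have "inverse t *\<^sub>R (X t - x0) - v0 = inverse t *\<^sub>R (X t - x0 - t *\<^sub>R v0)"
        using t by (simp add: algebra_simps)
      then have "dist (inverse t *\<^sub>R (X t - x0)) v0 = inverse t * norm (X t - x0 - t *\<^sub>R v0)"
        using t by (simp add: dist_norm)
      also have "\<dots> \<le> inverse t * (e / 2 * t)"
        using d(2) t by (intro mult_left_mono) (auto simp: X_0 V_0)
      also have "\<dots> < e" using t e by simp
      finally show ?thesis .
    qed
    then show "\<forall>\<^sub>F t in at_right 0. dist (inverse t *\<^sub>R (X t - x0)) v0 < e"
      unfolding eventually_at_right_field using d(1) by blast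
  qed
qed

end

section \<open>Absolutely continuous curves and uniqueness\<close>

definition small_family :: "real set \<Rightarrow> real \<Rightarrow> nat \<Rightarrow> (nat \<Rightarrow> real) \<Rightarrow> (nat \<Rightarrow> real) \<Rightarrow> bool" where
  "small_family I d n a b \<longleftrightarrow> (\<forall>i<n. a i \<le> b i \<and> {a i..b i} \<subseteq> I) \<and>
    (\<forall>i<n. \<forall>j<n. i \<noteq> j \<longrightarrow> {a i<..<b i} \<inter> {a j<..<b j} = {}) \<and> (\<Sum>i<n. b i - a i) < d"

lemma abs_continuous_on_alt:
  "abs_continuous_on I f \<longleftrightarrow>
    (\<forall>e>0. \<exists>d>0. \<forall>n a b. small_family I d n a b \<longrightarrow> (\<Sum>i<n. dist (f (a i)) (f (b i))) < e)"
  unfolding abs_continuous_on_def small_family_def by (simp only: imp_conjL)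

lemma abs_continuous_onD:
  assumes "abs_continuous_on I f" "e > 0"
  obtains d where "d > 0" "\<And>n a b. small_family I d n a b \<Longrightarrow> (\<Sum>i<n. dist (f (a i)) (f (b i))) < e"
  using assms unfolding abs_continuous_on_alt by blast

lemma small_family_mem: "small_family I d n a b \<Longrightarrow> i < n \<Longrightarrow> a i \<in> I \<and> b i \<in> I"
  unfolding small_family_def by (meson atLeastAtMost_iff order_refl subsetD)

lemma small_family_mono: "small_family I d n a b \<Longrightarrow> I \<subseteq> J \<Longrightarrow> d \<le> e \<Longrightarrow> small_family J e n a b"
  unfolding small_family_def by auto

lemma abs_continuous_on_subset:
  assumes "abs_continuous_on I f" "J \<subseteq> I"
  shows "abs_continuous_on J f"
  unfolding abs_continuous_on_alt
proof (intro allI impI)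
  fix e :: real assume "e > 0"
  then obtain d where "d > 0" "\<And>n a b. small_family I d n a b \<Longrightarrow> (\<Sum>i<n. dist (f (a i)) (f (b i))) < e"
    using abs_continuous_onD[OF assms(1)] by blast
  then show "\<exists>d>0. \<forall>n a b. small_family J d n a b \<longrightarrow> (\<Sum>i<n. dist (f (a i)) (f (b i))) < e"
    using small_family_mono[OF _ assms(2) order_refl] by blast
qed

text \<open>Sums over a family of intervals inherit any pointwise bound on increments. Products,
  squared distances and modifications off the interval all reduce to this comparison.\<close>

lemma abs_continuous_on_bound:
  assumes Y: "abs_continuous_on I Y" and Z: "abs_continuous_on I Z" and L: "L > 0"
    and le: "\<And>u v. u \<in> I \<Longrightarrow> v \<in> I \<Longrightarrow> dist (f u) (f v) \<le> L * (dist (Y u) (Y v) + dist (Z u) (Z v))"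
  shows "abs_continuous_on I f"
  unfolding abs_continuous_on_alt
proof (intro allI impI)
  fix e :: real assume e: "e > 0"
  then have e2: "e / (2 * L) > 0" using L by simp
  obtain d1 where d1: "d1 > 0" "\<And>n a b. small_family I d1 n a b \<Longrightarrow> (\<Sum>i<n. dist (Y (a i)) (Y (b i))) < e / (2 * L)"
    using abs_continuous_onD[OF Y e2] by blast
  obtain d2 where d2: "d2 > 0" "\<And>n a b. small_family I d2 n a b \<Longrightarrow> (\<Sum>i<n. dist (Z (a i)) (Z (b i))) < e / (2 * L)"
    using abs_continuous_onD[OF Z e2] by blast
  have "(\<Sum>i<n. dist (f (a i)) (f (b i))) < e" if sf: "small_family I (min d1 d2) n a b" for n a b
  proof -
    have "(\<Sum>i<n. dist (f (a i)) (f (b i))) \<le> (\<Sum>i<n. L * (dist (Y (a i)) (Y (b i)) + dist (Z (a i)) (Z (b i))))"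
      using small_family_mem[OF sf] by (intro sum_mono le) auto
    also have "\<dots> = L * ((\<Sum>i<n. dist (Y (a i)) (Y (b i))) + (\<Sum>i<n. dist (Z (a i)) (Z (b i))))"
      by (simp add: sum_distrib_left sum.distrib distrib_left)
    also have "\<dots> < L * (e / (2 * L) + e / (2 * L))"
      using d1(2)[OF small_family_mono[OF sf]] d2(2)[OF small_family_mono[OF sf]] L
      by (intro mult_strict_left_mono add_strict_mono) auto
    also have "\<dots> = e" using L by simp
    finally show ?thesis .
  qed
  moreover have "min d1 d2 > 0" using d1 d2 by simp
  ultimately show "\<exists>d>0. \<forall>n a b. small_family I d n a b \<longrightarrow> (\<Sum>i<n. dist (f (a i)) (f (b i))) < e" by blast
qed

lemma abs_continuous_on_cong:
  assumes "abs_continuous_on I f" "\<And>t. t \<in> I \<Longrightarrow> f t = g t"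
  shows "abs_continuous_on I g"
  by (rule abs_continuous_on_bound[OF assms(1) assms(1), of 1]) (auto simp: assms(2)[symmetric])

lemma abs_continuous_on_imp_continuous_on:
  assumes "abs_continuous_on {a..b} f"
  shows "continuous_on {a..b} f"
  unfolding continuous_on_iff
proof (intro ballI allI impI)
  fix x e :: real assume x: "x \<in> {a..b}" and "e > 0"
  then obtain d where d: "d > 0" "\<And>n u v. small_family {a..b} d n u v \<Longrightarrow> (\<Sum>i<n. dist (f (u i)) (f (v i))) < e"
    using abs_continuous_onD[OF assms] by blast
  have "dist (f y) (f x) < e" if y: "y \<in> {a..b}" "dist y x < d" for y
  proof -
    have "small_family {a..b} d (Suc 0) (\<lambda>_. min x y) (\<lambda>_. max x y)"
      using x y by (auto simp: dist_real_def small_family_def)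
    then have "dist (f (min x y)) (f (max x y)) < e" using d(2) by fastforce
    then show ?thesis by (cases "x \<le> y") (auto simp: min_def max_def dist_commute)
  qed
  then show "\<exists>d>0. \<forall>x'\<in>{a..b}. dist x' x < d \<longrightarrow> dist (f x') (f x) < e" using d(1) by blast
qed

lemma null_set_open_cover:
  assumes "N \<in> null_sets lborel" "d > 0"
  obtains T where "open T" "N \<subseteq> T" "emeasure lborel T < ennreal d"
proof -
  have N: "N \<in> sets borel" "emeasure lborel N = 0" using assms by (auto simp: null_sets_def)
  have "N \<in> sets lebesgue" using N by (simp add: sets_completionI_sets)
  then obtain T where T: "open T" "N \<subseteq> T" "emeasure lebesgue (T - N) < ennreal d"
    using sets_lebesgue_outer_open[OF _ assms(2)] by blast
  have "emeasure lborel (T - N) < ennreal d" using T N by simp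
  moreover have "emeasure lborel T = emeasure lborel (T - N)"
    using T(1) by (intro emeasure_Diff_null_set[OF assms(1), symmetric]) simp
  ultimately show ?thesis using that T by metis
qed

(* Cousin's lemma: tags in the exceptional null set are charged to absolute continuity. *)
lemma abs_continuous_on_nonincreasing:
  fixes f :: "real \<Rightarrow> real"
  assumes ab: "a \<le> b" and ac: "abs_continuous_on {a..b} f"
    and der: "AE t in lborel. t \<in> {a<..<b} \<longrightarrow> (\<exists>D\<le>0. (f has_real_derivative D) (at t))"
  shows "f b \<le> f a"
proof -
  obtain N where N: "N \<in> null_sets lborel"
    and Nd: "{t. \<not> (t \<in> {a<..<b} \<longrightarrow> (\<exists>D\<le>0. (f has_real_derivative D) (at t)))} \<subseteq> N"
    using der unfolding eventually_ae_filter by auto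
  \<comment> \<open>The endpoints join the exceptional set because the derivative is given in the
    open interval only.\<close>
  define E where "E = N \<union> {a, b}"
  have E: "E \<in> null_sets lborel" unfolding E_def
    by (rule null_sets.Un[OF N finite_imp_null_set_lborel]) simp
  have main: "f b - f a \<le> e * (b - a) + e" if e: "e > 0" for e
  proof -
    obtain d where d: "d > 0" "\<And>n u v. small_family {a..b} d n u v \<Longrightarrow> (\<Sum>i<n. dist (f (u i)) (f (v i))) < e"
      using abs_continuous_onD[OF ac e] by blast
    obtain T where T: "open T" "E \<subseteq> T" "emeasure lborel T < ennreal d"
      using null_set_open_cover[OF E d(1)] by blast
    \<comment> \<open>Straddle estimate: an interval around its tag \<open>t\<close> is cut at
      \<open>t\<close>, and both pieces are compared with the nonpositive derivative there.\<close>
    have "\<exists>r>0. t \<in> {a..b} - E \<longrightarrow> (\<forall>u v. u \<le> t \<and> t \<le> v \<and> u \<in> ball t r \<and> v \<in> ball t r \<longrightarrow> f v - f u \<le> e * (v - u))" for t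
    proof (cases "t \<in> {a..b} - E")
      case True
      then have "t \<in> {a<..<b}" "t \<notin> N" by (auto simp: E_def)
      then obtain D where D: "D \<le> 0" "(f has_real_derivative D) (at t)" using Nd by blast
      then obtain r where r: "r > 0" "\<And>y. norm (y - t) < r \<Longrightarrow> norm (f y - f t - D * (y - t)) \<le> e * norm (y - t)"
        using e unfolding has_field_derivative_def has_derivative_within_alt by auto
      have "f v - f u \<le> e * (v - u)" if uv: "u \<le> t" "t \<le> v" "u \<in> ball t r" "v \<in> ball t r" for u v
      proof -
        have "f v - f t - D * (v - t) \<le> e * (v - t)" "-(f u - f t - D * (u - t)) \<le> e * (t - u)"
          using r(2)[of v] r(2)[of u] uv by (auto simp: dist_real_def)
        then have "f v - f u \<le> D * (v - u) + e * (v - u)" by (simp add: algebra_simps)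
        moreover have "D * (v - u) \<le> 0" using D uv by (intro mult_nonpos_nonneg) auto
        ultimately show ?thesis by simp
      qed
      then show ?thesis using r(1) by blast
    qed (auto intro: exI[of _ 1])
    then obtain r where r: "\<And>t. r t > 0" "\<And>t u v. t \<in> {a..b} - E \<Longrightarrow> u \<le> t \<Longrightarrow> t \<le> v \<Longrightarrow> u \<in> ball t (r t)
        \<Longrightarrow> v \<in> ball t (r t) \<Longrightarrow> f v - f u \<le> e * (v - u)"
      by metis
    define g where "g t = (if t \<in> E then T else ball t (r t))" for t
    have "gauge g" using T r(1) by (auto simp: gauge_def g_def)
    then obtain p where p: "p tagged_division_of {a..b}" "g fine p"
      using fine_division_exists_real by blast
    have pK: "\<exists>u v. K = {u..v} \<and> u \<le> x \<and> x \<le> v \<and> {u..v} \<subseteq> {a..b} \<and> {u..v} \<subseteq> g x" if "(x, K) \<in> p" for x K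
      using tagged_division_ofD(2,3,4)[OF p(1) that] p(2) that by (fastforce simp: fine_def)
    have fin: "finite p" using p(1) by auto
    define p1 where "p1 = {q\<in>p. fst q \<in> E}"
    define p2 where "p2 = p - p1"
    define s where "s = (\<lambda>(x::real, K::real set). f (Sup K) - f (Inf K))"
    define l where "l = (\<lambda>(x::real, K::real set). Sup K - Inf K)"
    have l0: "0 \<le> l q" if "q \<in> p" for q using pK[of "fst q" "snd q"] that by (cases q) (auto simp: l_def)
    have sl: "s q \<le> e * l q" if q: "q \<in> p2" for q
    proof -
      obtain x K where xK: "q = (x, K)" by (cases q)
      then have "(x, K) \<in> p" "x \<notin> E" using q by (auto simp: p2_def p1_def)
      then obtain u v where uv: "K = {u..v}" "u \<le> x" "x \<le> v" "{u..v} \<subseteq> {a..b}" "{u..v} \<subseteq> ball x (r x)"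
        using pK[of x K] by (auto simp: g_def)
      have "x \<in> {a..b} - E" using uv \<open>x \<notin> E\<close> by (auto dest: subsetD[of _ _ x])
      moreover have "u \<in> ball x (r x)" "v \<in> ball x (r x)" using uv by (auto simp del: mem_ball)
      ultimately have "f v - f u \<le> e * (v - u)" using uv by (intro r(2)) auto
      then show ?thesis using xK uv by (simp add: s_def l_def)
    qed
    have "sum s p2 \<le> (\<Sum>q\<in>p2. e * l q)" by (intro sum_mono sl)
    also have "\<dots> = e * sum l p2" by (simp add: sum_distrib_left)
    also have "\<dots> \<le> e * sum l p"
      using e l0 fin by (intro mult_left_mono sum_mono2) (auto simp: p2_def)
    also have "sum l p = b - a"
      using additive_tagged_division_1[OF ab p(1), of "\<lambda>x. x"] by (simp add: l_def)
    finally have s2: "sum s p2 \<le> e * (b - a)" .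
    have "finite p1" using fin by (simp add: p1_def)
    then obtain h where h: "bij_betw h {..<card p1} p1"
      using ex_bij_betw_nat_finite[of p1] by (auto simp: atLeast0LessThan)
    define u where "u i = Inf (snd (h i))" for i
    define v where "v i = Sup (snd (h i))" for i
    have hp: "h i \<in> p1" if "i < card p1" for i using h that by (auto simp: bij_betw_def)
    have huv: "snd (h i) = {u i..v i} \<and> u i \<le> v i \<and> {u i..v i} \<subseteq> {a..b} \<and> {u i..v i} \<subseteq> T" if i: "i < card p1" for i
    proof -
      have "(fst (h i), snd (h i)) \<in> p" "fst (h i) \<in> E" using hp[OF i] by (auto simp: p1_def)
      then show ?thesis using pK[of "fst (h i)" "snd (h i)"] by (auto simp: g_def u_def v_def)
    qed
    have disj: "{u i<..<v i} \<inter> {u j<..<v j} = {}" if ij: "i < card p1" "j < card p1" "i \<noteq> j" for i j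
    proof -
      have "h i \<noteq> h j" using h ij by (auto simp: bij_betw_def inj_on_def)
      then have "interior (snd (h i)) \<inter> interior (snd (h j)) = {}"
        using tagged_division_ofD(5)[OF p(1), of "fst (h i)" "snd (h i)" "fst (h j)" "snd (h j)"] hp[OF ij(1)] hp[OF ij(2)]
        by (auto simp: p1_def prod_eq_iff)
      then show ?thesis using huv[OF ij(1)] huv[OF ij(2)] by (simp add: interior_atLeastAtMost_real)
    qed
    have "ennreal (\<Sum>i<card p1. v i - u i) = (\<Sum>i<card p1. emeasure lborel {u i<..<v i})"
      using huv by (subst sum_ennreal[symmetric]) auto
    also have "\<dots> = emeasure lborel (\<Union>i<card p1. {u i<..<v i})"
      using disj by (intro sum_emeasure) (auto simp: disjoint_family_on_def)
    also have "\<dots> \<le> emeasure lborel T"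
      using huv T(1) by (intro emeasure_mono) (auto, meson atLeastAtMost_iff less_imp_le subsetD)
    also have "\<dots> < ennreal d" by (rule T(3))
    finally have "(\<Sum>i<card p1. v i - u i) < d"
      using huv d(1) by (subst (asm) ennreal_less_iff) (auto intro!: sum_nonneg)
    then have "small_family {a..b} d (card p1) u v"
      using huv disj unfolding small_family_def by blast
    then have "(\<Sum>i<card p1. dist (f (u i)) (f (v i))) < e" by (rule d(2))
    moreover have "sum s p1 \<le> (\<Sum>i<card p1. dist (f (u i)) (f (v i)))"
    proof -
      have "sum s p1 = (\<Sum>i<card p1. s (h i))" using sum.reindex_bij_betw[OF h] by metis
      also have "\<dots> \<le> (\<Sum>i<card p1. dist (f (u i)) (f (v i)))"
        by (intro sum_mono) (auto simp: s_def u_def v_def dist_real_def split: prod.splits)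
      finally show ?thesis .
    qed
    moreover have "f b - f a = sum s p1 + sum s p2"
    proof -
      have "f b - f a = sum s p" unfolding s_def
        using additive_tagged_division_1[OF ab p(1), of f] by simp
      also have "\<dots> = sum s p1 + sum s p2"
        unfolding p2_def using sum.subset_diff[of p1 p s] fin by (simp add: p1_def)
      finally show ?thesis .
    qed
    ultimately show ?thesis using s2 by simp
  qed
  have "f b - f a \<le> 0 + c" if c: "c > 0" for c
  proof -
    \<comment> \<open>The error \<open>e * (b - a) + e\<close> equals \<open>c\<close> for exactly
      this \<open>e\<close>.\<close>
    have "f b - f a \<le> (c / (b - a + 1)) * (b - a) + c / (b - a + 1)"
      using ab c by (intro main) auto
    also have "\<dots> = (c / (b - a + 1)) * (b - a + 1)" by (simp only: distrib_left mult_1_right)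
    also have "\<dots> = c" using ab by simp
    finally show ?thesis by simp
  qed
  then have "f b - f a \<le> 0" by (rule field_le_epsilon)
  then show ?thesis by simp
qed

lemma abs_continuous_on_dist_square:
  fixes Y Z :: "real \<Rightarrow> 'a::real_inner"
  assumes Y: "abs_continuous_on {a..b} Y" and Z: "abs_continuous_on {a..b} Z"
  shows "abs_continuous_on {a..b} (\<lambda>t. (norm (Y t - Z t))\<^sup>2)"
proof -
  have "continuous_on {a..b} (\<lambda>t. Y t - Z t)"
    by (intro continuous_on_diff abs_continuous_on_imp_continuous_on Y Z)
  then have "bounded ((\<lambda>t. Y t - Z t) ` {a..b})"
    by (intro compact_imp_bounded compact_continuous_image) auto
  then obtain M where M: "M > 0" "\<And>t. t \<in> {a..b} \<Longrightarrow> norm (Y t - Z t) \<le> M"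
    unfolding bounded_pos by auto
  show ?thesis
  proof (rule abs_continuous_on_bound[OF Y Z, of "2 * M"])
    fix u v assume uv: "u \<in> {a..b}" "v \<in> {a..b}"
    define A where "A = Y u - Z u"
    define B where "B = Y v - Z v"
    have AB: "\<bar>norm A - norm B\<bar> \<le> dist (Y u) (Y v) + dist (Z u) (Z v)"
    proof -
      have "\<bar>norm A - norm B\<bar> \<le> norm (A - B)" by (rule norm_triangle_ineq3)
      also have "A - B = (Y u - Y v) - (Z u - Z v)" by (simp add: A_def B_def)
      also have "norm \<dots> \<le> norm (Y u - Y v) + norm (Z u - Z v)" by (rule norm_triangle_ineq4)
      finally show ?thesis by (simp add: dist_norm)
    qed
    have "dist ((norm A)\<^sup>2) ((norm B)\<^sup>2) = \<bar>norm A + norm B\<bar> * \<bar>norm A - norm B\<bar>"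
      by (simp add: dist_real_def power2_eq_square square_diff_square_factored abs_mult)
    also have "\<dots> \<le> (2 * M) * (dist (Y u) (Y v) + dist (Z u) (Z v))"
      using AB M(2)[OF uv(1)] M(2)[OF uv(2)] M(1) by (intro mult_mono) (auto simp: A_def B_def)
    finally show "dist ((norm (Y u - Z u))\<^sup>2) ((norm (Y v - Z v))\<^sup>2) \<le> 2 * M * (dist (Y u) (Y v) + dist (Z u) (Z v))"
      by (simp add: A_def B_def)
  qed (use M in simp)
qed

lemma abs_continuous_on_times:
  fixes f g :: "real \<Rightarrow> real"
  assumes f: "abs_continuous_on {a..b} f" and g: "abs_continuous_on {a..b} g"
  shows "abs_continuous_on {a..b} (\<lambda>t. f t * g t)"
proof -
  have "bounded (h ` {a..b})" if "abs_continuous_on {a..b} h" for h :: "real \<Rightarrow> real"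
    using abs_continuous_on_imp_continuous_on[OF that]
    by (intro compact_imp_bounded compact_continuous_image) auto
  then obtain M N where M: "M > 0" "\<And>t. t \<in> {a..b} \<Longrightarrow> \<bar>f t\<bar> \<le> M" and N: "N > 0" "\<And>t. t \<in> {a..b} \<Longrightarrow> \<bar>g t\<bar> \<le> N"
    using f g unfolding bounded_pos by (metis imageI real_norm_def)
  show ?thesis
  proof (rule abs_continuous_on_bound[OF f g, of "M + N"])
    fix u v assume uv: "u \<in> {a..b}" "v \<in> {a..b}"
    have "f u * g u - f v * g v = (f u - f v) * g u + f v * (g u - g v)" by (simp add: algebra_simps)
    then have "\<bar>f u * g u - f v * g v\<bar> \<le> \<bar>f u - f v\<bar> * \<bar>g u\<bar> + \<bar>f v\<bar> * \<bar>g u - g v\<bar>"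
      by (metis abs_mult abs_triangle_ineq)
    also have "\<dots> \<le> \<bar>f u - f v\<bar> * (M + N) + (M + N) * \<bar>g u - g v\<bar>"
      using M(1) N(1) M(2)[OF uv(2)] N(2)[OF uv(1)] by (intro add_mono mult_mono) auto
    finally show "dist (f u * g u) (f v * g v) \<le> (M + N) * (dist (f u) (f v) + dist (g u) (g v))"
      by (simp add: dist_real_def algebra_simps)
  qed (use M N in simp)
qed

lemma has_real_derivative_dist_square:
  fixes Y Z :: "real \<Rightarrow> 'a::real_inner"
  assumes "(Y has_vector_derivative D) (at t)" "(Z has_vector_derivative E) (at t)"
  shows "((\<lambda>t. (norm (Y t - Z t))\<^sup>2) has_real_derivative 2 * inner (D - E) (Y t - Z t)) (at t)"
proof -
  have d: "((\<lambda>t. Y t - Z t) has_vector_derivative (D - E)) (at t)"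
    by (intro has_vector_derivative_diff assms)
  have "((\<lambda>t. inner (Y t - Z t) (Y t - Z t)) has_vector_derivative
      (inner (Y t - Z t) (D - E) + inner (D - E) (Y t - Z t))) (at t)"
    by (rule bounded_bilinear.has_vector_derivative[OF bounded_bilinear_inner d d])
  then show ?thesis
    by (simp add: has_real_derivative_iff_has_vector_derivative power2_norm_eq_inner inner_commute)
qed

section \<open>Uniqueness for the two inclusions\<close>

lemma subdiff_monotone:
  assumes "\<xi> \<in> subdiff_indicator C x" "\<eta> \<in> subdiff_indicator C y"
  shows "inner (\<xi> - \<eta>) (x - y) \<ge> 0"
proof -
  have "inner \<xi> (y - x) \<le> 0" "inner \<eta> (x - y) \<le> 0"
    using assms by (auto simp: subdiff_indicator_def split: if_splits)
  then show ?thesis by (simp add: inner_diff_left inner_diff_right)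
qed

text \<open>In the difference of the velocities \<open>v0\<close> cancels, and monotonicity of the
  subdifferential makes the squared distance of the two solutions nonincreasing from the value
  zero.\<close>

lemma subdiff_flow_solution_unique:
  assumes Y: "subdiff_flow_solution x0 v0 Y" and Z: "subdiff_flow_solution x0 v0 Z" and t: "t \<ge> 0"
  shows "Y t = Z t"
proof (cases "t = 0")
  case False
  then have t: "t > 0" using t by simp
  have ac: "abs_continuous_on {0..t} Y" "abs_continuous_on {0..t} Z"
    using Y Z t by (auto simp: subdiff_flow_solution_def strong_solution_def)
  have ae: "AE s in lborel. s > 0 \<longrightarrow> (\<exists>D. (W has_vector_derivative D) (at s) \<and> D \<in> {- \<xi> + v0 | \<xi>. \<xi> \<in> subdiff_indicator cone_K (W s)})"
    if "subdiff_flow_solution x0 v0 W" for W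
    using that unfolding subdiff_flow_solution_def strong_solution_def by blast
  have "(norm (Y t - Z t))\<^sup>2 \<le> (norm (Y 0 - Z 0))\<^sup>2"
  proof (rule abs_continuous_on_nonincreasing[OF _ abs_continuous_on_dist_square[OF ac]])
    show "AE s in lborel. s \<in> {0<..<t} \<longrightarrow> (\<exists>D\<le>0. ((\<lambda>s. (norm (Y s - Z s))\<^sup>2) has_real_derivative D) (at s))"
      using ae[OF Y] ae[OF Z]
    proof eventually_elim
      case (elim s)
      show ?case
      proof
        assume "s \<in> {0<..<t}"
        with elim obtain \<xi> \<eta> where *: "(Y has_vector_derivative (- \<xi> + v0)) (at s)" "(Z has_vector_derivative (- \<eta> + v0)) (at s)"
          "\<xi> \<in> subdiff_indicator cone_K (Y s)" "\<eta> \<in> subdiff_indicator cone_K (Z s)" by auto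
        have "inner ((- \<xi> + v0) - (- \<eta> + v0)) (Y s - Z s) = - inner (\<xi> - \<eta>) (Y s - Z s)"
          by (simp add: inner_diff_left)
        then show "\<exists>D\<le>0. ((\<lambda>s. (norm (Y s - Z s))\<^sup>2) has_real_derivative D) (at s)"
          using has_real_derivative_dist_square[OF *(1,2)] subdiff_monotone[OF *(3,4)]
          by (intro exI[of _ "2 * inner ((- \<xi> + v0) - (- \<eta> + v0)) (Y s - Z s)"]) simp
      qed
    qed
  qed (use t in simp)
  then show ?thesis using Y Z by (simp add: subdiff_flow_solution_def)
qed (use Y Z in \<open>simp add: subdiff_flow_solution_def\<close>)

lemma lipschitz_inverse_square:
  assumes "0 < a"
  shows "(2 / a ^ 3)-lipschitz_on {a..b} (\<lambda>t. 1 / t\<^sup>2 :: real)"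
proof (rule lipschitz_onI)
  fix u v assume uv: "u \<in> {a..b}" "v \<in> {a..b}"
  then have pos: "0 < u" "0 < v" "a \<le> u" "a \<le> v" using assms by auto
  have "1 / u\<^sup>2 - 1 / v\<^sup>2 = (v - u) * ((1/u) * (1/v) * (1/u + 1/v))"
    using pos by (simp add: field_simps power2_eq_square)
  then have "dist (1 / u\<^sup>2) (1 / v\<^sup>2) = \<bar>v - u\<bar> * ((1/u) * (1/v) * (1/u + 1/v))"
    using pos by (simp add: dist_real_def abs_mult)
  also have "\<dots> \<le> \<bar>v - u\<bar> * ((1/a) * (1/a) * (1/a + 1/a))"
    using pos assms by (intro mult_left_mono mult_mono add_mono divide_left_mono) auto
  also have "\<dots> = 2 / a ^ 3 * dist u v"
    using assms by (simp add: dist_real_def abs_minus_commute power3_eq_cube)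
  finally show "dist (1 / u\<^sup>2) (1 / v\<^sup>2) \<le> 2 / a ^ 3 * dist u v" .
qed (use assms in simp)

text \<open>The rescaled problem prescribes no initial value. Since the difference quotient from
  \<open>x0\<close> has a finite limit, the curve itself tends to \<open>x0\<close>, and continuity
  identifies its value at \<open>0\<close>.\<close>

lemma rescaled_flow_solution_initial:
  assumes "rescaled_flow_solution x0 v0 Y"
  shows "Y 0 = x0"
proof -
  have "((\<lambda>t. inverse t *\<^sub>R (Y t - x0)) \<longlongrightarrow> v0) (at_right 0)"
    using assms by (simp add: rescaled_flow_solution_def)
  then have "((\<lambda>t. t *\<^sub>R (inverse t *\<^sub>R (Y t - x0))) \<longlongrightarrow> 0 *\<^sub>R v0) (at_right 0)"
    by (intro tendsto_scaleR tendsto_ident_at)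
  moreover have "\<forall>\<^sub>F t in at_right 0. t *\<^sub>R (inverse t *\<^sub>R (Y t - x0)) = Y t - x0"
    using eventually_at_right_less by (rule eventually_mono) simp
  ultimately have "((\<lambda>t. Y t - x0) \<longlongrightarrow> 0) (at_right 0)"
    by (simp add: tendsto_cong)
  then have 1: "(Y \<longlongrightarrow> x0) (at_right 0)" by (simp add: LIM_zero_iff)
  have "abs_continuous_on {0..1} Y"
    using assms by (simp add: rescaled_flow_solution_def strong_solution_def)
  then have "continuous_on {0..1} Y" by (rule abs_continuous_on_imp_continuous_on)
  then have "(Y \<longlongrightarrow> Y 0) (at 0 within {0..1})" by (auto simp: continuous_on_def)
  then have 2: "(Y \<longlongrightarrow> Y 0) (at_right 0)"
    by (simp add: at_within_Icc_at_right)
  show ?thesis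
    by (rule tendsto_unique[OF _ 2 1]) simp
qed

(* The quantity |Y - Z|^2 / t^2 is nonincreasing and vanishes as t tends to 0. *)
lemma rescaled_flow_solution_unique:
  assumes Y: "rescaled_flow_solution x0 v0 Y" and Z: "rescaled_flow_solution x0 v0 Z" and t: "t \<ge> 0"
  shows "Y t = Z t"
proof (cases "t = 0")
  case False
  then have t: "t > 0" using t by simp
  have ac: "abs_continuous_on {0..t} Y" "abs_continuous_on {0..t} Z"
    using Y Z t by (auto simp: rescaled_flow_solution_def strong_solution_def)
  have ae: "AE s in lborel. s > 0 \<longrightarrow> (\<exists>D. (W has_vector_derivative D) (at s) \<and>
      s *\<^sub>R D \<in> {- \<xi> + W s - x0 | \<xi>. \<xi> \<in> subdiff_indicator cone_K (W s)})"
    if "rescaled_flow_solution x0 v0 W" for W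
    using that unfolding rescaled_flow_solution_def strong_solution_def by blast
  define f where "f s = (norm (Y s - Z s))\<^sup>2 * (1 / s\<^sup>2)" for s
  have le: "f t \<le> f s" if s: "0 < s" "s \<le> t" for s
  proof (rule abs_continuous_on_nonincreasing[OF s(2)])
    have "{s..t} \<subseteq> {0..t}" using s by auto
    then show "abs_continuous_on {s..t} f" unfolding f_def
      by (intro abs_continuous_on_times abs_continuous_on_dist_square ac[THEN abs_continuous_on_subset]
          abs_continuous_on_lipschitz[OF lipschitz_inverse_square] s)
    show "AE r in lborel. r \<in> {s<..<t} \<longrightarrow> (\<exists>D\<le>0. (f has_real_derivative D) (at r))"
      using ae[OF Y] ae[OF Z]
    proof eventually_elim
      case (elim r)
      show ?case
      proof
        assume "r \<in> {s<..<t}"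
        then have r: "r > 0" using s by auto
        with elim obtain D E \<xi> \<eta> where *: "(Y has_vector_derivative D) (at r)" "(Z has_vector_derivative E) (at r)"
          "r *\<^sub>R D = - \<xi> + Y r - x0" "r *\<^sub>R E = - \<eta> + Z r - x0"
          "\<xi> \<in> subdiff_indicator cone_K (Y r)" "\<eta> \<in> subdiff_indicator cone_K (Z r)" by blast
        define W where "W = Y r - Z r"
        have "r * inner (D - E) W = inner (r *\<^sub>R D - r *\<^sub>R E) W" by (simp add: scaleR_diff_right[symmetric])
        also have "r *\<^sub>R D - r *\<^sub>R E = W - (\<xi> - \<eta>)" unfolding *(3,4) W_def by simp
        also have "inner (W - (\<xi> - \<eta>)) W \<le> (norm W)\<^sup>2"
          using subdiff_monotone[OF *(5,6)] by (simp add: inner_diff_left power2_norm_eq_inner W_def)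
        finally have i: "r * inner (D - E) W \<le> (norm W)\<^sup>2" .
        have "((\<lambda>s. 1 / s\<^sup>2) has_real_derivative - 2 / r ^ 3) (at r)"
          using r by (auto intro!: derivative_eq_intros simp: field_simps power2_eq_square power3_eq_cube)
        then have "(f has_real_derivative 2 * inner (D - E) W * (1 / r\<^sup>2) + (- 2 / r ^ 3) * (norm W)\<^sup>2) (at r)"
          using DERIV_mult[OF has_real_derivative_dist_square[OF *(1,2)], of "\<lambda>s. 1 / s\<^sup>2"]
          unfolding f_def W_def by blast
        moreover have "2 * inner (D - E) W * (1 / r\<^sup>2) + (- 2 / r ^ 3) * (norm W)\<^sup>2 = (2 / r ^ 3) * (r * inner (D - E) W - (norm W)\<^sup>2)"
          using r by (simp add: field_simps power2_eq_square power3_eq_cube)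
        moreover have "\<dots> \<le> 0" using i r by (intro mult_nonneg_nonpos) auto
        ultimately show "\<exists>D\<le>0. (f has_real_derivative D) (at r)" by auto
      qed
    qed
  qed
  have lim: "(f \<longlongrightarrow> 0) (at_right 0)"
  proof -
    have "((\<lambda>s. (norm (inverse s *\<^sub>R (Y s - x0) - inverse s *\<^sub>R (Z s - x0)))\<^sup>2) \<longlongrightarrow> (norm (v0 - v0))\<^sup>2) (at_right 0)"
      using Y Z unfolding rescaled_flow_solution_def by (intro tendsto_intros) auto
    moreover have "(norm (inverse s *\<^sub>R (Y s - x0) - inverse s *\<^sub>R (Z s - x0)))\<^sup>2 = f s" for s
      by (simp add: scaleR_diff_right[symmetric] f_def power_mult_distrib divide_inverse power_inverse mult.commute)
    ultimately show ?thesis by simp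
  qed
  have "f t \<le> 0"
  proof (rule tendsto_lowerbound[OF lim])
    show "\<forall>\<^sub>F s in at_right 0. f t \<le> f s"
      unfolding eventually_at_right_field using t le by (intro exI[of _ t]) auto
  qed simp
  then show ?thesis using t by (simp add: f_def divide_le_0_iff)
qed (use rescaled_flow_solution_initial Y Z in metis)

lemma strong_solution_cong:
  assumes X: "strong_solution R X" and eq: "\<And>t. t \<ge> 0 \<Longrightarrow> Y t = X t"
  shows "strong_solution R Y"
  unfolding strong_solution_def
proof (intro conjI allI impI)
  show "abs_continuous_on {0..T} Y" if "T > 0" for T
    using X that eq unfolding strong_solution_def by (auto intro: abs_continuous_on_cong)
  have "AE t in lborel. t > 0 \<longrightarrow> (\<exists>D. (X has_vector_derivative D) (at t) \<and> R t (X t) D)"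
    using X by (simp add: strong_solution_def)
  then show "AE t in lborel. t > 0 \<longrightarrow> (\<exists>D. (Y has_vector_derivative D) (at t) \<and> R t (Y t) D)"
  proof eventually_elim
    case (elim t)
    show ?case
    proof
      assume t: "t > 0"
      then obtain D where D: "(X has_vector_derivative D) (at t)" "R t (X t) D" using elim by blast
      have "(Y has_vector_derivative D) (at t)"
        by (rule has_vector_derivative_transform_within_open[OF D(1), of "{0<..}"]) (use t eq in auto)
      then show "\<exists>D. (Y has_vector_derivative D) (at t) \<and> R t (Y t) D" using D eq t by auto
    qed
  qed
qed

context sticky_flow
begin

lemma proj_formula_iff: "proj_formula x0 v0 Y \<longleftrightarrow> (\<forall>t\<ge>0. Y t = X t)"
  by (simp add: proj_formula_def X_def)

lemma unique_subdiff_flow_iff: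
  "unique_forward (subdiff_flow_solution x0 v0) Y \<longleftrightarrow> (\<forall>t\<ge>0. Y t = X t)"
proof
  assume "unique_forward (subdiff_flow_solution x0 v0) Y"
  then show "\<forall>t\<ge>0. Y t = X t"
    using subdiff_flow_solution_X unfolding unique_forward_def by metis
next
  assume eq: "\<forall>t\<ge>0. Y t = X t"
  have "subdiff_flow_solution x0 v0 Y"
    using subdiff_flow_solution_X strong_solution_cong[of _ X Y] eq by (simp add: subdiff_flow_solution_def)
  then show "unique_forward (subdiff_flow_solution x0 v0) Y"
    unfolding unique_forward_def using subdiff_flow_solution_unique by blast
qed

lemma unique_rescaled_flow_iff:
  "unique_forward (rescaled_flow_solution x0 v0) Y \<longleftrightarrow> (\<forall>t\<ge>0. Y t = X t)"
proof
  assume "unique_forward (rescaled_flow_solution x0 v0) Y"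
  then show "\<forall>t\<ge>0. Y t = X t"
    using rescaled_flow_solution_X unfolding unique_forward_def by metis
next
  assume eq: "\<forall>t\<ge>0. Y t = X t"
  have "((\<lambda>t. inverse t *\<^sub>R (X t - x0)) \<longlongrightarrow> v0) (at_right 0)"
    using rescaled_flow_solution_X by (simp add: rescaled_flow_solution_def)
  then have "((\<lambda>t. inverse t *\<^sub>R (Y t - x0)) \<longlongrightarrow> v0) (at_right 0)"
    by (rule Lim_transform_eventually)
      (use eq in \<open>auto simp: eventually_at_right_field intro!: exI[of _ 1]\<close>)
  then have "rescaled_flow_solution x0 v0 Y"
    using rescaled_flow_solution_X strong_solution_cong[of _ X Y] eq by (simp add: rescaled_flow_solution_def)
  then show "unique_forward (rescaled_flow_solution x0 v0) Y"
    unfolding unique_forward_def using rescaled_flow_solution_unique by blast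
qed

lemma right_deriv_eq:
  assumes eq: "\<forall>t\<ge>0. Y t = X t" and t: "t \<ge> 0"
  shows "(Y has_vector_derivative V t) (at t within {t..})" "right_deriv Y t = V t"
proof -
  show 1: "(Y has_vector_derivative V t) (at t within {t..})"
    by (rule has_vector_derivative_transform[OF _ _ X_right_derivative[OF t]]) (use eq t in auto)
  show "right_deriv Y t = V t"
    unfolding right_deriv_def
    by (rule vector_derivative_within[OF _ 1]) (simp add: trivial_limit_at_right_real at_within_Ici_at_right)
qed

end

section \<open>Lagrangian description of measures on the line\<close>

lemma triangle_sets:
  fixes x y :: real
  shows "{p. x \<le> fst p \<and> fst p \<le> snd p \<and> snd p < y} \<in> sets (borel \<Otimes>\<^sub>M borel)"
proof -
  have "{p \<in> space (borel \<Otimes>\<^sub>M borel). x \<le> fst p \<and> fst p \<le> snd p \<and> snd p < y} \<in> sets (borel \<Otimes>\<^sub>M borel)"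
    by measurable
  then show ?thesis by (simp add: space_pair_measure)
qed

lemma triangle_area:
  fixes x y :: real
  shows "(\<integral>\<^sup>+p. 2 * indicator {p. x \<le> fst p \<and> fst p \<le> snd p \<and> snd p < y} p \<partial>(lborel :: (real \<times> real) measure))
    = ennreal ((max 0 (y - x))\<^sup>2)"
proof -
  let ?S = "{p::real \<times> real. x \<le> fst p \<and> fst p \<le> snd p \<and> snd p < y}"
  note [measurable] = triangle_sets[of x y]
  have "(\<integral>\<^sup>+p. 2 * indicator ?S p \<partial>(lborel :: (real \<times> real) measure))
    = (\<integral>\<^sup>+s. \<integral>\<^sup>+t. 2 * indicator ?S (s, t) \<partial>lborel \<partial>lborel)"
    unfolding lborel_prod[symmetric] by (subst lborel.nn_integral_fst) (auto simp: sets_pair_measure_cong)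
  also have "\<dots> = (\<integral>\<^sup>+s. ennreal (2 * (y - s)) * indicator {x..y} s \<partial>lborel)"
  proof (rule nn_integral_cong)
    fix s :: real
    have "(\<integral>\<^sup>+t. 2 * indicator ?S (s, t) \<partial>lborel) = (\<integral>\<^sup>+t. (2 * indicator {x..y} s) * indicator {s..<y} t \<partial>lborel)"
      by (rule nn_integral_cong) (auto split: split_indicator)
    also have "\<dots> = (2 * indicator {x..y} s) * emeasure lborel {s..<y}"
      by (rule nn_integral_cmult_indicator) simp
    also have "\<dots> = ennreal (2 * (y - s)) * indicator {x..y} s"
      using ennreal_mult[of 2 "y - s"] by (auto split: split_indicator)
    finally show "(\<integral>\<^sup>+t. 2 * indicator ?S (s, t) \<partial>lborel) = ennreal (2 * (y - s)) * indicator {x..y} s" .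
  qed
  also have "\<dots> = ennreal ((max 0 (y - x))\<^sup>2)"
  proof (cases "x \<le> y")
    case True
    have "(\<integral>\<^sup>+s. ennreal (2 * (y - s)) * indicator {x..y} s \<partial>lborel) = ennreal (- (y - y)\<^sup>2 - (- (y - x)\<^sup>2))"
      by (rule nn_integral_FTC_Icc[OF _ _ _ True]) (auto intro!: derivative_eq_intros)
    then show ?thesis using True by simp
  qed (simp add: max_def)
  finally show ?thesis .
qed

text \<open>The squared distance of two numbers is twice the area of the triangle of pairs between
  them. By Fubini the transport cost depends only on the probabilities that one function is at most
  \<open>s\<close> while the other exceeds some \<open>t \<ge> s\<close>, and does so
  monotonically.\<close>

lemma (in prob_space) cost_layer_cake:
  assumes [measurable]: "f \<in> borel_measurable M" "g \<in> borel_measurable M"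
  shows "(\<integral>\<^sup>+q. ennreal ((f q - g q)\<^sup>2) \<partial>M) = (\<integral>\<^sup>+p. 2 * indicator {p. fst p \<le> snd p} p *
     (ennreal (prob {q\<in>space M. f q \<le> fst p \<and> snd p < g q}) + ennreal (prob {q\<in>space M. g q \<le> fst p \<and> snd p < f q}))
     \<partial>(lborel :: (real \<times> real) measure))"
proof -
  interpret pair_sigma_finite M "lborel :: (real \<times> real) measure" ..
  define S where "S x y = {p::real \<times> real. x \<le> fst p \<and> fst p \<le> snd p \<and> snd p < y}" for x y
  have "ennreal ((x - y)\<^sup>2) = (\<integral>\<^sup>+p. 2 * indicator (S x y) p + 2 * indicator (S y x) p \<partial>lborel)" for x y
  proof -
    have [measurable]: "S a b \<in> sets lborel" for a b
      using triangle_sets[of a b] unfolding S_def by (simp add: borel_prod[symmetric])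
    have "(\<integral>\<^sup>+p. 2 * indicator (S x y) p + 2 * indicator (S y x) p \<partial>lborel) = ennreal ((max 0 (y - x))\<^sup>2) + ennreal ((max 0 (x - y))\<^sup>2)"
      unfolding triangle_area[symmetric] S_def[symmetric] by (intro nn_integral_add) auto
    then show ?thesis by (simp add: max_def power2_commute[of x y])
  qed
  then have "(\<integral>\<^sup>+q. ennreal ((f q - g q)\<^sup>2) \<partial>M) = (\<integral>\<^sup>+q. \<integral>\<^sup>+p. 2 * indicator (S (f q) (g q)) p + 2 * indicator (S (g q) (f q)) p \<partial>lborel \<partial>M)"
    by simp
  also have "\<dots> = (\<integral>\<^sup>+p. \<integral>\<^sup>+q. 2 * indicator (S (f q) (g q)) p + 2 * indicator (S (g q) (f q)) p \<partial>M \<partial>lborel)"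
  proof (rule Fubini'[symmetric])
    have "Measurable.pred (M \<Otimes>\<^sub>M lborel) (\<lambda>(q, p). p \<in> S (f q) (g q))" "Measurable.pred (M \<Otimes>\<^sub>M lborel) (\<lambda>(q, p). p \<in> S (g q) (f q))"
      unfolding S_def lborel_prod[symmetric] mem_Collect_eq by measurable
    then show "(\<lambda>(q, p). 2 * indicator (S (f q) (g q)) p + 2 * indicator (S (g q) (f q)) p) \<in> borel_measurable (M \<Otimes>\<^sub>M lborel)"
      unfolding indicator_def by measurable
  qed
  also have "\<dots> = (\<integral>\<^sup>+p. 2 * indicator {p. fst p \<le> snd p} p *
     (ennreal (prob {q\<in>space M. f q \<le> fst p \<and> snd p < g q}) + ennreal (prob {q\<in>space M. g q \<le> fst p \<and> snd p < f q})) \<partial>lborel)"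
  proof (rule nn_integral_cong)
    fix p :: "real \<times> real"
    let ?A = "{q\<in>space M. f q \<le> fst p \<and> snd p < g q}" and ?B = "{q\<in>space M. g q \<le> fst p \<and> snd p < f q}"
    have "(\<integral>\<^sup>+q. 2 * indicator (S (f q) (g q)) p + 2 * indicator (S (g q) (f q)) p \<partial>M)
      = (\<integral>\<^sup>+q. (2 * indicator {p. fst p \<le> snd p} p) * (indicator ?A q + indicator ?B q) \<partial>M)"
      by (rule nn_integral_cong) (auto simp: S_def split: split_indicator)
    also have "\<dots> = (2 * indicator {p. fst p \<le> snd p} p) * (\<integral>\<^sup>+q. indicator ?A q + indicator ?B q \<partial>M)"
      by (rule nn_integral_cmult) measurable
    also have "(\<integral>\<^sup>+q. indicator ?A q + indicator ?B q \<partial>M) = ennreal (prob ?A) + ennreal (prob ?B)"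
      by (subst nn_integral_add) (auto simp: emeasure_eq_measure)
    finally show "(\<integral>\<^sup>+q. 2 * indicator (S (f q) (g q)) p + 2 * indicator (S (g q) (f q)) p \<partial>M)
      = 2 * indicator {p. fst p \<le> snd p} p * (ennreal (prob ?A) + ennreal (prob ?B))" .
  qed
  finally show ?thesis .
qed

text \<open>Sublevel sets of nondecreasing functions are initial segments, hence nested. The
  probability therefore equals the smallest value that the two distribution functions
  permit.\<close>

lemma mono_on_prob_diff:
  fixes f g :: "real \<Rightarrow> real"
  assumes f: "mono_on {0<..<1} f" and g: "mono_on {0<..<1} g"
  shows "measure unit_lborel {w\<in>{0<..<1}. f w \<le> s \<and> t < g w}
    = max 0 (measure unit_lborel {w\<in>{0<..<1}. f w \<le> s} - measure unit_lborel {w\<in>{0<..<1}. g w \<le> t})"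
proof -
  have fm [measurable]: "f \<in> borel_measurable unit_lborel" and gm [measurable]: "g \<in> borel_measurable unit_lborel"
    using f g by (auto intro: mono_on_imp_measurable_unit_lborel)
  define A where "A = {w\<in>space unit_lborel. f w \<le> s}"
  define B where "B = {w\<in>space unit_lborel. g w \<le> t}"
  have [measurable]: "A \<in> sets unit_lborel" "B \<in> sets unit_lborel" unfolding A_def B_def by measurable
  have "A \<subseteq> B \<or> B \<subseteq> A"
  proof (rule ccontr)
    assume "\<not> ?thesis"
    then obtain a b where ab: "a \<in> A" "a \<notin> B" "b \<in> B" "b \<notin> A" by blast
    then show False
      using mono_onD[OF f, of b a] mono_onD[OF g, of a b] by (cases "a \<le> b") (auto simp: A_def B_def)
  qed
  moreover have "measure unit_lborel (A - B) = max 0 (measure unit_lborel A - measure unit_lborel B)"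
    if "A \<subseteq> B"
  proof -
    have "measure unit_lborel (A - B) = 0" unfolding Diff_eq_empty_iff[THEN iffD2, OF that] by (rule measure_empty)
    moreover have "measure unit_lborel A \<le> measure unit_lborel B" using that by (intro U.finite_measure_mono) auto
    ultimately show ?thesis by simp
  qed
  moreover have "measure unit_lborel (A - B) = max 0 (measure unit_lborel A - measure unit_lborel B)"
    if "B \<subseteq> A"
    using that by (subst U.finite_measure_Diff) (auto simp: max_def intro: U.finite_measure_mono)
  moreover have "A - B = {w\<in>{0<..<1}. f w \<le> s \<and> t < g w}" by (auto simp: A_def B_def)
  ultimately show ?thesis unfolding A_def B_def space_unit_lborel by metis
qed

text \<open>For any pair with the same marginals, the probabilities in the layer cake formula are
  bounded below by the differences of the distribution functions, and the monotone pair attains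
  these bounds. The probability space is left general so that a coupling enters through its two
  coordinates.\<close>

lemma mono_coupling_optimal:
  fixes f g :: "real \<Rightarrow> real"
  assumes f: "mono_on {0<..<1} f" and g: "mono_on {0<..<1} g"
    and M: "prob_space M" and [measurable]: "f' \<in> borel_measurable M" "g' \<in> borel_measurable M"
    and ff: "\<And>s. measure M {q\<in>space M. f' q \<le> s} = measure unit_lborel {w\<in>{0<..<1}. f w \<le> s}"
    and gg: "\<And>s. measure M {q\<in>space M. g' q \<le> s} = measure unit_lborel {w\<in>{0<..<1}. g w \<le> s}"
  shows "(\<integral>\<^sup>+w. ennreal ((f w - g w)\<^sup>2) \<partial>unit_lborel) \<le> (\<integral>\<^sup>+q. ennreal ((f' q - g' q)\<^sup>2) \<partial>M)"
proof -
  interpret M: prob_space M by (rule M)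
  have fm [measurable]: "f \<in> borel_measurable unit_lborel" and gm [measurable]: "g \<in> borel_measurable unit_lborel"
    using f g by (auto intro: mono_on_imp_measurable_unit_lborel)
  have le: "measure M {q\<in>space M. h q \<le> s} - measure M {q\<in>space M. k q \<le> t} \<le> measure M {q\<in>space M. h q \<le> s \<and> t < k q}"
    if [measurable]: "h \<in> borel_measurable M" "k \<in> borel_measurable M" for h k :: "_ \<Rightarrow> real" and s t
  proof -
    have "measure M {q\<in>space M. h q \<le> s} \<le> measure M ({q\<in>space M. h q \<le> s \<and> t < k q} \<union> {q\<in>space M. k q \<le> t})"
      by (rule M.finite_measure_mono) auto
    also have "\<dots> \<le> measure M {q\<in>space M. h q \<le> s \<and> t < k q} + measure M {q\<in>space M. k q \<le> t}"
      by (rule measure_Un_le) measurable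
    finally show ?thesis by simp
  qed
  show ?thesis
    unfolding U.cost_layer_cake[OF fm gm] M.cost_layer_cake[OF assms(4,5)] space_unit_lborel
  proof (intro nn_integral_mono mult_left_mono add_mono ennreal_leI)
    fix p :: "real \<times> real"
    show "measure unit_lborel {q \<in> {0<..<1}. f q \<le> fst p \<and> snd p < g q} \<le> M.prob {q \<in> space M. f' q \<le> fst p \<and> snd p < g' q}"
      unfolding mono_on_prob_diff[OF f g] using le[of f' g'] by (auto simp: ff gg)
    show "measure unit_lborel {q \<in> {0<..<1}. g q \<le> fst p \<and> snd p < f q} \<le> M.prob {q \<in> space M. g' q \<le> fst p \<and> snd p < f' q}"
      unfolding mono_on_prob_diff[OF g f] using le[of g' f'] by (auto simp: ff gg)
  qed simp
qed

section \<open>Monotone rearrangements and the Wasserstein distance\<close>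

abbreviation "law f \<equiv> distr unit_lborel borel f"

lemma cdf_law:
  fixes f :: "real \<Rightarrow> real"
  assumes [measurable]: "f \<in> borel_measurable unit_lborel"
  shows "measure (law f) {..s} = measure unit_lborel {w\<in>{0<..<1}. f w \<le> s}"
  by (subst measure_distr) (auto intro!: arg_cong[where f="measure unit_lborel"])

text \<open>The monotone pair costs no more than the coupling of \<open>f\<close> with itself, whose
  cost is zero.\<close>

lemma mono_eq_of_law_eq:
  assumes f: "sq f" "mono_on {0<..<1} f" and g: "sq g" "mono_on {0<..<1} g" and eq: "law f = law g"
  shows "abs_l2 f = abs_l2 g"
proof -
  have fm [measurable]: "f \<in> borel_measurable unit_lborel" and gm [measurable]: "g \<in> borel_measurable unit_lborel"
    using f g by (auto intro: mono_on_imp_measurable_unit_lborel)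
  have "(\<integral>\<^sup>+w. ennreal ((f w - g w)\<^sup>2) \<partial>unit_lborel) \<le> (\<integral>\<^sup>+w. ennreal ((f w - f w)\<^sup>2) \<partial>unit_lborel)"
    using cdf_law[OF fm] cdf_law[OF gm] eq
    by (intro mono_coupling_optimal f g prob_space_unit_lborel fm) auto
  then have "AE w in unit_lborel. ennreal ((f w - g w)\<^sup>2) = 0"
    using nn_integral_0_iff_AE[of "\<lambda>w. ennreal ((f w - g w)\<^sup>2)" unit_lborel] by simp
  then show ?thesis using abs_l2_eq_iff[OF f(1) g(1)] by (auto elim!: eventually_mono)
qed

lemma P2_real_distribution: "\<rho> \<in> P2 \<Longrightarrow> real_distribution \<rho>"
  by (auto simp: P2_def real_distribution_def real_distribution_axioms_def)

context
  fixes \<rho> assumes \<rho>: "real_distribution \<rho>"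
begin

interpretation real_distribution \<rho> by (rule \<rho>)

lemma rearr_le: "w < measure \<rho> {..x} \<Longrightarrow> 0 < w \<Longrightarrow> rearr \<rho> w \<le> x"
  and le_rearr: "rearr \<rho> w \<le> x \<Longrightarrow> 0 < w \<Longrightarrow> w < 1 \<Longrightarrow> w \<le> measure \<rho> {..x}"
  and mono_rearr: "mono_on {0<..<1} (rearr \<rho>)"
proof -
  have bdd: "bdd_below {x. measure \<rho> {..x} > w}" if "0 < w" for w
  proof -
    have "\<forall>\<^sub>F x in at_bot. cdf \<rho> x < w" using cdf_lim_at_bot that by (rule order_tendstoD)
    then obtain a where a: "\<And>x. x \<le> a \<Longrightarrow> cdf \<rho> x < w" by (auto simp: eventually_at_bot_linorder)
    then show ?thesis
      by (intro bdd_belowI[of _ a]) (metis (mono_tags) cdf_def linorder_le_cases mem_Collect_eq not_less_iff_gr_or_eq)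
  qed
  have ne: "{x. measure \<rho> {..x} > w} \<noteq> {}" if "w < 1" for w
  proof -
    have "\<forall>\<^sub>F x in at_top. w < cdf \<rho> x" using cdf_lim_at_top_prob that by (rule order_tendstoD)
    then show ?thesis by (auto simp: cdf_def eventually_at_top_linorder)
  qed
  show "rearr \<rho> w \<le> x" if "w < measure \<rho> {..x}" "0 < w"
    unfolding rearr_def using that bdd by (intro cInf_lower) auto
  show "w \<le> measure \<rho> {..x}" if "rearr \<rho> w \<le> x" "0 < w" "w < 1"
  proof -
    have gt: "w \<le> cdf \<rho> y" if y: "x < y" for y
    proof -
      have "rearr \<rho> w < y" using y \<open>rearr \<rho> w \<le> x\<close> by simp
      then obtain z where "measure \<rho> {..z} > w" "z < y"
        unfolding rearr_def using cInf_lessD[OF ne[OF \<open>w < 1\<close>]] by auto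
      then show ?thesis using cdf_nondecreasing[of z y] by (simp add: cdf_def)
    qed
    have "(cdf \<rho> \<longlongrightarrow> cdf \<rho> x) (at_right x)"
      using cdf_is_right_cont[of x] by (simp add: continuous_within)
    moreover have "\<forall>\<^sub>F y in at_right x. w \<le> cdf \<rho> y"
      using eventually_at_right_less[of x] by (rule eventually_mono) (rule gt)
    ultimately have "w \<le> cdf \<rho> x" by (rule tendsto_lowerbound) simp
    then show ?thesis by (simp add: cdf_def)
  qed
  show "mono_on {0<..<1} (rearr \<rho>)"
    unfolding rearr_def by (intro mono_onI cInf_superset_mono ne bdd) auto
qed

lemma rearr_measurable [measurable]: "rearr \<rho> \<in> borel_measurable unit_lborel"
  by (rule mono_on_imp_measurable_unit_lborel[OF mono_rearr])

text \<open>The sublevel set of the rearrangement at \<open>x\<close> lies between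
  \<open>{..<F}\<close> and \<open>{..F}\<close> within the unit interval, where \<open>F\<close> is
  the distribution function at \<open>x\<close>; both have measure \<open>F\<close>.\<close>

lemma law_rearr: "law (rearr \<rho>) = \<rho>"
proof (rule cdf_unique)
  show "real_distribution (law (rearr \<rho>))" by (rule U.real_distribution_distr) measurable
  show "real_distribution \<rho>" by (rule \<rho>)
  show "cdf (law (rearr \<rho>)) = cdf \<rho>"
  proof
    fix x
    define F where "F = measure \<rho> {..x}"
    have F: "0 \<le> F" "F \<le> 1" by (simp_all add: F_def)
    have m: "measure unit_lborel ({0<..<1} \<inter> I) = F" if "I = {..<F} \<or> I = {..F}" for I
    proof -
      have "{0<..<1} \<inter> I = {0<..<F} \<or> {0<..<1} \<inter> I = {0<..F} \<or> {0<..<1} \<inter> I = {0<..<1} \<and> F = 1"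
        using that F by force
      then show ?thesis using F by (auto simp: unit_lborel_def measure_restrict_space subset_iff)
    qed
    have s: "{0<..<1} \<inter> {..<F} \<in> sets unit_lborel" "{0<..<1} \<inter> {..F} \<in> sets unit_lborel"
      by (auto simp: sets_unit_lborel)
    have s': "{w\<in>{0<..<1}. rearr \<rho> w \<le> x} \<in> sets unit_lborel"
    proof -
      have "{w\<in>space unit_lborel. rearr \<rho> w \<le> x} \<in> sets unit_lborel" by measurable
      then show ?thesis by simp
    qed
    have "F = measure unit_lborel ({0<..<1} \<inter> {..<F})" using m[of "{..<F}"] by simp
    also have "\<dots> \<le> measure unit_lborel {w\<in>{0<..<1}. rearr \<rho> w \<le> x}"
      by (rule U.finite_measure_mono[OF _ s']) (auto simp: F_def intro: rearr_le)
    finally have "F \<le> measure unit_lborel {w\<in>{0<..<1}. rearr \<rho> w \<le> x}" .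
    moreover have "measure unit_lborel {w\<in>{0<..<1}. rearr \<rho> w \<le> x} \<le> measure unit_lborel ({0<..<1} \<inter> {..F})"
      by (rule U.finite_measure_mono[OF _ s(2)]) (auto simp: F_def intro: le_rearr)
    moreover have "measure unit_lborel ({0<..<1} \<inter> {..F}) = F" using m[of "{..F}"] by simp
    ultimately show "cdf (law (rearr \<rho>)) x = cdf \<rho> x"
      unfolding cdf_def cdf_law[OF rearr_measurable] by (simp add: F_def)
  qed
qed

end

lemma square_integrable_law_iff:
  assumes [measurable]: "f \<in> borel_measurable unit_lborel"
  shows "square_integrable (law f) u \<longleftrightarrow> u \<in> borel_measurable borel \<and> sq (\<lambda>w. u (f w))"
proof -
  have "integrable (law f) (\<lambda>x. (u x)\<^sup>2) \<longleftrightarrow> integrable unit_lborel (\<lambda>w. (u (f w))\<^sup>2)"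
    if [measurable]: "u \<in> borel_measurable borel"
    by (rule integrable_distr_eq) measurable
  then show ?thesis
    by (auto simp: square_integrable_def measurable_compose[OF assms])
qed

lemma law_in_P2: "sq f \<Longrightarrow> law f \<in> P2"
proof -
  assume f: "sq f"
  then have [measurable]: "f \<in> borel_measurable unit_lborel" by (simp add: square_integrable_def)
  have "integrable (law f) (\<lambda>x. x\<^sup>2)"
    using f by (subst integrable_distr_eq) (auto simp: square_integrable_def)
  then show ?thesis by (auto simp: P2_def intro!: U.prob_space_distr)
qed

context
  fixes \<rho> assumes \<rho>: "\<rho> \<in> P2"
begin

lemmas P2_mono_rearr = mono_rearr[OF P2_real_distribution[OF \<rho>]]
  and P2_rearr_measurable = rearr_measurable[OF P2_real_distribution[OF \<rho>]]
  and P2_law_rearr = law_rearr[OF P2_real_distribution[OF \<rho>]]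

lemma square_integrable_P2_iff:
  "square_integrable \<rho> u \<longleftrightarrow> u \<in> borel_measurable borel \<and> sq (\<lambda>w. u (rearr \<rho> w))"
  using square_integrable_law_iff[OF P2_rearr_measurable] P2_law_rearr by simp

lemma sq_rearr: "sq (rearr \<rho>)"
proof -
  have "sets \<rho> = sets borel" "integrable \<rho> (\<lambda>x. x\<^sup>2)" using \<rho> by (auto simp: P2_def)
  then have "square_integrable \<rho> (\<lambda>x. x)"
    by (auto simp: square_integrable_def cong: measurable_cong_sets)
  then show ?thesis by (simp add: square_integrable_P2_iff)
qed

lemma rearr_l2_in_cone_K: "rearr_l2 \<rho> \<in> cone_K"
  unfolding rearr_l2_def by (rule cone_KI[OF sq_rearr P2_mono_rearr])

lemma lagrangian_velocity_in_sub_H: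
  "square_integrable \<rho> u \<Longrightarrow> lagrangian_velocity \<rho> u \<in> sub_H (rearr_l2 \<rho>)"
  unfolding rearr_l2_def lagrangian_velocity_def comp_def
  by (rule comp_in_sub_H[OF sq_rearr P2_mono_rearr]) (simp add: square_integrable_P2_iff)

end

lemma rearr_l2_law:
  assumes "sq f" "mono_on {0<..<1} f"
  shows "rearr_l2 (law f) = abs_l2 f"
  unfolding rearr_l2_def
  using law_in_P2[OF assms(1)] assms
  by (intro mono_eq_of_law_eq sq_rearr P2_mono_rearr P2_law_rearr) 

lemma P2_eqI: "\<rho> \<in> P2 \<Longrightarrow> \<rho>' \<in> P2 \<Longrightarrow> rearr_l2 \<rho> = rearr_l2 \<rho>' \<Longrightarrow> \<rho> = \<rho>'"
proof -
  assume 1: "\<rho> \<in> P2" and 2: "\<rho>' \<in> P2" and eq: "rearr_l2 \<rho> = rearr_l2 \<rho>'"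
  have "law (rearr \<rho>) = law (rearr \<rho>')"
    using eq abs_l2_eq_iff[OF sq_rearr[OF 1] sq_rearr[OF 2]]
    by (intro distr_cong_AE) (auto simp: rearr_l2_def P2_rearr_measurable 1 2)
  then show ?thesis by (simp add: P2_law_rearr 1 2)
qed

text \<open>The joint law of the two rearrangements attains the infimum over couplings, and its cost
  is the squared \<open>L^2\<close> distance.\<close>

lemma W2_eq_norm:
  assumes 1: "\<rho>1 \<in> P2" and 2: "\<rho>2 \<in> P2"
  shows "W2 \<rho>1 \<rho>2 = norm (rearr_l2 \<rho>1 - rearr_l2 \<rho>2)"
proof -
  define f where "f = rearr \<rho>1"
  define g where "g = rearr \<rho>2"
  have f: "sq f" "mono_on {0<..<1} f" "law f = \<rho>1" and g: "sq g" "mono_on {0<..<1} g" "law g = \<rho>2"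
    by (auto simp: f_def g_def sq_rearr 1 2 P2_mono_rearr P2_law_rearr)
  have fm [measurable]: "f \<in> borel_measurable unit_lborel" and gm [measurable]: "g \<in> borel_measurable unit_lborel"
    using f g by (auto intro: mono_on_imp_measurable_unit_lborel)
  have fg: "sq (\<lambda>w. f w - g w)" by (intro square_integrable_diff f g)
  define c where "c = (LINT w|unit_lborel. (f w - g w)\<^sup>2)"
  have c0: "0 \<le> c" by (simp add: c_def)
  have ennc: "ennreal c = (\<integral>\<^sup>+w. ennreal ((f w - g w)\<^sup>2) \<partial>unit_lborel)"
    unfolding c_def using fg by (intro nn_integral_eq_integral[symmetric]) (auto simp: square_integrable_def)
  have norm: "norm (rearr_l2 \<rho>1 - rearr_l2 \<rho>2) = sqrt c"
    using abs_l2_norm[OF fg] by (simp add: rearr_l2_def f_def[symmetric] g_def[symmetric] abs_l2_diff f g c_def real_sqrt_unique)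
  define \<gamma>0 where "\<gamma>0 = distr unit_lborel (borel \<Otimes>\<^sub>M borel) (\<lambda>w. (f w, g w))"
  have \<gamma>0: "\<gamma>0 \<in> couplings \<rho>1 \<rho>2"
    unfolding couplings_def \<gamma>0_def by (auto simp: distr_distr comp_def f(3) g(3))
  have c\<gamma>0: "(LINT p|\<gamma>0. (fst p - snd p)\<^sup>2) = c"
    unfolding \<gamma>0_def c_def by (subst integral_distr) auto
  have lower: "c \<le> (LINT p|\<gamma>. (fst p - snd p)\<^sup>2)" if "\<gamma> \<in> couplings \<rho>1 \<rho>2" for \<gamma>
  proof -
    have s [measurable_cong]: "sets \<gamma> = sets (borel \<Otimes>\<^sub>M borel)" and m1: "distr \<gamma> borel fst = \<rho>1" and m2: "distr \<gamma> borel snd = \<rho>2"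
      using that by (auto simp: couplings_def)
    have fs [measurable]: "fst \<in> borel_measurable \<gamma>" "snd \<in> borel_measurable \<gamma>" by measurable
    have sp: "space \<gamma> = UNIV" using sets_eq_imp_space_eq[OF s] by (simp add: space_pair_measure)
    interpret r1: prob_space \<rho>1 using 1 by (simp add: P2_def)
    have "emeasure \<gamma> (space \<gamma>) = emeasure (distr \<gamma> borel fst) UNIV"
      by (subst emeasure_distr) (auto simp: sp)
    also have "\<dots> = 1" unfolding m1 using r1.emeasure_space_1 sets_eq_imp_space_eq[of \<rho>1 borel] 1 by (simp add: P2_def)
    finally interpret \<gamma>: prob_space \<gamma> by (rule prob_spaceI)
    have "measure \<gamma> {q\<in>space \<gamma>. h q \<le> s} = measure (distr \<gamma> borel h) {..s}" if [measurable]: "h \<in> borel_measurable \<gamma>" for h :: "_ \<Rightarrow> real" and s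
      by (subst measure_distr) (auto intro!: arg_cong[where f="measure \<gamma>"])
    note cdfs = this[OF fs(1), unfolded m1, folded f(3), unfolded cdf_law[OF fm]] this[OF fs(2), unfolded m2, folded g(3), unfolded cdf_law[OF gm]]
    have le: "ennreal c \<le> (\<integral>\<^sup>+p. ennreal ((fst p - snd p)\<^sup>2) \<partial>\<gamma>)"
      unfolding ennc by (rule mono_coupling_optimal[OF f(2) g(2) \<gamma>.prob_space_axioms fs cdfs])
    \<comment> \<open>The lower bound is one for extended integrals. It passes to the Bochner
      integral, whose default value is zero, only once the cost is integrable; the second moments of
      the marginals ensure this.\<close>
    have i1: "integrable \<gamma> (\<lambda>p. (fst p)\<^sup>2)" "integrable \<gamma> (\<lambda>p. (snd p)\<^sup>2)"
      using 1 2 integrable_distr[of fst \<gamma> borel "\<lambda>x. x\<^sup>2"] integrable_distr[of snd \<gamma> borel "\<lambda>x. x\<^sup>2"]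
      by (simp_all add: m1 m2 P2_def)
    have "integrable \<gamma> (\<lambda>p. (fst p - snd p)\<^sup>2)"
    proof (rule Bochner_Integration.integrable_bound)
      show "integrable \<gamma> (\<lambda>p. 2 * (fst p)\<^sup>2 + 2 * (snd p)\<^sup>2)" using i1 by auto
      have "(a - b)\<^sup>2 \<le> 2 * a\<^sup>2 + 2 * b\<^sup>2" for a b :: real
        using zero_le_power2[of "a + b"] by (simp add: power2_sum power2_diff)
      then show "AE p in \<gamma>. norm ((fst p - snd p)\<^sup>2) \<le> norm (2 * (fst p)\<^sup>2 + 2 * (snd p)\<^sup>2)" by simp
    qed measurable
    then have "(\<integral>\<^sup>+p. ennreal ((fst p - snd p)\<^sup>2) \<partial>\<gamma>) = ennreal (LINT p|\<gamma>. (fst p - snd p)\<^sup>2)"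
      by (intro nn_integral_eq_integral) auto
    then show ?thesis using le by (simp add: ennreal_le_iff)
  qed
  have "(INF \<gamma>\<in>couplings \<rho>1 \<rho>2. LINT p|\<gamma>. (fst p - snd p)\<^sup>2) = c"
  proof (rule cInf_eq_minimum)
    show "c \<in> (\<lambda>\<gamma>. LINT p|\<gamma>. (fst p - snd p)\<^sup>2) ` couplings \<rho>1 \<rho>2"
      using \<gamma>0 c\<gamma>0 by force
  qed (use lower in auto)
  then show ?thesis unfolding W2_def norm by simp
qed

text \<open>The second argument may be any square integrable function, not only one in
  \<open>sub_H x\<close>. This allows the initial velocity to stand in for the current one in
  formulas for the momentum.\<close>

definition eul :: "l2 \<Rightarrow> l2 \<Rightarrow> state" where
  "eul x y = (law (rep_l2 x),
    \<lambda>B. if B \<in> sets borel then (LINT w|unit_lborel. indicator B (rep_l2 x w) * rep_l2 y w) else 0)"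

lemma eul_abs:
  assumes f: "sq f" and g: "sq g"
  shows "eul (abs_l2 f) (abs_l2 g) = (law f,
    \<lambda>B. if B \<in> sets borel then (LINT w|unit_lborel. indicator B (f w) * g w) else 0)"
proof -
  have [measurable]: "f \<in> borel_measurable unit_lborel" "g \<in> borel_measurable unit_lborel"
    using f g by (auto simp: square_integrable_def)
  have "law (rep_l2 (abs_l2 f)) = law f"
    by (rule distr_cong_AE) (use rep_abs_l2[OF f] in auto)
  moreover have "(LINT w|unit_lborel. indicator B (rep_l2 (abs_l2 f) w) * rep_l2 (abs_l2 g) w) = (LINT w|unit_lborel. indicator B (f w) * g w)"
    if [measurable]: "B \<in> sets borel" for B :: "real set"
  proof (rule integral_cong_AE)
    show "AE w in unit_lborel. indicator B (rep_l2 (abs_l2 f) w) * rep_l2 (abs_l2 g) w = indicator B (f w) * g w"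
      using rep_abs_l2[OF f] rep_abs_l2[OF g] by eventually_elim simp
  qed measurable
  ultimately show ?thesis by (auto simp: eul_def)
qed

lemma eul_lagrangian:
  assumes \<rho>: "\<rho> \<in> P2" and u: "square_integrable \<rho> u"
  shows "(\<rho>, momentum \<rho> u) = eul (rearr_l2 \<rho>) (lagrangian_velocity \<rho> u)"
proof -
  have [measurable]: "rearr \<rho> \<in> borel_measurable unit_lborel" by (rule P2_rearr_measurable[OF \<rho>])
  have u': "u \<in> borel_measurable borel" "sq (\<lambda>w. u (rearr \<rho> w))"
    using u by (auto simp: square_integrable_P2_iff[OF \<rho>])
  note [measurable] = u'(1)
  have "(LINT x:B|\<rho>. u x) = (LINT w|unit_lborel. indicator B (rearr \<rho> w) * u (rearr \<rho> w))"
    if [measurable]: "B \<in> sets borel" for B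
  proof -
    have "(LINT x:B|\<rho>. u x) = (LINT x|law (rearr \<rho>). indicator B x * u x)"
      by (simp add: set_lebesgue_integral_def P2_law_rearr[OF \<rho>])
    also have "\<dots> = (LINT w|unit_lborel. indicator B (rearr \<rho> w) * u (rearr \<rho> w))"
      by (rule integral_distr) measurable
    finally show ?thesis .
  qed
  then show ?thesis
    unfolding rearr_l2_def lagrangian_velocity_def comp_def eul_abs[OF sq_rearr[OF \<rho>] u'(2)]
    by (auto simp: momentum_def P2_law_rearr[OF \<rho>])
qed

lemma law_rep_cone_K:
  assumes "x \<in> cone_K"
  shows "law (rep_l2 x) \<in> P2" "rearr_l2 (law (rep_l2 x)) = x"
proof -
  obtain f where f: "sq f" "mono_on {0<..<1} f" "x = abs_l2 f" using assms cone_K_cases by blast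
  have "law (rep_l2 x) = law f"
    using eul_abs[OF f(1) f(1)] f(3) by (simp add: eul_def)
  then show "law (rep_l2 x) \<in> P2" "rearr_l2 (law (rep_l2 x)) = x"
    using law_in_P2[OF f(1)] rearr_l2_law[OF f(1,2)] f(3) by auto
qed

lemma sub_H_factor_rep:
  assumes x: "x \<in> cone_K" and y: "y \<in> sub_H x"
  obtains u where "u \<in> borel_measurable borel" "sq (\<lambda>w. u (rep_l2 x w))" "y = abs_l2 (\<lambda>w. u (rep_l2 x w))"
proof -
  obtain f where f: "sq f" "mono_on {0<..<1} f" "x = abs_l2 f" using x cone_K_cases by blast
  obtain u where u [measurable]: "u \<in> borel_measurable borel" and ae: "AE w in unit_lborel. rep_l2 y w = u (f w)"
    using sub_H_factor[OF f(1,2)] y f(3) by blast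
  have ae': "AE w in unit_lborel. rep_l2 y w = u (rep_l2 x w)"
    using ae rep_abs_l2[OF f(1)] unfolding f(3) by eventually_elim simp
  have s: "sq (\<lambda>w. u (rep_l2 x w))" by (rule square_integrable_cong_AE[OF sq_rep_l2 _ ae']) measurable
  show ?thesis
    by (rule that[OF u s]) (use abs_l2_eq_iff[OF sq_rep_l2 s, of y] ae' in simp)
qed

lemma comp_rep_in_sub_H:
  assumes x: "x \<in> cone_K" and u [measurable]: "u \<in> borel_measurable borel" and s: "sq (\<lambda>w. u (rep_l2 x w))"
  shows "abs_l2 (\<lambda>w. u (rep_l2 x w)) \<in> sub_H x"
proof -
  obtain f where f: "sq f" "mono_on {0<..<1} f" "x = abs_l2 f" using x cone_K_cases by blast
  have [measurable]: "f \<in> borel_measurable unit_lborel" using f by (simp add: square_integrable_def)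
  have ae: "AE w in unit_lborel. u (rep_l2 x w) = u (f w)"
    using rep_abs_l2[OF f(1)] unfolding f(3) by eventually_elim simp
  have s': "sq (\<lambda>w. u (f w))" by (rule square_integrable_cong_AE[OF s _ ae]) measurable
  show ?thesis
    using comp_in_sub_H[OF f(1,2) s'] abs_l2_eq_iff[OF s s'] ae f(3) by simp
qed

text \<open>The difference is a function of \<open>x\<close> with vanishing integral over all
  sublevel sets of \<open>x\<close>, so it is orthogonal to every square integrable function of
  \<open>x\<close>, in particular to itself.\<close>

lemma sub_H_eqI:
  assumes x: "x \<in> cone_K" and y: "y \<in> sub_H x" and z: "z \<in> sub_H x"
    and eq: "\<And>c. (LINT w|unit_lborel. indicator {..c} (rep_l2 x w) * rep_l2 y w) = (LINT w|unit_lborel. indicator {..c} (rep_l2 x w) * rep_l2 z w)"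
  shows "y = z"
proof -
  define d where "d = y - z"
  have "d \<in> sub_H x" unfolding d_def using y z by (rule subspace_diff[OF subspace_sub_H])
  then obtain u where u [measurable]: "u \<in> borel_measurable borel" "sq (\<lambda>w. u (rep_l2 x w))" "d = abs_l2 (\<lambda>w. u (rep_l2 x w))"
    using sub_H_factor_rep[OF x] by blast
  have ib: "integrable unit_lborel (\<lambda>w. indicator {..c} (rep_l2 x w) * rep_l2 v w)" for c v
    by (rule Bochner_Integration.integrable_bound[OF U.integrable_of_square_integrable[OF sq_rep_l2[of v]]])
      (auto split: split_indicator)
  have "(LINT w|unit_lborel. rep_l2 d w * u (rep_l2 x w)) = 0"
  proof (rule integral_comp_eq_zero[where f="rep_l2 x" and u=u])
    fix c
    have "(LINT w|unit_lborel. rep_l2 d w * indicator {..c} (rep_l2 x w))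
      = (LINT w|unit_lborel. indicator {..c} (rep_l2 x w) * rep_l2 y w - indicator {..c} (rep_l2 x w) * rep_l2 z w)"
      by (rule integral_cong_AE) (use rep_l2_diff[of y z] in \<open>auto simp: d_def left_diff_distrib right_diff_distrib mult.commute elim!: eventually_mono\<close>)
    also have "\<dots> = 0" by (simp add: ib eq)
    finally show "(LINT w|unit_lborel. rep_l2 d w * indicator {..c} (rep_l2 x w)) = 0" .
  qed (auto intro: U.integrable_of_square_integrable square_integrable_mult u)
  then have "inner d d = 0" using abs_l2_inner[OF sq_rep_l2 u(2), of d] u(3) by simp
  then show ?thesis by (simp add: d_def)
qed

text \<open>The law determines its monotone rearrangement \<open>x\<close>, and the momenta of
  half-lines determine the velocity within \<open>sub_H x\<close>.\<close>

lemma eul_inj: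
  assumes x: "x \<in> cone_K" "y \<in> sub_H x" and x': "x' \<in> cone_K" "y' \<in> sub_H x'" and eq: "eul x y = eul x' y'"
  shows "x = x' \<and> y = y'"
proof
  have "law (rep_l2 x) = law (rep_l2 x')" using eq by (simp add: eul_def)
  then show xx: "x = x'" using law_rep_cone_K(2) x x' by metis
  show "y = y'"
  proof (rule sub_H_eqI[OF x])
    show "y' \<in> sub_H x" using x' xx by simp
    fix c :: real
    show "(LINT w|unit_lborel. indicator {..c} (rep_l2 x w) * rep_l2 y w) = (LINT w|unit_lborel. indicator {..c} (rep_l2 x w) * rep_l2 y' w)"
      using fun_cong[OF arg_cong[where f=snd, OF eq], of "{..c}"] xx by (simp add: eul_def)
  qed
qed

lemma inner_comp_rep:
  assumes u [measurable]: "u \<in> borel_measurable borel" and b: "\<And>x. \<bar>u x\<bar> \<le> B"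
  shows "sq (\<lambda>w. u (rep_l2 x w))" "inner (abs_l2 (\<lambda>w. u (rep_l2 x w))) y = (LINT w|unit_lborel. u (rep_l2 x w) * rep_l2 y w)"
proof -
  show s: "sq (\<lambda>w. u (rep_l2 x w))" by (rule U.square_integrable_bounded[of _ B]) (use b in auto)
  show "inner (abs_l2 (\<lambda>w. u (rep_l2 x w))) y = (LINT w|unit_lborel. u (rep_l2 x w) * rep_l2 y w)"
    using abs_l2_inner[OF s sq_rep_l2, of y] by simp
qed

text \<open>The momentum tests \<open>y\<close> only against indicators composed with
  \<open>x\<close>. These lie in \<open>sub_H x\<close>, where \<open>y\<close> and its projection
  cannot be told apart.\<close>

lemma eul_PH:
  assumes x: "x \<in> cone_K"
  shows "eul x (PH x y) = eul x y"
proof -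
  have "(LINT w|unit_lborel. indicator B (rep_l2 x w) * rep_l2 (PH x y) w) = (LINT w|unit_lborel. indicator B (rep_l2 x w) * rep_l2 y w)"
    if [measurable]: "B \<in> sets borel" for B :: "real set"
  proof -
    have u: "(indicator B :: real \<Rightarrow> real) \<in> borel_measurable borel" "\<bar>indicator B r :: real\<bar> \<le> 1" for r by (auto split: split_indicator)
    note i = inner_comp_rep[OF u]
    show ?thesis
      unfolding i(2)[symmetric] using PH_inner[OF comp_rep_in_sub_H[OF x u(1) i(1)], of y] by (simp add: inner_commute)
  qed
  then show ?thesis by (auto simp: eul_def)
qed

lemma eul_ex_velocity:
  assumes x: "x \<in> cone_K" and y: "y \<in> sub_H x"
  obtains u where "square_integrable (law (rep_l2 x)) u" "lagrangian_velocity (law (rep_l2 x)) u = y"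
    "eul x y = (law (rep_l2 x), momentum (law (rep_l2 x)) u)"
proof -
  define \<rho> where "\<rho> = law (rep_l2 x)"
  have \<rho>: "\<rho> \<in> P2" "rearr_l2 \<rho> = x" using law_rep_cone_K[OF x] by (auto simp: \<rho>_def)
  obtain u where u: "u \<in> borel_measurable borel" "AE w in unit_lborel. rep_l2 y w = u (rearr \<rho> w)"
    using sub_H_factor[OF sq_rearr[OF \<rho>(1)] P2_mono_rearr[OF \<rho>(1)], of y] y \<rho>(2) by (auto simp: rearr_l2_def)
  have s: "sq (\<lambda>w. u (rearr \<rho> w))"
    by (rule square_integrable_cong_AE[OF sq_rep_l2 _ u(2)]) (rule measurable_compose[OF P2_rearr_measurable[OF \<rho>(1)] u(1)])
  have su: "square_integrable \<rho> u" using u s by (simp add: square_integrable_P2_iff[OF \<rho>(1)])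
  have l: "lagrangian_velocity \<rho> u = y"
    using abs_l2_eq_iff[OF sq_rep_l2 s, of y] u(2) by (simp add: lagrangian_velocity_def comp_def)
  show ?thesis
    using that[of u] su l eul_lagrangian[OF \<rho>(1) su] \<rho>(2) by (simp add: \<rho>_def)
qed

section \<open>Momenta as signed measures\<close>

lemma momentum_signed_measure:
  assumes \<rho>: "\<rho> \<in> P2" and u: "square_integrable \<rho> u"
  shows "momentum \<rho> u \<in> signed_measures"
proof -
  interpret prob_space \<rho> using \<rho> by (simp add: P2_def)
  have s: "sets \<rho> = sets borel" using \<rho> by (simp add: P2_def)
  have i: "integrable \<rho> u" by (rule integrable_of_square_integrable[OF u])
  have "(\<lambda>n. momentum \<rho> u (A n)) sums momentum \<rho> u (\<Union>n. A n)"
    if A: "range A \<subseteq> sets borel" "disjoint_family A" for A :: "nat \<Rightarrow> real set"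
  proof -
    have As: "A n \<in> sets borel" for n using A by auto
    have si: "set_integrable \<rho> B u" if "B \<in> sets borel" for B
      using that i s unfolding set_integrable_def by (intro integrable_mult_indicator) auto
    have U: "(\<Union>i<n. A i) \<in> sets borel" "(\<Union>i. A i) \<in> sets borel" for n using As by auto
    have "(\<lambda>n. LINT x:(\<Union>i<n. A i)|\<rho>. u x) \<longlonglongrightarrow> (LINT x:(\<Union>n. \<Union>i<n. A i)|\<rho>. u x)"
      using s U si by (intro set_integral_cont_up) (auto simp: incseq_def, force)
    moreover have "(\<Union>n. \<Union>i<n. A i) = (\<Union>i. A i)" by auto
    moreover have "(LINT x:(\<Union>i<n. A i)|\<rho>. u x) = (\<Sum>i<n. LINT x:A i|\<rho>. u x)" for n
      using A(2) As s si by (intro set_integral_finite_Union) (auto simp: disjoint_family_on_def)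
    ultimately have "(\<lambda>n. LINT x:A n|\<rho>. u x) sums (LINT x:(\<Union>n. A n)|\<rho>. u x)"
      by (simp add: sums_def)
    then show ?thesis using As by (simp add: momentum_def)
  qed
  then show ?thesis by (auto simp: signed_measures_def momentum_def)
qed

lemma V2_iff_eul: "\<mu> \<in> V2 \<longleftrightarrow> (\<exists>x\<in>cone_K. \<exists>y\<in>sub_H x. \<mu> = eul x y)"
proof
  assume "\<mu> \<in> V2"
  then obtain \<rho> u where "\<rho> \<in> P2" "square_integrable \<rho> u" "\<mu> = (\<rho>, momentum \<rho> u)" by (auto simp: V2_def)
  then show "\<exists>x\<in>cone_K. \<exists>y\<in>sub_H x. \<mu> = eul x y"
    using eul_lagrangian lagrangian_velocity_in_sub_H rearr_l2_in_cone_K by blast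
next
  assume "\<exists>x\<in>cone_K. \<exists>y\<in>sub_H x. \<mu> = eul x y"
  then obtain x y where x: "x \<in> cone_K" "y \<in> sub_H x" and \<mu>: "\<mu> = eul x y" by blast
  obtain u where "square_integrable (law (rep_l2 x)) u" "eul x y = (law (rep_l2 x), momentum (law (rep_l2 x)) u)"
    using eul_ex_velocity[OF x] by blast
  then show "\<mu> \<in> V2"
    using \<mu> law_rep_cone_K(1)[OF x(1)] momentum_signed_measure by (auto simp: V2_def)
qed

text \<open>\<open>velocity\<close> picks an arbitrary density of the momentum. Injectivity of
  \<open>eul\<close> shows that every choice has the same Lagrangian velocity.\<close>

lemma velocity_eul:
  assumes x: "x \<in> cone_K" and y: "y \<in> sub_H x"
  shows "lagrangian_velocity (fst (eul x y)) (velocity (eul x y)) = y" "rearr_l2 (fst (eul x y)) = x"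
    "fst (eul x y) \<in> P2" "square_integrable (fst (eul x y)) (velocity (eul x y))"
proof -
  define \<rho> where "\<rho> = fst (eul x y)"
  have \<rho>: "\<rho> \<in> P2" "rearr_l2 \<rho> = x" using law_rep_cone_K[OF x] by (auto simp: \<rho>_def eul_def)
  then show "fst (eul x y) \<in> P2" "rearr_l2 (fst (eul x y)) = x" by (auto simp: \<rho>_def)
  have "\<exists>v. square_integrable \<rho> v \<and> snd (eul x y) = momentum \<rho> v"
    using eul_ex_velocity[OF x y] by (metis \<rho>_def fst_conv snd_conv)
  from someI_ex[OF this] have v: "square_integrable \<rho> (velocity (eul x y))" "snd (eul x y) = momentum \<rho> (velocity (eul x y))"
    unfolding velocity_def \<rho>_def[symmetric] by blast+
  then show "square_integrable (fst (eul x y)) (velocity (eul x y))" by (simp add: \<rho>_def)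
  have "eul x (lagrangian_velocity \<rho> (velocity (eul x y))) = eul x y"
    using eul_lagrangian[OF \<rho>(1) v(1)] \<rho>(2) v(2) by (simp add: \<rho>_def prod_eq_iff)
  then have "lagrangian_velocity \<rho> (velocity (eul x y)) = y"
    using eul_inj x y lagrangian_velocity_in_sub_H[OF \<rho>(1) v(1)] \<rho>(2) by metis
  then show "lagrangian_velocity (fst (eul x y)) (velocity (eul x y)) = y" by (simp add: \<rho>_def)
qed

lemma D2_eul:
  assumes x: "x \<in> cone_K" "y \<in> sub_H x" and x': "x' \<in> cone_K" "y' \<in> sub_H x'"
  shows "D2 (eul x y) (eul x' y') = sqrt ((norm (x - x'))\<^sup>2 + (norm (y - y'))\<^sup>2)"
proof -
  have s: "sq (\<lambda>w. velocity (eul a b) (rearr (fst (eul a b)) w))" if "a \<in> cone_K" "b \<in> sub_H a" for a b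
    using velocity_eul[OF that] square_integrable_P2_iff by blast
  have "(norm (y - y'))\<^sup>2 = (LINT w|unit_lborel. (velocity (eul x y) (rearr (fst (eul x y)) w) - velocity (eul x' y') (rearr (fst (eul x' y')) w))\<^sup>2)"
    using velocity_eul(1)[OF x] velocity_eul(1)[OF x'] abs_l2_norm[OF square_integrable_diff[OF s[OF x] s[OF x']]]
      abs_l2_diff[OF s[OF x] s[OF x']]
    by (simp add: lagrangian_velocity_def comp_def)
  moreover have "W2 (fst (eul x y)) (fst (eul x' y')) = norm (x - x')"
    using W2_eq_norm[OF velocity_eul(3)[OF x] velocity_eul(3)[OF x']] velocity_eul(2)[OF x] velocity_eul(2)[OF x'] by simp
  ultimately show ?thesis by (simp add: D2_def)
qed

text \<open>The supremum is attained at the part of \<open>B\<close> where \<open>u\<close> is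
  nonnegative. Since \<open>ennreal\<close> sends negative numbers to zero, the density on the right
  is the positive part of \<open>u\<close>.\<close>

lemma pos_variation_momentum:
  assumes \<rho>: "\<rho> \<in> P2" and u: "square_integrable \<rho> u"
  shows "pos_variation (momentum \<rho> u) = density \<rho> (\<lambda>x. ennreal (u x))"
proof -
  interpret prob_space \<rho> using \<rho> by (simp add: P2_def)
  have s [measurable_cong]: "sets \<rho> = sets borel" using \<rho> by (simp add: P2_def)
  have sp: "space \<rho> = UNIV" using sets_eq_imp_space_eq[OF s] by simp
  have i: "integrable \<rho> u" by (rule integrable_of_square_integrable[OF u])
  then have [measurable]: "u \<in> borel_measurable \<rho>" by simp
  let ?D = "density \<rho> (\<lambda>x. ennreal (u x))"
  have "(SUP A\<in>{A \<in> sets borel. A \<subseteq> B}. ennreal (momentum \<rho> u A)) = emeasure ?D B" if B [measurable]: "B \<in> sets borel" for B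
  proof (rule antisym)
    show "(SUP A\<in>{A \<in> sets borel. A \<subseteq> B}. ennreal (momentum \<rho> u A)) \<le> emeasure ?D B"
    proof (rule SUP_least)
      fix A assume "A \<in> {A \<in> sets borel. A \<subseteq> B}"
      then have A [measurable]: "A \<in> sets borel" and AB: "A \<subseteq> B" by auto
      have iA: "integrable \<rho> (\<lambda>x. indicator A x * u x)"
        using integrable_mult_indicator[OF _ i, of A] A s by simp
      have "momentum \<rho> u A \<le> (LINT x|\<rho>. max 0 (indicator A x * u x))"
        unfolding momentum_def set_lebesgue_integral_def using iA A by (auto intro!: integral_mono integrable_max)
      then have "ennreal (momentum \<rho> u A) \<le> (\<integral>\<^sup>+x. ennreal (max 0 (indicator A x * u x)) \<partial>\<rho>)"
        using iA by (subst nn_integral_eq_integral) (auto intro!: ennreal_leI integrable_max)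
      also have "\<dots> \<le> (\<integral>\<^sup>+x. ennreal (u x) * indicator B x \<partial>\<rho>)"
        using AB by (intro nn_integral_mono) (auto split: split_indicator)
      also have "\<dots> = emeasure ?D B" by (subst emeasure_density) (auto simp: s)
      finally show "ennreal (momentum \<rho> u A) \<le> emeasure ?D B" .
    qed
    define A where "A = {x\<in>B. 0 \<le> u x}"
    have "u -` {0..} \<inter> space \<rho> \<in> sets \<rho>" by (rule measurable_sets[of u \<rho> borel]) (use i in simp_all)
    then have "B \<inter> u -` {0..} \<in> sets borel" using B by (simp add: sp s sets.Int)
    also have "B \<inter> u -` {0..} = A" by (auto simp: A_def)
    finally have A [measurable]: "A \<in> sets borel" .
    have iA: "integrable \<rho> (\<lambda>x. indicator A x * u x)"
      using integrable_mult_indicator[OF _ i, of A] A s by simp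
    have "emeasure ?D B = (\<integral>\<^sup>+x. ennreal (u x) * indicator B x \<partial>\<rho>)" by (subst emeasure_density) (auto simp: s)
    also have "\<dots> = (\<integral>\<^sup>+x. ennreal (indicator A x * u x) \<partial>\<rho>)"
      by (rule nn_integral_cong) (auto simp: A_def ennreal_neg split: split_indicator)
    also have "\<dots> = ennreal (momentum \<rho> u A)"
      using iA A by (subst nn_integral_eq_integral) (auto simp: momentum_def set_lebesgue_integral_def A_def split: split_indicator)
    finally show "emeasure ?D B \<le> (SUP A\<in>{A \<in> sets borel. A \<subseteq> B}. ennreal (momentum \<rho> u A))"
      using A by (auto simp: A_def intro!: SUP_upper)
  qed
  then have "pos_variation (momentum \<rho> u) = measure_of UNIV (sets borel) (emeasure ?D)"
    unfolding pos_variation_def using sets.sigma_sets_eq[of "borel :: real measure"] by (intro measure_of_eq) auto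
  also have "\<dots> = ?D"
    using measure_of_of_measure[of ?D] by (simp add: sp s)
  finally show ?thesis .
qed

text \<open>Projecting \<open>y\<close> first provides a density with respect to the law, for which
  the Jordan parts are explicit. As \<open>\<phi>\<close> composed with \<open>x\<close> is in
  \<open>sub_H x\<close>, the projection drops out again at the end and the formula holds for every
  \<open>y\<close>.\<close>

lemma signed_integral_eul:
  assumes x: "x \<in> cone_K" and \<phi> [measurable]: "\<phi> \<in> borel_measurable borel" and b: "\<And>r. \<bar>\<phi> r\<bar> \<le> B"
  shows "signed_integral (snd (eul x y)) \<phi> = (LINT w|unit_lborel. \<phi> (rep_l2 x w) * rep_l2 y w)"
proof -
  define \<rho> where "\<rho> = law (rep_l2 x)"
  have \<rho>: "\<rho> \<in> P2" using law_rep_cone_K[OF x] by (simp add: \<rho>_def)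
  interpret prob_space \<rho> using \<rho> by (simp add: P2_def)
  have s [measurable_cong]: "sets \<rho> = sets borel" using \<rho> by (simp add: P2_def)
  obtain u where u: "square_integrable \<rho> u" "lagrangian_velocity \<rho> u = PH x y" "eul x (PH x y) = (\<rho>, momentum \<rho> u)"
    using eul_ex_velocity[OF x PH_mem] unfolding \<rho>_def by blast
  have i: "integrable \<rho> u" by (rule integrable_of_square_integrable[OF u(1)])
  then have um [measurable]: "u \<in> borel_measurable \<rho>" by simp
  have um' [measurable]: "u \<in> borel_measurable borel" using um by (simp cong: measurable_cong_sets add: s)
  have \<phi>\<rho> [simp]: "\<phi> \<in> borel_measurable \<rho>"
    unfolding measurable_cong_sets[OF s refl] by (rule \<phi>)
  have neg: "(\<lambda>B. - momentum \<rho> u B) = momentum \<rho> (\<lambda>x. - u x)"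
    by (rule ext) (simp add: momentum_def set_lebesgue_integral_def)
  have d: "density \<rho> (\<lambda>x. ennreal (v x)) = density \<rho> (\<lambda>x. ennreal (max 0 (v x)))" for v :: "real \<Rightarrow> real"
  proof -
    have "(\<lambda>x. ennreal (v x)) = (\<lambda>x. ennreal (max 0 (v x)))" by (auto simp: max_def ennreal_neg)
    then show ?thesis by (simp only:)
  qed
  have int: "(LINT x|density \<rho> (\<lambda>x. ennreal (v x)). \<phi> x) = (LINT x|\<rho>. max 0 (v x) * \<phi> x)" if [measurable]: "v \<in> borel_measurable \<rho>" for v
    by (subst d, subst integral_density) auto
  have im: "integrable \<rho> (\<lambda>x. max 0 (v x) * \<phi> x)" if v: "integrable \<rho> v" for v
  proof (rule Bochner_Integration.integrable_bound)
    show "integrable \<rho> (\<lambda>x. B * max 0 (v x))" using v by (intro integrable_mult_right integrable_max) auto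
    have "0 \<le> B" using b[of 0] by linarith
    have "\<bar>max 0 (v x) * \<phi> x\<bar> \<le> \<bar>B * max 0 (v x)\<bar>" for x
    proof -
      have "\<bar>\<phi> x\<bar> \<le> \<bar>B\<bar>" using b[of x] \<open>0 \<le> B\<close> by simp
      then have "\<bar>max 0 (v x)\<bar> * \<bar>\<phi> x\<bar> \<le> \<bar>max 0 (v x)\<bar> * \<bar>B\<bar>" by (rule mult_left_mono) simp
      then show ?thesis by (simp add: abs_mult mult.commute)
    qed
    then show "AE x in \<rho>. norm (max 0 (v x) * \<phi> x) \<le> norm (B * max 0 (v x))" by simp
    show "(\<lambda>x. max 0 (v x) * \<phi> x) \<in> borel_measurable \<rho>"
      using v by (intro borel_measurable_times borel_measurable_max) simp_all
  qed
  have "signed_integral (snd (eul x y)) \<phi> = signed_integral (momentum \<rho> u) \<phi>"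
    using u(3) eul_PH[OF x, of y] by (metis snd_conv)
  also have "\<dots> = (LINT x|\<rho>. max 0 (u x) * \<phi> x) - (LINT x|\<rho>. max 0 (- u x) * \<phi> x)"
    unfolding signed_integral_def neg pos_variation_momentum[OF \<rho> u(1)] pos_variation_momentum[OF \<rho> square_integrable_minus[OF u(1)]]
    by (simp add: int)
  also have "\<dots> = (LINT x|\<rho>. u x * \<phi> x)"
    unfolding Bochner_Integration.integral_diff[OF im[OF i] im[OF Bochner_Integration.integrable_minus[OF i]], symmetric]
    by (rule Bochner_Integration.integral_cong) (auto simp: max_def)
  also have "\<dots> = (LINT w|unit_lborel. u (rep_l2 x w) * \<phi> (rep_l2 x w))"
    unfolding \<rho>_def by (rule integral_distr) measurable
  also have "\<dots> = (LINT w|unit_lborel. \<phi> (rep_l2 x w) * rep_l2 (PH x y) w)"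
  proof (rule integral_cong_AE)
    have "AE w in unit_lborel. rep_l2 x w = rearr \<rho> w"
      using law_rep_cone_K(2)[OF x] rep_abs_l2[OF sq_rearr[OF \<rho>]] by (simp add: rearr_l2_def \<rho>_def)
    moreover have "AE w in unit_lborel. rep_l2 (PH x y) w = u (rearr \<rho> w)"
      using u(1,2) rep_abs_l2[of "\<lambda>w. u (rearr \<rho> w)"] square_integrable_P2_iff[OF \<rho>]
      by (auto simp: lagrangian_velocity_def comp_def)
    ultimately show "AE w in unit_lborel. u (rep_l2 x w) * \<phi> (rep_l2 x w) = \<phi> (rep_l2 x w) * rep_l2 (PH x y) w"
      by eventually_elim simp
  qed measurable
  also have "\<dots> = (LINT w|unit_lborel. \<phi> (rep_l2 x w) * rep_l2 y w)"
  proof -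
    note i = inner_comp_rep[OF \<phi> b]
    show ?thesis
      unfolding i(2)[symmetric] using PH_inner[OF comp_rep_in_sub_H[OF x \<phi> i(1)], of y] by (simp add: inner_commute)
  qed
  finally show ?thesis .
qed

text \<open>Cutoffs are bounded and continuous, so the two limits agree on them; passing from
  cutoffs to half-lines separates the elements of \<open>sub_H x\<close>.\<close>

lemma weak_conv_signed_unique:
  assumes x: "x \<in> cone_K" and y: "y \<in> sub_H x" and z: "z \<in> sub_H x"
    and 1: "weak_conv_signed M (snd (eul x y))" and 2: "weak_conv_signed M (snd (eul x z))"
  shows "y = z"
proof -
  define d where "d = y - z"
  have dH: "d \<in> sub_H x" unfolding d_def using y z by (rule subspace_diff[OF subspace_sub_H])
  have cut: "(LINT w|unit_lborel. rep_l2 d w * cutoff k c (rep_l2 x w)) = 0" for k c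
  proof -
    have b: "\<bar>cutoff k c r\<bar> \<le> 1" for r using cutoff_bounds[of k c r] by simp
    have "bounded (range (cutoff k c))" using b by (auto intro!: boundedI[of _ 1])
    then have "signed_integral (snd (eul x y)) (cutoff k c) = signed_integral (snd (eul x z)) (cutoff k c)"
      using 1 2 continuous_cutoff[of k c] LIMSEQ_unique unfolding weak_conv_signed_def by blast
    then have "inner (abs_l2 (\<lambda>w. cutoff k c (rep_l2 x w))) y = inner (abs_l2 (\<lambda>w. cutoff k c (rep_l2 x w))) z"
      by (simp add: signed_integral_eul[OF x cutoff_measurable b] inner_comp_rep[OF cutoff_measurable b])
    then have "inner (abs_l2 (\<lambda>w. cutoff k c (rep_l2 x w))) d = 0" by (simp add: d_def inner_diff_right)
    then show ?thesis by (simp add: inner_comp_rep[OF cutoff_measurable b] mult.commute)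
  qed
  have "d = 0"
  proof (rule sub_H_eqI[OF x dH subspace_0[OF subspace_sub_H]])
    fix c
    have "(LINT w|unit_lborel. rep_l2 d w * indicator {..c} (rep_l2 x w)) = 0"
      by (rule integral_indicator_eq_zero_of_cutoff) (auto simp: cut intro: U.integrable_of_square_integrable)
    moreover have "(LINT w|unit_lborel. indicator {..c} (rep_l2 x w) * rep_l2 0 w) = 0"
    proof -
      have "AE w in unit_lborel. rep_l2 0 w = 0"
        using rep_abs_l2[OF U.square_integrable_const[of 0]] by (simp add: abs_l2_zero)
      then have "AE w in unit_lborel. indicator {..c} (rep_l2 x w) * rep_l2 0 w = 0" by eventually_elim simp
      then show ?thesis by (rule integral_eq_zero_AE)
    qed
    ultimately show "(LINT w|unit_lborel. indicator {..c} (rep_l2 x w) * rep_l2 d w) = (LINT w|unit_lborel. indicator {..c} (rep_l2 x w) * rep_l2 0 w)"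
      by (simp add: mult.commute)
  qed
  then show ?thesis by (simp add: d_def)
qed

(* The velocities may converge only in L2, but along subsequences the positions converge a.e. *)
lemma weak_conv_signed_eul:
  assumes x: "\<And>n. x n \<in> cone_K" "x' \<in> cone_K" and lx: "x \<longlonglongrightarrow> x'" and ly: "y \<longlonglongrightarrow> y'"
  shows "weak_conv_signed (\<lambda>n. snd (eul (x n) (y n))) (snd (eul x' y'))"
  unfolding weak_conv_signed_def
proof (intro allI impI, elim conjE)
  fix \<phi> :: "real \<Rightarrow> real" assume c: "continuous_on UNIV \<phi>" and "bounded (range \<phi>)"
  then obtain B where b: "\<And>r. \<bar>\<phi> r\<bar> \<le> B" by (auto simp: bounded_iff)
  have \<phi>m [measurable]: "\<phi> \<in> borel_measurable borel" by (rule borel_measurable_continuous_onI[OF c])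
  define S where "S n = (LINT w|unit_lborel. \<phi> (rep_l2 (x n) w) * rep_l2 (y n) w)" for n
  define T where "T n = (LINT w|unit_lborel. \<phi> (rep_l2 (x n) w) * rep_l2 y' w)" for n
  define L where "L = (LINT w|unit_lborel. \<phi> (rep_l2 x' w) * rep_l2 y' w)"
  have nb: "norm (abs_l2 (\<lambda>w. \<phi> (rep_l2 v w))) \<le> B" for v
  proof -
    have "(norm (abs_l2 (\<lambda>w. \<phi> (rep_l2 v w))))\<^sup>2 = (LINT w|unit_lborel. (\<phi> (rep_l2 v w))\<^sup>2)"
      by (rule abs_l2_norm[OF inner_comp_rep(1)[OF \<phi>m b]])
    also have "\<dots> \<le> (LINT w|unit_lborel. B\<^sup>2)"
    proof (rule integral_mono)
      show "integrable unit_lborel (\<lambda>w. (\<phi> (rep_l2 v w))\<^sup>2)"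
        using inner_comp_rep(1)[OF \<phi>m b, where x=v] by (auto simp: square_integrable_def)
      show "(\<phi> (rep_l2 v w))\<^sup>2 \<le> B\<^sup>2" for w using power_mono[OF b[of "rep_l2 v w"], of 2] by simp
    qed simp
    also have "\<dots> = B\<^sup>2" using U.prob_space by simp
    finally show ?thesis by (rule power2_le_imp_le) (use b[of 0] in linarith)
  qed
  have ST: "(\<lambda>n. S n - T n) \<longlonglongrightarrow> 0"
  proof (rule Lim_null_comparison)
    have "norm (S n - T n) \<le> B * norm (y n - y')" for n
    proof -
      have "S n - T n = inner (abs_l2 (\<lambda>w. \<phi> (rep_l2 (x n) w))) (y n - y')"
        by (simp add: S_def T_def inner_diff_right inner_comp_rep[OF \<phi>m b])
      also have "norm \<dots> \<le> norm (abs_l2 (\<lambda>w. \<phi> (rep_l2 (x n) w))) * norm (y n - y')"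
        by (simp add: Cauchy_Schwarz_ineq2)
      also have "\<dots> \<le> B * norm (y n - y')" by (intro mult_right_mono nb) simp
      finally show ?thesis .
    qed
    then show "\<forall>\<^sub>F n in sequentially. norm (S n - T n) \<le> B * norm (y n - y')" by simp
    have "(\<lambda>n. norm (y n - y')) \<longlonglongrightarrow> 0" using ly by (simp add: tendsto_norm_zero_iff LIM_zero)
    then show "(\<lambda>n. B * norm (y n - y')) \<longlonglongrightarrow> 0" by (rule tendsto_mult_right_zero)
  qed
  have TL: "T \<longlonglongrightarrow> L"
  proof (rule ccontr)
    assume "\<not> T \<longlonglongrightarrow> L"
    then obtain e where e: "e > 0" "\<And>N. \<exists>n\<ge>N. e \<le> dist (T n) L"
      unfolding lim_sequentially by (metis linorder_not_less)
    then obtain s where s: "strict_mono (s :: nat \<Rightarrow> nat)" "\<And>n. e \<le> dist (T (s n)) L"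
      using infinite_enumerate[of "{n. e \<le> dist (T n) L}"] by (auto simp: infinite_nat_iff_unbounded_le)
    have "(\<lambda>n. x (s n)) \<longlonglongrightarrow> x'" using LIMSEQ_subseq_LIMSEQ[OF lx s(1)] by (simp add: comp_def)
    then obtain r where r: "strict_mono (r :: nat \<Rightarrow> nat)" "AE w in unit_lborel. (\<lambda>n. rep_l2 (x (s (r n))) w) \<longlonglongrightarrow> rep_l2 x' w"
      using l2_tendsto_AE_subseq[of "\<lambda>n. x (s n)" x'] by auto
    have "(\<lambda>n. T (s (r n))) \<longlonglongrightarrow> L" unfolding T_def L_def
    proof (rule integral_dominated_convergence[where w="\<lambda>w. B * \<bar>rep_l2 y' w\<bar>"])
      show "AE w in unit_lborel. (\<lambda>n. \<phi> (rep_l2 (x (s (r n))) w) * rep_l2 y' w) \<longlonglongrightarrow> \<phi> (rep_l2 x' w) * rep_l2 y' w"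
        using r(2)
      proof eventually_elim
        case (elim w)
        have "isCont \<phi> (rep_l2 x' w)" using c by (simp add: continuous_on_eq_continuous_at)
        then show ?case by (intro tendsto_mult tendsto_const isCont_tendsto_compose[OF _ elim])
      qed
      show "AE w in unit_lborel. norm (\<phi> (rep_l2 (x (s (r n))) w) * rep_l2 y' w) \<le> B * \<bar>rep_l2 y' w\<bar>" for n
        by (intro AE_I2) (auto simp: abs_mult intro!: mult_right_mono b)
    qed (simp_all add: U.integrable_of_square_integrable)
    then have "\<forall>\<^sub>F n in sequentially. dist (T (s (r n))) L < e" using e(1) by (rule tendstoD)
    then show False using s(2) by (auto simp: eventually_sequentially linorder_not_less[symmetric])
  qed
  have "S \<longlonglongrightarrow> L" using tendsto_add[OF ST TL] by simp
  then show "(\<lambda>n. signed_integral (snd (eul (x n) (y n))) \<phi>) \<longlonglongrightarrow> signed_integral (snd (eul x' y')) \<phi>"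
    by (simp add: signed_integral_eul[OF _ \<phi>m b] x S_def[abs_def] L_def)
qed

section \<open>Sticky particles\<close>

definition cum :: "(nat \<Rightarrow> real) \<Rightarrow> nat \<Rightarrow> real" where
  "cum m k = (\<Sum>i<k. m i)"

text \<open>Counting the cells that end at or before \<open>w\<close> makes monotonicity in
  \<open>w\<close> immediate. For \<open>w\<close> in the unit interval the count is the index of
  the half-open cell that contains \<open>w\<close>.\<close>

definition idx :: "nat \<Rightarrow> (nat \<Rightarrow> real) \<Rightarrow> real \<Rightarrow> nat" where
  "idx N m w = card {i. i < N \<and> cum m (Suc i) \<le> w}"

definition step :: "nat \<Rightarrow> (nat \<Rightarrow> real) \<Rightarrow> (nat \<Rightarrow> real) \<Rightarrow> l2" where
  "step N m c = abs_l2 (\<lambda>w. c (idx N m w))"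

locale masses =
  fixes N :: nat and m :: "nat \<Rightarrow> real"
  assumes m_pos: "\<And>i. i < N \<Longrightarrow> 0 < m i" and m_sum: "(\<Sum>i<N. m i) = 1"
begin

lemma cum_mono: "i \<le> j \<Longrightarrow> j \<le> N \<Longrightarrow> cum m i \<le> cum m j"
  unfolding cum_def by (rule sum_mono2) (auto intro!: less_imp_le[OF m_pos])

lemma cum_Suc: "cum m (Suc i) = cum m i + m i"
  by (simp add: cum_def)

lemma cum_0: "cum m 0 = 0" and cum_N: "cum m N = 1"
  by (simp_all add: cum_def m_sum)

lemma cum_bounds: "i \<le> N \<Longrightarrow> 0 \<le> cum m i \<and> cum m i \<le> 1"
  using cum_mono[of 0 i] cum_mono[of i N] by (simp add: cum_0 cum_N)

lemma idx_eq:
  assumes "i < N" "cum m i \<le> w" "w < cum m (Suc i)"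
  shows "idx N m w = i"
proof -
  have "{k. k < N \<and> cum m (Suc k) \<le> w} = {..<i}"
  proof (rule set_eqI)
    fix k
    show "k \<in> {k. k < N \<and> cum m (Suc k) \<le> w} \<longleftrightarrow> k \<in> {..<i}"
    proof (cases "k < i")
      case True
      then have "cum m (Suc k) \<le> cum m i" using assms(1) by (intro cum_mono) auto
      then show ?thesis using True assms by auto
    next
      case False
      then have "k < N \<Longrightarrow> cum m (Suc i) \<le> cum m (Suc k)" by (intro cum_mono) auto
      then show ?thesis using False assms by auto
    qed
  qed
  then show ?thesis by (simp add: idx_def)
qed

lemma idx_bounds:
  assumes "0 < w" "w < 1"
  shows "idx N m w < N" "cum m (idx N m w) \<le> w" "w < cum m (Suc (idx N m w))"
proof -
  define i where "i = (LEAST k. w < cum m k)"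
  have ex: "w < cum m N" using assms cum_N by simp
  have i: "w < cum m i" unfolding i_def using ex by (rule LeastI)
  have "i \<le> N" unfolding i_def using ex by (rule Least_le)
  have "i \<noteq> 0" using i assms by (auto simp: cum_0 intro: ccontr)
  then obtain k where k: "i = Suc k" by (cases i) auto
  have "\<not> w < cum m k" using not_less_Least[of k "\<lambda>k. w < cum m k"] k unfolding i_def[symmetric] by simp
  then have "k < N" "cum m k \<le> w" "w < cum m (Suc k)" using i k \<open>i \<le> N\<close> by auto
  then show "idx N m w < N" "cum m (idx N m w) \<le> w" "w < cum m (Suc (idx N m w))"
    using idx_eq[of k w] by auto
qed

lemma idx_mono: "v \<le> w \<Longrightarrow> idx N m v \<le> idx N m w"
  unfolding idx_def by (rule card_mono) auto

definition blk :: "nat \<Rightarrow> real set" where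
  "blk i = {w\<in>{0<..<1}. idx N m w = i}"

lemma blk_eq: "i < N \<Longrightarrow> blk i = {0<..<1} \<inter> {cum m i..<cum m (Suc i)}"
  using idx_eq idx_bounds by (auto simp: blk_def)

lemma blk_sets: "i < N \<Longrightarrow> blk i \<in> sets unit_lborel"
  by (auto simp: blk_eq sets_unit_lborel)

lemma measure_blk: "i < N \<Longrightarrow> measure unit_lborel (blk i) = m i"
proof -
  assume i: "i < N"
  have b: "0 \<le> cum m i" "cum m (Suc i) \<le> 1" "cum m i \<le> cum m (Suc i)"
    using i cum_bounds[of i] cum_bounds[of "Suc i"] m_pos[OF i] by (auto simp: cum_Suc)
  have "AE w in unit_lborel. w \<in> blk i \<longleftrightarrow> w \<in> {cum m i<..<cum m (Suc i)}"
    using AE_unit_lborel_neq[of "cum m i"] AE_space[of unit_lborel]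
    by eventually_elim (auto simp: blk_eq i)
  then have "measure unit_lborel (blk i) = measure unit_lborel {cum m i<..<cum m (Suc i)}"
    using b blk_sets[OF i] by (intro measure_eq_AE) (simp_all add: sets_unit_lborel subset_iff)
  then show ?thesis
    using emeasure_unit_lborel_interval[OF b(1,3,2)] m_pos[OF i] by (simp add: measure_def cum_Suc)
qed

lemma idx_comp_eq_sum:
  fixes c :: "nat \<Rightarrow> real"
  assumes "0 < w" "w < 1"
  shows "c (idx N m w) = (\<Sum>i<N. c i * indicator (blk i) w)"
proof -
  have "(\<Sum>i<N. c i * indicator (blk i) w) = (\<Sum>i<N. if i = idx N m w then c i else 0)"
    using assms by (intro sum.cong) (auto simp: blk_def)
  then show ?thesis using idx_bounds(1)[OF assms] by simp
qed

lemma idx_comp_measurable [measurable]: "(\<lambda>w. c (idx N m w)) \<in> borel_measurable unit_lborel" for c :: "nat \<Rightarrow> real"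
proof -
  have "(\<lambda>w. \<Sum>i<N. c i * indicator (blk i) w) \<in> borel_measurable unit_lborel"
    using blk_sets by (intro borel_measurable_sum borel_measurable_times) auto
  then show ?thesis
    by (rule measurable_cong[THEN iffD2, rotated])
      (simp only: space_unit_lborel greaterThanLessThan_iff idx_comp_eq_sum)
qed

lemma sq_idx_comp: "sq (\<lambda>w. c (idx N m w))"
proof (rule U.square_integrable_bounded[of _ "\<Sum>i<N. \<bar>c i\<bar>"])
  show "AE w in unit_lborel. \<bar>c (idx N m w)\<bar> \<le> (\<Sum>i<N. \<bar>c i\<bar>)"
    using idx_bounds(1) by (intro AE_I2 member_le_sum) auto
qed measurable

lemma integral_idx_comp:
  fixes z :: "real \<Rightarrow> real"
  assumes z: "integrable unit_lborel z"
  shows "(LINT w|unit_lborel. c (idx N m w) * z w) = (\<Sum>i<N. c i * (LINT w|unit_lborel. indicator (blk i) w * z w))"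
proof -
  have i: "integrable unit_lborel (\<lambda>w. indicator (blk i) w * z w)" if "i < N" for i
    using integrable_mult_indicator[OF blk_sets[OF that] z] by simp
  have "(LINT w|unit_lborel. c (idx N m w) * z w) = (LINT w|unit_lborel. (\<Sum>i<N. c i * (indicator (blk i) w * z w)))"
    by (rule Bochner_Integration.integral_cong)
      (simp_all only: space_unit_lborel greaterThanLessThan_iff idx_comp_eq_sum sum_distrib_right mult.assoc)
  also have "\<dots> = (\<Sum>i<N. c i * (LINT w|unit_lborel. indicator (blk i) w * z w))"
    using i by (subst Bochner_Integration.integral_sum) auto
  finally show ?thesis .
qed

lemma inner_step_step: "inner (step N m c) (step N m d) = (\<Sum>i<N. m i * c i * d i)"
proof -
  have "inner (step N m c) (step N m d) = (LINT w|unit_lborel. (\<lambda>i. c i * d i) (idx N m w) * 1)"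
    by (simp add: step_def abs_l2_inner sq_idx_comp)
  also have "\<dots> = (\<Sum>i<N. c i * d i * (LINT w|unit_lborel. indicator (blk i) w * 1))"
    by (rule integral_idx_comp) simp
  also have "\<dots> = (\<Sum>i<N. m i * c i * d i)"
  proof (rule sum.cong[OF refl])
    fix i assume "i \<in> {..<N}"
    then have "(LINT w|unit_lborel. indicator (blk i) w * 1) = m i"
      using measure_blk[of i] sets.sets_into_space[OF blk_sets[of i]] by (simp add: Int_absorb2)
    then show "c i * d i * (LINT w|unit_lborel. indicator (blk i) w * 1) = m i * c i * d i" by simp
  qed
  finally show ?thesis .
qed

lemma step_add: "step N m c + step N m d = step N m (\<lambda>i. c i + d i)"
  and step_diff: "step N m c - step N m d = step N m (\<lambda>i. c i - d i)"
  and step_scaleR: "r *\<^sub>R step N m c = step N m (\<lambda>i. r * c i)"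
  unfolding step_def by (simp_all add: abs_l2_add abs_l2_diff abs_l2_scaleR sq_idx_comp)

text \<open>Every cell has positive measure, so none can hide in a null set.\<close>

lemma AE_idx_iff: "(AE w in unit_lborel. P (idx N m w)) \<longleftrightarrow> (\<forall>i<N. P i)"
proof
  assume ae: "AE w in unit_lborel. P (idx N m w)"
  show "\<forall>i<N. P i"
  proof (intro allI impI, rule ccontr)
    fix i assume i: "i < N" and "\<not> P i"
    with ae have "AE w in unit_lborel. w \<notin> blk i" by (auto simp: blk_def elim!: eventually_mono)
    then have "emeasure unit_lborel (blk i) = 0"
      by (subst (asm) AE_iff_measurable[of "blk i"]) (auto simp: blk_sets i, auto simp: blk_def)
    then show False using measure_blk[OF i] m_pos[OF i] by (simp add: measure_def)
  qed
next
  assume "\<forall>i<N. P i"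
  then show "AE w in unit_lborel. P (idx N m w)" using idx_bounds(1) by (intro AE_I2) simp
qed

lemma step_eq_iff: "step N m c = step N m d \<longleftrightarrow> (\<forall>i<N. c i = d i)"
  unfolding step_def abs_l2_eq_iff[OF sq_idx_comp sq_idx_comp] by (rule AE_idx_iff)

lemma step_cong: "(\<And>i. i < N \<Longrightarrow> c i = d i) \<Longrightarrow> step N m c = step N m d"
  by (simp add: step_eq_iff)

lemma mono_idx_comp:
  fixes c :: "nat \<Rightarrow> real"
  assumes "\<And>i j. i \<le> j \<Longrightarrow> j < N \<Longrightarrow> c i \<le> c j"
  shows "mono_on {0<..<1} (\<lambda>w. c (idx N m w))"
  using idx_bounds(1) by (intro mono_onI assms idx_mono) auto

lemma step_in_cone_K_iff: "step N m c \<in> cone_K \<longleftrightarrow> (\<forall>i j. i \<le> j \<longrightarrow> j < N \<longrightarrow> c i \<le> c j)"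
proof
  assume "step N m c \<in> cone_K"
  then obtain f where f: "sq f" "mono_on {0<..<1} f" "step N m c = abs_l2 f" using cone_K_cases by blast
  then have ae: "AE w in unit_lborel. c (idx N m w) = f w"
    by (simp add: step_def abs_l2_eq_iff sq_idx_comp)
  show "\<forall>i j. i \<le> j \<longrightarrow> j < N \<longrightarrow> c i \<le> c j"
  proof (intro allI impI)
    fix i j assume ij: "i \<le> j" "j < N"
    have ex: "\<exists>w\<in>blk k. c k = f w" if k: "k < N" for k
    proof (rule ccontr)
      assume no: "\<not> (\<exists>w\<in>blk k. c k = f w)"
      have "AE w in unit_lborel. idx N m w \<noteq> k"
        using ae AE_space 
      proof eventually_elim
        case (elim w)
        then show ?case using no by (auto simp: blk_def)
      qed
      then show False using AE_idx_iff[of "\<lambda>i. i \<noteq> k"] k by auto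
    qed
    show "c i \<le> c j"
    proof (cases "i = j")
      case False
      obtain w w' where w: "w \<in> blk i" "c i = f w" "w' \<in> blk j" "c j = f w'" using ex[of i] ex[of j] ij by auto
      have "w \<le> w'"
      proof (rule ccontr)
        assume "\<not> w \<le> w'"
        then have "idx N m w' \<le> idx N m w" by (intro idx_mono) auto
        then show False using w False ij by (auto simp: blk_def)
      qed
      then show ?thesis using w f(2) by (auto simp: blk_def mono_on_def)
    qed simp
  qed
qed (auto simp: step_def intro!: cone_KI sq_idx_comp mono_idx_comp)

lemma step_in_sub_H_step_iff:
  assumes x: "\<And>i j. i \<le> j \<Longrightarrow> j < N \<Longrightarrow> x i \<le> x j"
  shows "step N m c \<in> sub_H (step N m x) \<longleftrightarrow> (\<forall>i<N. \<forall>j<N. x i = x j \<longrightarrow> c i = c j)"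
proof -
  have mx: "mono_on {0<..<1} (\<lambda>w. x (idx N m w))" by (rule mono_idx_comp) (rule x)
  show ?thesis
  proof
    assume "step N m c \<in> sub_H (step N m x)"
    then have "step N m c \<in> sub_H (abs_l2 (\<lambda>w. x (idx N m w)))" by (simp add: step_def)
    then obtain u where u: "AE w in unit_lborel. rep_l2 (step N m c) w = u (x (idx N m w))"
      using sub_H_factor[OF sq_idx_comp mx] by blast
    have "AE w in unit_lborel. rep_l2 (step N m c) w = c (idx N m w)"
      unfolding step_def by (rule rep_abs_l2[OF sq_idx_comp])
    with u have "AE w in unit_lborel. c (idx N m w) = u (x (idx N m w))" by eventually_elim simp
    then have "\<forall>i<N. c i = u (x i)" by (simp add: AE_idx_iff[of "\<lambda>i. c i = u (x i)"])
    then show "\<forall>i<N. \<forall>j<N. x i = x j \<longrightarrow> c i = c j" by simp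
  next
    assume c: "\<forall>i<N. \<forall>j<N. x i = x j \<longrightarrow> c i = c j"
    define u where "u r = c (SOME i. i < N \<and> x i = r)" for r
    have u: "c i = u (x i)" if i: "i < N" for i
    proof -
      have "(SOME j. j < N \<and> x j = x i) < N \<and> x (SOME j. j < N \<and> x j = x i) = x i"
        by (rule someI[of _ i]) (simp add: i)
      then show ?thesis unfolding u_def
        by (intro c[rule_format] i) (elim conjE, assumption, elim conjE, rule sym)
    qed
    have "step N m c = step N m (\<lambda>i. u (x i))" using u by (rule step_cong)
    also have "\<dots> \<in> sub_H (step N m x)"
      unfolding step_def
      using comp_in_sub_H[OF sq_idx_comp mx sq_idx_comp[of "\<lambda>i. u (x i)"]] .
    finally show "step N m c \<in> sub_H (step N m x)" .
  qed
qed

text \<open>The values on the cells are pairwise different, so \<open>sub_H Grid\<close> is exactly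
  the space of step functions over the partition.\<close>

abbreviation "Grid \<equiv> step N m real"

lemma Grid_mem: "Grid \<in> cone_K"
  by (simp add: step_in_cone_K_iff)

lemma step_in_sub_H_Grid: "step N m c \<in> sub_H Grid"
  by (subst step_in_sub_H_step_iff) auto

lemma sub_H_Grid_cases:
  assumes "y \<in> sub_H Grid"
  obtains c where "y = step N m c"
proof -
  have "mono_on {0<..<1} (\<lambda>w. real (idx N m w))" by (rule mono_idx_comp) simp
  then obtain u where u: "AE w in unit_lborel. rep_l2 y w = u (real (idx N m w))"
    using sub_H_factor[OF sq_idx_comp[of real]] assms[unfolded step_def] by blast
  have "y = step N m (\<lambda>i. u (real i))"
    unfolding step_def using abs_l2_eq_iff[OF sq_rep_l2 sq_idx_comp[of "\<lambda>i. u (real i)"], of y] u by simp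
  then show ?thesis by (rule that)
qed

text \<open>Averaging \<open>z\<close> over the cells keeps it in the cone and leaves its inner
  product with a step function unchanged. Polarity is thus reduced to finite monotone
  sequences.\<close>

lemma step_polar:
  assumes "\<And>c. (\<And>i j. i \<le> j \<Longrightarrow> j < N \<Longrightarrow> c i \<le> c j) \<Longrightarrow> (\<Sum>i<N. m i * \<xi> i * c i) \<le> 0"
    and z: "z \<in> cone_K"
  shows "inner (step N m \<xi>) z \<le> 0"
proof -
  obtain c where c: "PH Grid z = step N m c" using sub_H_Grid_cases[OF PH_mem] by blast
  have "step N m c \<in> cone_K" using PH_cone_K[OF Grid_mem z] c by simp
  then have "(\<Sum>i<N. m i * \<xi> i * c i) \<le> 0" unfolding step_in_cone_K_iff by (intro assms) auto
  moreover have "inner (step N m \<xi>) z = inner (PH Grid z) (step N m \<xi>)"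
    using PH_inner[OF step_in_sub_H_Grid, of z \<xi>] by (simp add: inner_commute)
  ultimately show ?thesis unfolding c inner_step_step by (simp add: mult.commute mult.left_commute)
qed

lemma law_step:
  fixes x :: "nat \<Rightarrow> real"
  shows "law (\<lambda>w. x (idx N m w)) = distr (point_measure {..<N} (\<lambda>i. ennreal (m i))) borel x"
proof (rule measure_eqI)
  fix B assume "B \<in> sets (law (\<lambda>w. x (idx N m w)))"
  then have B [measurable]: "B \<in> sets borel" by simp
  have "measure (law (\<lambda>w. x (idx N m w))) B = (LINT w|unit_lborel. indicator B (x (idx N m w)) * 1)"
  proof -
    have "measure (law (\<lambda>w. x (idx N m w))) B = (LINT r|law (\<lambda>w. x (idx N m w)). indicator B r)" by simp
    also have "\<dots> = (LINT w|unit_lborel. indicator B (x (idx N m w)))" by (rule integral_distr) (simp_all add: idx_comp_measurable borel_measurable_indicator)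
    finally show ?thesis by simp
  qed
  also have "\<dots> = (\<Sum>i<N. indicator B (x i) * (LINT w|unit_lborel. indicator (blk i) w * 1))"
    by (rule integral_idx_comp) simp
  also have "\<dots> = (\<Sum>i<N. indicator B (x i) * m i)"
    using measure_blk sets.sets_into_space[OF blk_sets] by (intro sum.cong) (auto simp: Int_absorb2)
  also have "\<dots> = (\<Sum>i\<in>{i\<in>{..<N}. x i \<in> B}. m i)"
    unfolding sum.inter_filter[OF finite_lessThan] by (rule sum.cong) (auto split: split_indicator)
  finally have 1: "measure (law (\<lambda>w. x (idx N m w))) B = (\<Sum>i\<in>{i\<in>{..<N}. x i \<in> B}. m i)" .
  interpret L: prob_space "law (\<lambda>w. x (idx N m w))" by (rule U.prob_space_distr) measurable
  have "emeasure (distr (point_measure {..<N} (\<lambda>i. ennreal (m i))) borel x) B = emeasure (point_measure {..<N} (\<lambda>i. ennreal (m i))) {i\<in>{..<N}. x i \<in> B}"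
    by (subst emeasure_distr) (auto simp: space_point_measure intro!: arg_cong2[where f=emeasure])
  also have "\<dots> = (\<Sum>i\<in>{i\<in>{..<N}. x i \<in> B}. ennreal (m i))"
    by (rule emeasure_point_measure_finite) auto
  also have "\<dots> = ennreal (\<Sum>i\<in>{i\<in>{..<N}. x i \<in> B}. m i)"
    by (rule sum_ennreal) (auto intro: less_imp_le m_pos)
  finally show "emeasure (law (\<lambda>w. x (idx N m w))) B = emeasure (distr (point_measure {..<N} (\<lambda>i. ennreal (m i))) borel x) B"
    by (simp only: 1 L.emeasure_eq_measure)
qed simp

lemma eul_step: "eul (step N m x) (step N m v) = discrete_state N m x v"
proof -
  have e: "(LINT w|unit_lborel. indicator B (x (idx N m w)) * v (idx N m w)) = (\<Sum>i<N. m i * v i * indicator B (x i))" for B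
  proof -
    have "(LINT w|unit_lborel. indicator B (x (idx N m w)) * v (idx N m w)) = inner (step N m (\<lambda>i. indicator B (x i))) (step N m v)"
      by (simp add: step_def abs_l2_inner sq_idx_comp sq_idx_comp[of "\<lambda>i. indicator B (x i)"])
    then show ?thesis by (simp add: inner_step_step mult.commute mult.left_commute)
  qed
  show ?thesis
    unfolding discrete_state_def step_def eul_abs[OF sq_idx_comp sq_idx_comp] law_step e ..
qed

text \<open>The deviation of \<open>a i\<close> from its cluster average is a weighted sum of the
  differences \<open>a i - a j\<close>. Exchanging the indices and adding gives products of
  differences, whose signs can be read off pair by pair: Chebyshev's identity on each
  cluster.\<close>

lemma sum_avg_pairs:
  fixes x a z :: "nat \<Rightarrow> real"
  defines "J \<equiv> \<lambda>i. {j. j < N \<and> x j = x i}"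
  shows "2 * (\<Sum>i<N. m i * (a i - (\<Sum>j\<in>J i. m j * a j) / (\<Sum>j\<in>J i. m j)) * z i)
    = (\<Sum>i<N. \<Sum>j<N. (if x j = x i then m i * m j / (\<Sum>j\<in>J i. m j) else 0) * ((a i - a j) * (z i - z j)))"
proof -
  define W where "W i = (\<Sum>j\<in>J i. m j)" for i
  define k where "k i j = (if x j = x i then m i * m j / W i else 0)" for i j
  have W: "W i > 0" if "i < N" for i
    unfolding W_def J_def using that by (intro sum_pos) (auto intro: m_pos)
  have sym: "k i j = k j i" for i j
    by (auto simp: k_def W_def J_def)
  have Jsum: "(\<Sum>j\<in>J i. g j) = (\<Sum>j<N. if x j = x i then g j else 0)" for g :: "nat \<Rightarrow> real" and i
    unfolding J_def by (subst sum.inter_filter[symmetric]) (auto intro!: sum.cong)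
  have S: "(\<Sum>i<N. m i * (a i - (\<Sum>j\<in>J i. m j * a j) / W i) * z i) = (\<Sum>i<N. \<Sum>j<N. k i j * ((a i - a j) * z i))"
  proof (rule sum.cong[OF refl])
    fix i assume "i \<in> {..<N}"
    then have i: "i < N" by simp
    have "(\<Sum>j<N. k i j * ((a i - a j) * z i)) = (\<Sum>j\<in>J i. m i * m j / W i * ((a i - a j) * z i))"
      unfolding Jsum by (rule sum.cong) (auto simp: k_def)
    also have "\<dots> = (\<Sum>j\<in>J i. (m i * z i / W i) * (a i * m j - m j * a j))"
      by (rule sum.cong) (auto simp: field_simps)
    also have "\<dots> = (m i * z i / W i) * (a i * W i - (\<Sum>j\<in>J i. m j * a j))"
      by (simp only: sum_distrib_left[symmetric] sum_subtractf W_def)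
    also have "\<dots> = m i * (a i - (\<Sum>j\<in>J i. m j * a j) / W i) * z i"
      using W[OF i] by (simp add: field_simps)
    finally show "m i * (a i - (\<Sum>j\<in>J i. m j * a j) / W i) * z i = (\<Sum>j<N. k i j * ((a i - a j) * z i))" ..
  qed
  have S': "(\<Sum>i<N. \<Sum>j<N. k i j * ((a i - a j) * z i)) = (\<Sum>i<N. \<Sum>j<N. k i j * ((a j - a i) * z j))"
    by (subst sum.swap) (simp add: sym)
  have "2 * (\<Sum>i<N. m i * (a i - (\<Sum>j\<in>J i. m j * a j) / W i) * z i)
    = (\<Sum>i<N. \<Sum>j<N. k i j * ((a i - a j) * z i)) + (\<Sum>i<N. \<Sum>j<N. k i j * ((a j - a i) * z j))"
    using S S' by simp
  also have "\<dots> = (\<Sum>i<N. \<Sum>j<N. k i j * ((a i - a j) * (z i - z j)))"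
    unfolding sum.distrib[symmetric] by (intro sum.cong refl) (simp add: algebra_simps)
  finally show ?thesis unfolding k_def W_def .
qed

end

section \<open>Sticky trajectories as projections\<close>

lemma discrete_data_masses: "discrete_data N m x0 \<Longrightarrow> masses N m"
  by (auto simp: discrete_data_def masses_def)

lemma discrete_data_mono: "discrete_data N m x0 \<Longrightarrow> i \<le> j \<Longrightarrow> j < N \<Longrightarrow> x0 i \<le> x0 j"
  by (cases "i = j") (auto simp: discrete_data_def intro!: less_imp_le)

lemma discrete_data_inj: "discrete_data N m x0 \<Longrightarrow> i < N \<Longrightarrow> j < N \<Longrightarrow> x0 i = x0 j \<Longrightarrow> i = j"
  by (metis discrete_data_def less_irrefl nat_neq_iff)

lemma finite_gap_right:
  fixes t :: real
  assumes "finite A"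
  obtains d where "d > 0" "A \<inter> {t<..<t+d} = {}"
proof -
  define B where "B = {a\<in>A. t < a}"
  have B: "finite B" using assms by (simp add: B_def)
  define b where "b = Min (insert (t + 1) B)"
  have "t < b" unfolding b_def using B by (subst Min_gr_iff) (auto simp: B_def)
  moreover have "b \<le> a" if "a \<in> A" "t < a" for a
    unfolding b_def using B that by (intro Min_le) (auto simp: B_def)
  ultimately have "A \<inter> {t<..<t + (b - t)} = {}" by fastforce
  then show ?thesis using that[of "b - t"] \<open>t < b\<close> by simp
qed

locale sticky_discrete = masses +
  fixes x0 v0 :: "nat \<Rightarrow> real" and x v :: "nat \<Rightarrow> real \<Rightarrow> real"
  assumes data: "discrete_data N m x0" and traj: "sticky_trajectories N m x0 v0 x v"
begin

abbreviation "coll \<equiv> collision_times N x"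

lemma init: "i < N \<Longrightarrow> x i 0 = x0 i" "i < N \<Longrightarrow> v i 0 = v0 i"
  and cont: "i < N \<Longrightarrow> continuous_on {0..} (x i)"
  and ordered: "i \<le> j \<Longrightarrow> j < N \<Longrightarrow> 0 \<le> t \<Longrightarrow> x i t \<le> x j t"
  and cluster_mono: "i < N \<Longrightarrow> 0 \<le> s \<Longrightarrow> s \<le> t \<Longrightarrow> cluster N x i s \<subseteq> cluster N x i t"
  and fin_coll: "finite coll"
  and free: "i < N \<Longrightarrow> 0 \<le> s \<Longrightarrow> s \<le> t \<Longrightarrow> {s<..t} \<inter> coll = {} \<Longrightarrow> v i t = v i s \<and> x i t = x i s + (t - s) * v i s"
  and coll_rule: "i < N \<Longrightarrow> t \<in> coll \<Longrightarrow> v i t = (\<Sum>j\<in>cluster N x i t. m j * Lim (at_left t) (v j)) / (\<Sum>j\<in>cluster N x i t. m j)"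
proof -
  note tr = traj[unfolded sticky_trajectories_def]
  note c1 = conjunct1[OF tr] and r1 = conjunct2[OF tr]
  note r2 = conjunct2[OF r1]
  note c3 = conjunct1[OF r2] and r3 = conjunct2[OF r2]
  note c4 = conjunct1[OF r3] and r4 = conjunct2[OF r3]
  note c5 = conjunct1[OF r4] and r5 = conjunct2[OF r4]
  note c6 = conjunct1[OF r5] and c7 = conjunct2[OF r5]
  show "i < N \<Longrightarrow> x i 0 = x0 i" "i < N \<Longrightarrow> v i 0 = v0 i" "i < N \<Longrightarrow> continuous_on {0..} (x i)"
    using c1 by auto
  show "i \<le> j \<Longrightarrow> j < N \<Longrightarrow> 0 \<le> t \<Longrightarrow> x i t \<le> x j t" using c3 by simp
  show "i < N \<Longrightarrow> 0 \<le> s \<Longrightarrow> s \<le> t \<Longrightarrow> cluster N x i s \<subseteq> cluster N x i t" using c4 by blast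
  show "finite coll" by (rule c5)
  show "i < N \<Longrightarrow> 0 \<le> s \<Longrightarrow> s \<le> t \<Longrightarrow> {s<..t} \<inter> coll = {} \<Longrightarrow> v i t = v i s \<and> x i t = x i s + (t - s) * v i s" using c6 by blast
  show "i < N \<Longrightarrow> t \<in> coll \<Longrightarrow> v i t = (\<Sum>j\<in>cluster N x i t. m j * Lim (at_left t) (v j)) / (\<Sum>j\<in>cluster N x i t. m j)" using c7 by blast
qed

text \<open>The free flight clause excludes collisions also at its right end. When \<open>t\<close>
  is itself a collision time, the position is obtained by continuity and the incoming velocity as
  the limit of a constant.\<close>

lemma
  assumes st: "0 \<le> s" "s < t" and no: "{s<..<t} \<inter> coll = {}" and i: "i < N"
  shows x_left: "x i t = x i s + (t - s) * v i s" and v_left: "Lim (at_left t) (v i) = v i s"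
proof -
  have fr: "v i r = v i s \<and> x i r = x i s + (r - s) * v i s" if r: "s < r" "r < t" for r
  proof -
    have "{s<..r} \<inter> coll = {}" using no r by fastforce
    then show ?thesis using free[OF i st(1), of r] r by auto
  qed
  have ev: "\<forall>\<^sub>F r in at_left t. s < r \<and> r < t"
    unfolding eventually_at_left_field using st(2) by blast
  have "continuous (at t within {0..}) (x i)" using cont[OF i] st by (simp add: continuous_on_eq_continuous_within)
  then have "(x i \<longlongrightarrow> x i t) (at t within {0..})" by (simp add: continuous_within)
  moreover have "at t within {0..} = at t"
    using st by (intro at_within_open_subset[of _ "{0<..}"]) auto
  ultimately have 1: "(x i \<longlongrightarrow> x i t) (at_left t)" by (simp add: filterlim_at_split)
  have "((\<lambda>r. x i s + (r - s) * v i s) \<longlongrightarrow> x i s + (t - s) * v i s) (at_left t)"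
    by (intro tendsto_intros)
  then have 2: "(x i \<longlongrightarrow> x i s + (t - s) * v i s) (at_left t)"
    by (rule Lim_transform_eventually) (use ev in \<open>auto elim!: eventually_mono dest: fr\<close>)
  show "x i t = x i s + (t - s) * v i s" by (rule tendsto_unique[OF _ 1 2]) simp
  have "(v i \<longlongrightarrow> v i s) (at_left t)"
    by (rule tendsto_eventually) (use ev in \<open>auto elim!: eventually_mono dest: fr\<close>)
  then show "Lim (at_left t) (v i) = v i s" by (intro tendsto_Lim) simp_all
qed

definition "mono_seq z \<longleftrightarrow> (\<forall>i j. i \<le> j \<longrightarrow> j < N \<longrightarrow> z i \<le> (z j :: real))"
definition "const_seq t z \<longleftrightarrow> (\<forall>i<N. \<forall>j<N. x i t = x j t \<longrightarrow> z i = (z j :: real))"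

text \<open>Discrete normal vectors at the configuration of time \<open>t\<close>. Orthogonality is
  demanded for all sequences constant on clusters, not just for the positions, because in this form
  it persists as clusters grow.\<close>

definition "in_normal_cone t \<xi> \<longleftrightarrow>
  (\<forall>z. mono_seq z \<longrightarrow> (\<Sum>i<N. m i * \<xi> i * z i) \<le> 0) \<and> (\<forall>z. const_seq t z \<longrightarrow> (\<Sum>i<N. m i * \<xi> i * z i) = 0)"

lemma const_seq_antimono: "0 \<le> s \<Longrightarrow> s \<le> t \<Longrightarrow> const_seq t z \<Longrightarrow> const_seq s z"
  using cluster_mono unfolding const_seq_def cluster_def by blast

lemma in_normal_cone_add:
  assumes "in_normal_cone s \<xi>" "in_normal_cone t \<eta>" "0 \<le> s" "s \<le> t" "0 \<le> r"
  shows "in_normal_cone t (\<lambda>i. \<xi> i + r * \<eta> i)"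
proof -
  have *: "(\<Sum>i<N. m i * (\<xi> i + r * \<eta> i) * z i) = (\<Sum>i<N. m i * \<xi> i * z i) + r * (\<Sum>i<N. m i * \<eta> i * z i)" for z
    unfolding sum_distrib_left sum.distrib[symmetric] by (rule sum.cong) (simp_all add: algebra_simps)
  show ?thesis
    unfolding in_normal_cone_def *
    using assms const_seq_antimono[of s t]
    by (auto simp: in_normal_cone_def intro!: add_nonpos_nonpos mult_nonneg_nonpos)
qed

lemma in_normal_cone_cong: "in_normal_cone t \<xi> \<Longrightarrow> (\<And>i. i < N \<Longrightarrow> \<xi> i = \<eta> i) \<Longrightarrow> in_normal_cone t \<eta>"
  by (simp add: in_normal_cone_def)

lemma in_normal_cone_mono: "in_normal_cone s \<xi> \<Longrightarrow> 0 \<le> s \<Longrightarrow> s \<le> t \<Longrightarrow> in_normal_cone t \<xi>"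
  using const_seq_antimono unfolding in_normal_cone_def by blast

text \<open>The outgoing velocity is the cluster average of the incoming ones, so the symmetrised
  sum applies; each of its terms pairs a nonincreasing with a nondecreasing difference. Without a
  collision at \<open>t\<close> there is no jump.\<close>

lemma velocity_jump:
  assumes st: "0 \<le> s" "s < t" and no: "{s<..<t} \<inter> coll = {}"
  shows "in_normal_cone t (\<lambda>i. v i s - v i t)"
proof (cases "t \<in> coll")
  case False
  then have "{s<..t} \<inter> coll = {}" using no st by (auto simp: less_eq_real_def)
  then show ?thesis using free[of _ s t] st by (simp add: in_normal_cone_def)
next
  case True
  let ?J = "\<lambda>i. {j. j < N \<and> x j t = x i t}"
  define k where "k i j = (if x j t = x i t then m i * m j / (\<Sum>j\<in>?J i. m j) else 0)" for i j
  have vt: "v i t = (\<Sum>j\<in>?J i. m j * v j s) / (\<Sum>j\<in>?J i. m j)" if i: "i < N" for i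
  proof -
    have "(\<Sum>j\<in>?J i. m j * Lim (at_left t) (v j)) = (\<Sum>j\<in>?J i. m j * v j s)"
      by (rule sum.cong) (auto simp: v_left[OF st no])
    then show ?thesis using coll_rule[OF i True] unfolding cluster_def by (simp only:)
  qed
  have eq: "2 * (\<Sum>i<N. m i * (v i s - v i t) * z i) = (\<Sum>i<N. \<Sum>j<N. k i j * ((v i s - v j s) * (z i - z j)))" for z
    using sum_avg_pairs[of "\<lambda>i. v i s" "\<lambda>i. x i t" z] unfolding k_def by (simp add: vt)
  have k0: "0 \<le> k i j" if "i < N" "j < N" for i j
    unfolding k_def using that by (auto simp: less_imp_le m_pos intro!: divide_nonneg_nonneg mult_nonneg_nonneg sum_nonneg)
  (* colliding particles: the left one is faster *)
  have faster: "v j s \<le> v i s" if ij: "i \<le> j" "j < N" "x i t = x j t" for i j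
  proof -
    have "x i s + (t - s) * v i s = x j s + (t - s) * v j s"
      using ij x_left[OF st no, of i] x_left[OF st no, of j] by simp
    moreover have "x i s \<le> x j s" using ij st by (intro ordered) auto
    ultimately have "(t - s) * v j s \<le> (t - s) * v i s" by linarith
    then show ?thesis using st by simp
  qed
  have "(\<Sum>i<N. m i * (v i s - v i t) * z i) \<le> 0" if z: "mono_seq z" for z
  proof -
    have "k i j * ((v i s - v j s) * (z i - z j)) \<le> 0" if ij: "i < N" "j < N" for i j
    proof (cases "x j t = x i t")
      case True
      have "(v i s - v j s) * (z i - z j) \<le> 0"
      proof (cases "i \<le> j")
        case le: True
        then show ?thesis using faster[OF le ij(2)] z ij True by (auto simp: mono_seq_def intro: mult_nonneg_nonpos)
      next
        case False
        then show ?thesis using faster[of j i] z ij True by (auto simp: mono_seq_def intro: mult_nonpos_nonneg)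
      qed
      then show ?thesis using k0[OF ij] by (rule mult_nonneg_nonpos[rotated])
    qed (simp add: k_def)
    then have "2 * (\<Sum>i<N. m i * (v i s - v i t) * z i) \<le> 0" unfolding eq by (intro sum_nonpos) auto
    then show ?thesis by simp
  qed
  moreover have "(\<Sum>i<N. m i * (v i s - v i t) * z i) = 0" if z: "const_seq t z" for z
  proof -
    have k00: "k i j * ((v i s - v j s) * (z i - z j)) = 0" if "i < N" "j < N" for i j
    proof (cases "x j t = x i t")
      case True
      then have "z j = z i" using z that unfolding const_seq_def by blast
      then show ?thesis by simp
    qed (simp add: k_def)
    have "2 * (\<Sum>i<N. m i * (v i s - v i t) * z i) = 0"
      unfolding eq by (intro sum.neutral ballI k00) simp_all
    then show ?thesis by simp
  qed
  ultimately show ?thesis unfolding in_normal_cone_def by blast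
qed

text \<open>Induction over the number of earlier collisions, stepping back from \<open>t\<close> to
  the last of them or to \<open>0\<close>. The velocity residual gains the jump at \<open>t\<close>;
  the position residual grows by the elapsed time multiplied by the velocity residual. Normal cones
  only grow in time and are closed under such sums.\<close>

lemma normal_cone_invariant:
  "0 \<le> t \<Longrightarrow> in_normal_cone t (\<lambda>i. v0 i - v i t) \<and> in_normal_cone t (\<lambda>i. x0 i + t * v0 i - x i t)"
proof (induction "card {\<tau>\<in>coll. \<tau> < t}" arbitrary: t rule: less_induct)
  case less
  have zero: "in_normal_cone 0 (\<lambda>i. v0 i - v i 0)" "in_normal_cone 0 (\<lambda>i. x0 i + 0 * v0 i - x i 0)"
    by (simp_all add: in_normal_cone_def init)
  show ?case
  proof (cases "t = 0")
    case False
    then have t: "t > 0" using less by simp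
    define T where "T = insert 0 {\<tau>\<in>coll. \<tau> < t}"
    have T: "finite T" "T \<noteq> {}" using fin_coll by (auto simp: T_def)
    define s where "s = Max T"
    have sT: "s \<in> T" unfolding s_def using T by simp
    have pos: "0 < \<tau>" if "\<tau> \<in> coll" for \<tau> using that by (simp add: collision_times_def)
    have st: "0 \<le> s" "s < t" using sT t pos by (auto simp: T_def dest: less_imp_le)
    have no: "{s<..<t} \<inter> coll = {}"
    proof (rule ccontr)
      assume "{s<..<t} \<inter> coll \<noteq> {}"
      then obtain \<tau> where "s < \<tau>" "\<tau> < t" "\<tau> \<in> coll" by auto
      then have "\<tau> \<le> s" unfolding s_def using T by (intro Max_ge) (auto simp: T_def)
      then show False using \<open>s < \<tau>\<close> by simp
    qed
    have IH: "in_normal_cone s (\<lambda>i. v0 i - v i s)" "in_normal_cone s (\<lambda>i. x0 i + s * v0 i - x i s)"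
    proof -
      have "in_normal_cone s (\<lambda>i. v0 i - v i s) \<and> in_normal_cone s (\<lambda>i. x0 i + s * v0 i - x i s)"
      proof (cases "s = 0")
        case False
        then have "s \<in> coll" using sT by (auto simp: T_def)
        have "card {\<tau>\<in>coll. \<tau> < s} < card {\<tau>\<in>coll. \<tau> < t}"
          using fin_coll \<open>s \<in> coll\<close> st by (intro psubset_card_mono) auto
        then show ?thesis using less.hyps st by blast
      qed (use zero in simp)
      then show "in_normal_cone s (\<lambda>i. v0 i - v i s)" "in_normal_cone s (\<lambda>i. x0 i + s * v0 i - x i s)" by auto
    qed
    have "in_normal_cone t (\<lambda>i. (v0 i - v i s) + 1 * (v i s - v i t))"
      using st by (intro in_normal_cone_add[OF IH(1) velocity_jump[OF st no]]) auto
    moreover have "in_normal_cone t (\<lambda>i. (x0 i + s * v0 i - x i s) + (t - s) * (v0 i - v i s))"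
      using st by (intro in_normal_cone_add[OF IH(2) in_normal_cone_mono[OF IH(1)]]) auto
    ultimately show ?thesis
    proof (intro conjI)
      assume 1: "in_normal_cone t (\<lambda>i. (v0 i - v i s) + 1 * (v i s - v i t))"
        and 2: "in_normal_cone t (\<lambda>i. (x0 i + s * v0 i - x i s) + (t - s) * (v0 i - v i s))"
      show "in_normal_cone t (\<lambda>i. v0 i - v i t)"
        by (rule in_normal_cone_cong[OF 1]) simp
      show "in_normal_cone t (\<lambda>i. x0 i + t * v0 i - x i t)"
        by (rule in_normal_cone_cong[OF 2]) (simp add: x_left[OF st no] algebra_simps)
    qed
  qed (use zero in simp)
qed

lemma PK_step: "0 \<le> t \<Longrightarrow> PK (step N m x0 + t *\<^sub>R step N m v0) = step N m (\<lambda>i. x i t)"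
  unfolding PK_eq_iff subdiff_cone_K_iff step_scaleR step_add step_diff
proof (intro conjI ballI)
  assume t: "0 \<le> t"
  have inv: "(\<Sum>i<N. m i * (x0 i + t * v0 i - x i t) * z i) \<le> 0" if "mono_seq z" for z
    using normal_cone_invariant[OF t] that unfolding in_normal_cone_def by blast
  show "step N m (\<lambda>i. x i t) \<in> cone_K" using ordered t by (simp add: step_in_cone_K_iff)
  show "inner (step N m (\<lambda>i. x0 i + t * v0 i - x i t)) (step N m (\<lambda>i. x i t)) = 0"
    unfolding inner_step_step
    using normal_cone_invariant[OF t, THEN conjunct2, unfolded in_normal_cone_def, THEN conjunct2, THEN spec, of "\<lambda>i. x i t"]
    by (simp add: const_seq_def)
  show "inner (step N m (\<lambda>i. x0 i + t * v0 i - x i t)) z \<le> 0" if "z \<in> cone_K" for z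
    by (rule step_polar[OF inv that]) (auto simp: mono_seq_def)
qed

text \<open>Functions of the positions are constant on clusters and hence do not distinguish
  \<open>v0\<close> from the current velocities: the discrete counterpart of
  \<open>eul_PH\<close>.\<close>

lemma eul_PK_step:
  assumes t: "0 \<le> t"
  shows "eul (PK (step N m x0 + t *\<^sub>R step N m v0)) (step N m v0) = discrete_state N m (\<lambda>i. x i t) (\<lambda>i. v i t)"
proof -
  have e: "(\<Sum>i<N. m i * v0 i * indicator B (x i t)) = (\<Sum>i<N. m i * v i t * indicator B (x i t))" for B
  proof -
    have "const_seq t (\<lambda>i. indicator B (x i t))" by (simp add: const_seq_def)
    then have "(\<Sum>i<N. m i * (v0 i - v i t) * indicator B (x i t)) = 0"
      using normal_cone_invariant[OF t] unfolding in_normal_cone_def by blast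
    moreover have "(\<Sum>i<N. m i * (v0 i - v i t) * indicator B (x i t))
      = (\<Sum>i<N. m i * v0 i * indicator B (x i t)) - (\<Sum>i<N. m i * v i t * indicator B (x i t))"
      unfolding sum_subtractf[symmetric] by (rule sum.cong) (simp_all add: algebra_simps)
    ultimately show ?thesis by simp
  qed
  show ?thesis unfolding PK_step[OF t] eul_step discrete_state_def e ..
qed

end

section \<open>Existence of sticky trajectories and density of discrete states\<close>

text \<open>The first meeting of \<open>i\<close> and \<open>j\<close> after \<open>s\<close> is a
  collision time: \<open>j\<close> enters the cluster of \<open>i\<close> there. An earlier meeting
  is impossible, as they would then still be together at \<open>s\<close>.\<close>

lemma cluster_collision_between:
  assumes ij: "i < N" "j < N" and st: "0 \<le> s" "s \<le> t"
    and cont: "continuous_on {0..} (x i)" "continuous_on {0..} (x j)"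
    and mono: "\<And>k s t. k < N \<Longrightarrow> 0 \<le> s \<Longrightarrow> s \<le> t \<Longrightarrow> cluster N x k s \<subseteq> cluster N x k t"
    and neq: "x i s \<noteq> x j s" and eq: "x i t = x j t"
  shows "{s<..t} \<inter> collision_times N x \<noteq> {}"
proof -
  define A where "A = {r\<in>{s..t}. x i r = x j r}"
  have c: "continuous_on {s..t} (x i)" "continuous_on {s..t} (x j)"
    using st by (auto intro: continuous_on_subset[OF cont(1)] continuous_on_subset[OF cont(2)])
  have "closed A" unfolding A_def using continuous_closed_preimage_constant[of "{s..t}" "\<lambda>r. x i r - x j r" 0] c
    by (simp add: continuous_on_diff)
  moreover have "t \<in> A" using st eq by (simp add: A_def)
  moreover have bdd: "bdd_below A" by (rule bdd_belowI[of _ s]) (simp add: A_def)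
  ultimately have inf: "Inf A \<in> A" by (intro closed_contains_Inf) auto
  define \<tau> where "\<tau> = Inf A"
  have \<tau>: "s < \<tau>" "\<tau> \<le> t" "x i \<tau> = x j \<tau>"
    using inf neq by (auto simp: A_def \<tau>_def less_le)
  have ne: "x i r \<noteq> x j r" if r: "0 \<le> r" "r < \<tau>" for r
  proof
    assume e: "x i r = x j r"
    show False
    proof (cases "s \<le> r")
      case True
      then have "r \<in> A" using e r \<tau> by (simp add: A_def)
      then have "\<tau> \<le> r" unfolding \<tau>_def using bdd by (rule cInf_lower)
      then show False using r by simp
    next
      case False
      then have "cluster N x i r \<subseteq> cluster N x i s" using mono[OF ij(1), of r s] r by simp
      then show False using e neq ij by (auto simp: cluster_def)
    qed
  qed
  have "cluster N x i r \<subset> cluster N x i \<tau>" if r: "0 \<le> r" "r < \<tau>" for r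
  proof
    show "cluster N x i r \<subseteq> cluster N x i \<tau>" using mono[OF ij(1), of r \<tau>] r by simp
    have "j \<in> cluster N x i \<tau>" "j \<notin> cluster N x i r" using ne[OF r] \<tau>(3) ij by (auto simp: cluster_def)
    then show "cluster N x i r \<noteq> cluster N x i \<tau>" by blast
  qed
  then have "\<forall>r. 0 \<le> r \<and> r < \<tau> \<longrightarrow> cluster N x i r \<subset> cluster N x i \<tau>" by blast
  moreover have "0 < \<tau>" using \<tau> st by simp
  ultimately have "\<tau> \<in> collision_times N x" unfolding collision_times_def using ij(1) by blast
  then show ?thesis using \<tau> by auto
qed

text \<open>The total size of all clusters is an integer of at most \<open>N * N\<close>, and at a
  collision time it is strictly larger than at any earlier time.\<close>

lemma finite_collision_times:
  assumes mono: "\<And>k s t. k < N \<Longrightarrow> 0 \<le> s \<Longrightarrow> s \<le> t \<Longrightarrow> cluster N x k s \<subseteq> cluster N x k t"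
  shows "finite (collision_times N x)"
proof -
  define n where "n t = (\<Sum>i<N. card (cluster N x i t))" for t
  have fin: "finite (cluster N x i t)" for i t by (simp add: cluster_def)
  have less: "n s < n t" if st: "0 \<le> s" "s < t" "t \<in> collision_times N x" for s t
  proof -
    obtain i where i: "i < N" "cluster N x i s \<subset> cluster N x i t"
      using st unfolding collision_times_def by blast
    show ?thesis unfolding n_def
    proof (rule sum_strict_mono_ex1)
      show "\<forall>k\<in>{..<N}. card (cluster N x k s) \<le> card (cluster N x k t)"
        using mono st by (intro ballI card_mono fin) auto
      show "\<exists>k\<in>{..<N}. card (cluster N x k s) < card (cluster N x k t)"
        using i by (intro bexI[of _ i] psubset_card_mono fin) auto
    qed simp
  qed
  have "inj_on n (collision_times N x)"
  proof (rule inj_onI)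
    fix s t assume st: "s \<in> collision_times N x" "t \<in> collision_times N x" "n s = n t"
    have "0 < s" "0 < t" using st by (auto simp: collision_times_def)
    then show "s = t" using less[of s t] less[of t s] st by (cases s t rule: linorder_cases) auto
  qed
  moreover have "n ` collision_times N x \<subseteq> {..N * N}"
  proof
    fix y assume "y \<in> n ` collision_times N x"
    then obtain t where y: "y = n t" by blast
    have "card (cluster N x i t) \<le> N" for i
      using card_mono[of "{..<N}" "cluster N x i t"] by (auto simp: cluster_def)
    then have "n t \<le> (\<Sum>i<N. N)" unfolding n_def by (intro sum_mono)
    then show "y \<in> {..N * N}" using y by simp
  qed
  ultimately show ?thesis by (meson finite_atMost inj_on_finite)
qed

section \<open>Trajectories from the projected flow\<close>

context masses
begin

text \<open>The value on cell \<open>i\<close>, written as a bounded linear functional on the whole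
  space, so that continuity and one-sided derivatives pass from the curve to its
  coordinates.\<close>

definition coord :: "l2 \<Rightarrow> nat \<Rightarrow> real" where
  "coord y i = inner y (step N m (\<lambda>j. if j = i then 1 else 0)) / m i"

lemma coord_step: "i < N \<Longrightarrow> coord (step N m c) i = c i"
  using m_pos[of i] by (simp add: coord_def inner_step_step if_distrib sum.delta cong: if_cong)

lemma step_coord: "y \<in> sub_H Grid \<Longrightarrow> step N m (coord y) = y"
  by (erule sub_H_Grid_cases) (simp add: step_eq_iff coord_step)

end

text \<open>The projected flow starting from step functions stays in the finite-dimensional space of
  step functions, and its coordinates satisfy every clause: shrinking of \<open>sub_H\<close> is
  growth of clusters, and projection of velocities is conservation of momentum.\<close>

theorem sticky_trajectories_exist:
  assumes data: "discrete_data N m x0"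
  shows "\<exists>x v. sticky_trajectories N m x0 v0 x v"
proof -
  interpret masses N m by (rule discrete_data_masses[OF data])
  have x0K: "step N m x0 \<in> cone_K"
    using discrete_data_mono[OF data] by (simp add: step_in_cone_K_iff)
  have v0H: "step N m c \<in> sub_H (step N m x0)" for c
    using discrete_data_mono[OF data] discrete_data_inj[OF data] by (subst step_in_sub_H_step_iff) blast+
  interpret F: sticky_flow "step N m x0" "step N m v0"
    by standard (rule x0K, rule v0H)
  have grid: "F.X t \<in> sub_H Grid" "F.V t \<in> sub_H Grid" if "t \<ge> 0" for t
  proof -
    have "F.X t \<in> sub_H (step N m x0)" using F.X_in_sub_H[of 0 t] that by (simp add: F.X_0)
    then show X: "F.X t \<in> sub_H Grid" using sub_H_mono[OF step_in_sub_H_Grid] by blast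
    show "F.V t \<in> sub_H Grid" using sub_H_mono[OF X] F.V_mem by blast
  qed
  define x where "x i t = coord (F.X t) i" for i t
  define v where "v i t = coord (F.V t) i" for i t
  have X: "F.X t = step N m (\<lambda>i. x i t)" and V: "F.V t = step N m (\<lambda>i. v i t)" if "t \<ge> 0" for t
    using step_coord[OF grid(1)[OF that]] step_coord[OF grid(2)[OF that]] by (simp_all add: x_def[abs_def] v_def[abs_def])
  have ordered: "x i t \<le> x j t" if "i \<le> j" "j < N" "t \<ge> 0" for i j t
    using F.X_mem[of t] that by (simp add: X step_in_cone_K_iff)
  have in_H: "step N m c \<in> sub_H (F.X t) \<longleftrightarrow> (\<forall>i<N. \<forall>j<N. x i t = x j t \<longrightarrow> c i = c j)" if "t \<ge> 0" for c t
    unfolding X[OF that] by (rule step_in_sub_H_step_iff) (use ordered that in auto)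
  have mono: "cluster N x k s \<subseteq> cluster N x k t" if "k < N" "0 \<le> s" "s \<le> t" for k s t
  proof -
    have t: "t \<ge> 0" using that(2,3) by (rule order_trans)
    have "step N m (\<lambda>i. x i t) \<in> sub_H (F.X s)" using F.X_in_sub_H[OF that(2,3)] unfolding X[OF t] .
    then have "\<forall>i<N. \<forall>j<N. x i s = x j s \<longrightarrow> x i t = x j t" by (rule in_H[OF that(2), THEN iffD1])
    then show ?thesis unfolding cluster_def using that(1) by blast
  qed
  have v_const: "v i t = v j t" if "i < N" "j < N" "x i t = x j t" "t \<ge> 0" for i j t
  proof -
    have "step N m (\<lambda>i. v i t) \<in> sub_H (F.X t)" using F.V_mem[of t] unfolding V[OF that(4)] .
    then have "\<forall>i<N. \<forall>j<N. x i t = x j t \<longrightarrow> v i t = v j t" by (rule in_H[OF that(4), THEN iffD1])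
    then show ?thesis using that(1-3) by blast
  qed
  have cont: "continuous_on {0..} (x i)" for i
    unfolding x_def coord_def divide_inverse
    by (intro continuous_intros lipschitz_on_continuous_on[OF F.lipschitz_on_X])
  have deriv: "(x i has_real_derivative v i t) (at t within {t..})" if "t \<ge> 0" for i t
  proof -
    have "((\<lambda>t. inner (F.X t) (step N m (\<lambda>j. if j = i then 1 else 0))) has_vector_derivative inner (F.V t) (step N m (\<lambda>j. if j = i then 1 else 0))) (at t within {t..})"
      by (rule bounded_linear.has_vector_derivative[OF bounded_linear_inner_left F.X_right_derivative[OF that]])
    then have "((\<lambda>t. inner (F.X t) (step N m (\<lambda>j. if j = i then 1 else 0))) has_real_derivative inner (F.V t) (step N m (\<lambda>j. if j = i then 1 else 0))) (at t within {t..})"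
      by (simp add: has_real_derivative_iff_has_vector_derivative)
    then show ?thesis unfolding x_def[abs_def] v_def coord_def by (rule DERIV_cdivide)
  qed
  have fin: "finite (collision_times N x)" by (rule finite_collision_times[OF mono])
  have free: "v i t = v i s \<and> x i t = x i s + (t - s) * v i s"
    if i: "i < N" and st: "0 \<le> s" "s \<le> t" and no: "{s<..t} \<inter> collision_times N x = {}" for i s t
  proof -
    \<comment> \<open>Without a collision the clusters at \<open>s\<close> and \<open>t\<close>
      coincide, so \<open>sub_H\<close> does not shrink, the velocity is constant, and
      \<open>increment_estimate\<close> has right-hand side zero.\<close>
    have "\<forall>k<N. \<forall>j<N. x k t = x j t \<longrightarrow> x k s = x j s"
    proof (intro allI impI, rule ccontr)
      fix k j assume kj: "k < N" "j < N" "x k t = x j t" "x k s \<noteq> x j s"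
      have "{s<..t} \<inter> collision_times N x \<noteq> {}"
        by (rule cluster_collision_between[OF kj(1,2) st cont cont mono kj(4,3)])
      then show False using no by simp
    qed
    then have "step N m (\<lambda>i. x i s) \<in> sub_H (F.X t)" by (rule in_H[OF order_trans[OF st], THEN iffD2])
    then have "sub_H (F.X s) \<subseteq> sub_H (F.X t)" unfolding X[OF st(1)] by (rule sub_H_mono)
    then have "F.V s \<in> sub_H (F.X t)" using F.V_mem by blast
    then have Vst: "F.V t = F.V s" using F.V_semigroup[OF st] by (simp add: PH_self)
    then have "norm (F.X t - F.X s - (t - s) *\<^sub>R F.V t) = 0"
      using F.increment_estimate[OF st] by simp
    then have "F.X t = F.X s + (t - s) *\<^sub>R F.V s" using Vst by (simp add: algebra_simps)
    then show ?thesis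
      using Vst by (simp add: x_def v_def coord_def inner_add_left add_divide_distrib)
  qed
  have vcont: "continuous (at_right t) (v i)" if i: "i < N" and t: "t \<ge> 0" for i t
  proof -
    obtain d where d: "d > 0" "collision_times N x \<inter> {t<..<t+d} = {}"
      using finite_gap_right[OF fin] by blast
    have "v i r = v i t" if r: "t < r" "r < t + d" for r
    proof -
      have "{t<..r} \<inter> collision_times N x = {}" using d r by fastforce
      then show ?thesis using free[OF i t, of r] r by auto
    qed
    then have "\<forall>\<^sub>F r in at_right t. v i r = v i t"
      unfolding eventually_at_right_field using d(1) by (intro exI[of _ "t + d"]) auto
    then show ?thesis by (simp add: continuous_within tendsto_eventually)
  qed
  have coll: "v i t = (\<Sum>j\<in>cluster N x i t. m j * Lim (at_left t) (v j)) / (\<Sum>j\<in>cluster N x i t. m j)"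
    if i: "i < N" and t: "t \<in> collision_times N x" for i t
  proof -
    have t0: "t > 0" using t by (simp add: collision_times_def)
    define T where "T = insert 0 {\<tau>\<in>collision_times N x. \<tau> < t}"
    have T: "finite T" "T \<noteq> {}" using fin by (auto simp: T_def)
    define s where "s = Max T"
    have sT: "s \<in> T" unfolding s_def using T by simp
    have st: "0 \<le> s" "s < t" using sT t0 by (auto simp: T_def collision_times_def)
    have no: "\<tau> \<le> s" if "\<tau> < t" "\<tau> \<in> collision_times N x" for \<tau>
      unfolding s_def using T that by (intro Max_ge) (auto simp: T_def)
    have lim: "Lim (at_left t) (v j) = v j s" if j: "j < N" for j
    proof -
      have eq: "v j r = v j s" if r: "s < r" "r < t" for r
      proof -
        have "{s<..r} \<inter> collision_times N x = {}"
        proof (rule equals0I)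
          fix a assume "a \<in> {s<..r} \<inter> collision_times N x"
          then show False using no[of a] r by simp
        qed
        then show ?thesis using free[OF j st(1), of r] r by auto
      qed
      have "\<forall>\<^sub>F r in at_left t. v j r = v j s"
        unfolding eventually_at_left_field using st(2) eq by blast
      then have "(v j \<longlongrightarrow> v j s) (at_left t)" by (rule tendsto_eventually)
      then show ?thesis by (intro tendsto_Lim) simp_all
    qed
    \<comment> \<open>The indicator of the cluster at time \<open>t\<close> lies in
      \<open>sub_H (F.X t)\<close>. Projecting the velocity of time \<open>s\<close> therefore
      preserves its inner product with \<open>c\<close>, which is the momentum of the
      cluster.\<close>
    define c where "c j = (if x j t = x i t then 1 else 0 :: real)" for j
    have cH: "step N m c \<in> sub_H (F.X t)" using in_H[of t c] t0 by (simp add: c_def)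
    have sumc: "(\<Sum>j<N. m j * g j * c j) = (\<Sum>j\<in>cluster N x i t. m j * g j)" for g
      unfolding cluster_def c_def using sum.inter_filter[of "{..<N}" "\<lambda>j. m j * g j" "\<lambda>j. x j t = x i t"]
      by (simp add: if_distrib cong: if_cong)
    have "inner (F.V t) (step N m c) = inner (F.V s) (step N m c)"
      using PH_inner[OF cH, of "F.V s"] F.V_semigroup[of s t] st by simp
    then have "(\<Sum>j\<in>cluster N x i t. m j * v j t) = (\<Sum>j\<in>cluster N x i t. m j * v j s)"
      using V[of t] V[of s] st by (simp only: inner_step_step sumc[symmetric] less_imp_le)
    moreover have "(\<Sum>j\<in>cluster N x i t. m j * v j t) = v i t * (\<Sum>j\<in>cluster N x i t. m j)"
      unfolding sum_distrib_left
    proof (rule sum.cong[OF refl])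
      fix j assume "j \<in> cluster N x i t"
      then have "v j t = v i t" using v_const[of j i t] i t0 by (auto simp: cluster_def)
      then show "m j * v j t = v i t * m j" by simp
    qed
    moreover have "(\<Sum>j\<in>cluster N x i t. m j * Lim (at_left t) (v j)) = (\<Sum>j\<in>cluster N x i t. m j * v j s)"
      by (rule sum.cong) (auto simp: cluster_def lim)
    moreover have "(\<Sum>j\<in>cluster N x i t. m j) > 0"
      using i by (intro sum_pos) (auto simp: cluster_def m_pos)
    ultimately show ?thesis by (simp add: field_simps)
  qed
  have init: "x i 0 = x0 i" "v i 0 = v0 i" if "i < N" for i
    using that by (simp_all add: x_def v_def F.X_0 F.V_0 coord_step)
  have "sticky_trajectories N m x0 v0 x v"
    unfolding sticky_trajectories_def
  proof (intro conjI)
    show "\<forall>i<N. x i 0 = x0 i \<and> v i 0 = v0 i \<and> continuous_on {0..} (x i)"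
      using init cont by simp
    show "\<forall>i<N. \<forall>t\<ge>0. (x i has_real_derivative v i t) (at t within {t..}) \<and> continuous (at_right t) (v i)"
      using deriv vcont by simp
    show "\<forall>i<N. \<forall>j<N. \<forall>t\<ge>0. i \<le> j \<longrightarrow> x i t \<le> x j t"
      using ordered by simp
    show "\<forall>i<N. \<forall>s t. 0 \<le> s \<and> s \<le> t \<longrightarrow> cluster N x i s \<subseteq> cluster N x i t"
      using mono by simp
    show "\<forall>i<N. \<forall>s t. 0 \<le> s \<and> s \<le> t \<and> {s<..t} \<inter> collision_times N x = {} \<longrightarrow>
        v i t = v i s \<and> x i t = x i s + (t - s) * v i s"
      by (intro allI impI free) auto
    show "\<forall>i<N. \<forall>t\<in>collision_times N x. v i t =
        (\<Sum>j\<in>cluster N x i t. m j * Lim (at_left t) (v j)) / (\<Sum>j\<in>cluster N x i t. m j)"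
      by (intro allI impI ballI coll)
  qed (rule fin)
  then show ?thesis by blast
qed

section \<open>Dyadic step functions\<close>

lemma uniform_masses: "masses (2 ^ n) (\<lambda>_. 1 / 2 ^ n)"
  by standard simp_all

lemma uniform_cum: "cum (\<lambda>_. 1 / 2 ^ n) k = real k / 2 ^ n"
  by (simp add: cum_def)

lemma uniform_idx_less_iff:
  assumes "0 < w" "w < 1"
  shows "idx (2 ^ n) (\<lambda>_. 1 / 2 ^ n) w < k \<longleftrightarrow> w < real k / 2 ^ n"
proof -
  interpret masses "2 ^ n" "\<lambda>_. 1 / 2 ^ n" by (rule uniform_masses)
  let ?i = "idx (2 ^ n) (\<lambda>_. 1 / 2 ^ n) w"
  have b: "real ?i / 2 ^ n \<le> w" "w < real (Suc ?i) / 2 ^ n"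
    using idx_bounds[OF assms] by (simp_all only: uniform_cum)
  have mono: "real a / 2 ^ n \<le> real b / 2 ^ n" if "a \<le> b" for a b :: nat
    using that by (simp add: divide_right_mono)
  show ?thesis
    using b mono[of "Suc ?i" k] mono[of k ?i] by (cases "?i < k") auto
qed

definition grid :: "nat \<Rightarrow> l2" where
  "grid n = step (2 ^ n) (\<lambda>_. 1 / 2 ^ n) real"

lemma grid_mem: "grid n \<in> cone_K"
  unfolding grid_def by (rule masses.Grid_mem[OF uniform_masses])

lemma sub_H_grid_Suc: "sub_H (grid n) \<subseteq> sub_H (grid (Suc n))"
proof (rule sub_H_mono)
  have eq: "idx (2 ^ n) (\<lambda>_. 1 / 2 ^ n) w = idx (2 ^ Suc n) (\<lambda>_. 1 / 2 ^ Suc n) w div 2" if w: "0 < w" "w < 1" for w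
  proof -
    have "idx (2 ^ n) (\<lambda>_. 1 / 2 ^ n) w < k \<longleftrightarrow> idx (2 ^ Suc n) (\<lambda>_. 1 / 2 ^ Suc n) w div 2 < k" for k
    proof -
      have "idx (2 ^ Suc n) (\<lambda>_. 1 / 2 ^ Suc n) w div 2 < k \<longleftrightarrow> idx (2 ^ Suc n) (\<lambda>_. 1 / 2 ^ Suc n) w < 2 * k"
        by auto
      also have "\<dots> \<longleftrightarrow> w < real (2 * k) / 2 ^ Suc n" by (rule uniform_idx_less_iff[OF w])
      also have "real (2 * k) / 2 ^ Suc n = real k / 2 ^ n" by simp
      finally show ?thesis using uniform_idx_less_iff[OF w, of n k] by simp
    qed
    then show ?thesis by (metis less_irrefl linorder_neqE_nat)
  qed
  have "grid n = step (2 ^ Suc n) (\<lambda>_. 1 / 2 ^ Suc n) (\<lambda>i. real (i div 2))"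
    unfolding grid_def step_def
    using abs_l2_eq_iff[OF masses.sq_idx_comp[OF uniform_masses[of n], of real] masses.sq_idx_comp[OF uniform_masses[of "Suc n"], of "\<lambda>i. real (i div 2)"]] eq
    by (auto intro!: AE_I2)
  then show "grid n \<in> sub_H (grid (Suc n))"
    using masses.step_in_sub_H_Grid[OF uniform_masses[of "Suc n"]] by (simp add: grid_def)
qed

lemma sub_H_grid_mono: "n \<le> k \<Longrightarrow> sub_H (grid n) \<subseteq> sub_H (grid k)"
  by (rule lift_Suc_mono_le[of "\<lambda>n. sub_H (grid n)"]) (rule sub_H_grid_Suc)

text \<open>Orthogonality to dyadic step functions makes the integrals over dyadic initial intervals
  vanish, then by dominated convergence those over all initial intervals.
  \<open>integral_comp_eq_zero\<close> with the identity as inner function finishes.\<close>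

lemma closure_grids: "y \<in> closure (\<Union>n. sub_H (grid n))"
proof (rule in_closure_of_orthogonal)
  show "subspace (\<Union>n. sub_H (grid n))"
    unfolding subspace_def
  proof (intro conjI ballI allI)
    show "0 \<in> (\<Union>n. sub_H (grid n))" using subspace_0[OF subspace_sub_H] by blast
    fix x y assume "x \<in> (\<Union>n. sub_H (grid n))" "y \<in> (\<Union>n. sub_H (grid n))"
    then obtain k l where "x \<in> sub_H (grid k)" "y \<in> sub_H (grid l)" by blast
    then have "x \<in> sub_H (grid (max k l))" "y \<in> sub_H (grid (max k l))"
      using sub_H_grid_mono[of k "max k l"] sub_H_grid_mono[of l "max k l"] by auto
    then show "x + y \<in> (\<Union>n. sub_H (grid n))" using subspace_add[OF subspace_sub_H] by blast
  next
    fix c x assume "x \<in> (\<Union>n. sub_H (grid n))"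
    then show "c *\<^sub>R x \<in> (\<Union>n. sub_H (grid n))" using subspace_scale[OF subspace_sub_H] by blast
  qed
  fix g assume g: "\<And>z. z \<in> (\<Union>n. sub_H (grid n)) \<Longrightarrow> inner g z = 0"
  have gi: "integrable unit_lborel (rep_l2 g)" by (rule U.integrable_of_square_integrable) simp
  have dyadic: "(LINT w|unit_lborel. rep_l2 g w * indicator {..<real k / 2 ^ n} w) = 0" for k n
  proof -
    let ?c = "\<lambda>i. if i < k then 1 else 0 :: real"
    have "inner g (step (2 ^ n) (\<lambda>_. 1 / 2 ^ n) ?c) = 0"
      using masses.step_in_sub_H_Grid[OF uniform_masses[of n]] by (intro g) (auto simp: grid_def)
    then have "(LINT w|unit_lborel. rep_l2 g w * ?c (idx (2 ^ n) (\<lambda>_. 1 / 2 ^ n) w)) = 0"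
      unfolding step_def using abs_l2_inner[OF sq_rep_l2 masses.sq_idx_comp[OF uniform_masses[of n], of ?c], of g] by simp
    also have "(LINT w|unit_lborel. rep_l2 g w * ?c (idx (2 ^ n) (\<lambda>_. 1 / 2 ^ n) w)) = (LINT w|unit_lborel. rep_l2 g w * indicator {..<real k / 2 ^ n} w)"
      by (rule Bochner_Integration.integral_cong) (auto simp: uniform_idx_less_iff)
    finally show ?thesis .
  qed
  have zero: "(LINT w|unit_lborel. rep_l2 g w * indicator {..c} w) = 0" for c
  proof -
    \<comment> \<open>Replacing a negative \<open>c\<close> by \<open>0\<close> changes nothing
      inside the unit interval and makes the truncation by \<open>nat\<close> harmless.\<close>
    define d where "d = max c 0"
    define k where "k n = nat \<lfloor>2 ^ n * d\<rfloor>" for n :: nat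
    have k: "real (k n) / 2 ^ n \<le> d" "d - 1 / 2 ^ n \<le> real (k n) / 2 ^ n" for n
    proof -
      have "real (k n) = of_int \<lfloor>2 ^ n * d\<rfloor>" by (simp add: k_def d_def)
      then have "real (k n) \<le> 2 ^ n * d" "2 ^ n * d - 1 \<le> real (k n)" by linarith+
      then have "real (k n) / 2 ^ n \<le> d" "(2 ^ n * d - 1) / 2 ^ n \<le> real (k n) / 2 ^ n"
        by (simp_all add: divide_le_eq mult.commute divide_right_mono)
      moreover have "(2 ^ n * d - 1) / 2 ^ n = d - 1 / 2 ^ n" by (simp add: diff_divide_distrib)
      ultimately show "real (k n) / 2 ^ n \<le> d" "d - 1 / 2 ^ n \<le> real (k n) / 2 ^ n" by simp_all
    qed
    have p: "(\<lambda>n. d - 1 / 2 ^ n) \<longlonglongrightarrow> d"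
    proof -
      have "(\<lambda>n. d - (1 / 2) ^ n) \<longlonglongrightarrow> d - 0"
        by (intro tendsto_intros LIMSEQ_realpow_zero) auto
      then show ?thesis by (simp add: power_one_over)
    qed
    have "(\<lambda>n. LINT w|unit_lborel. rep_l2 g w * indicator {..<real (k n) / 2 ^ n} w) \<longlonglongrightarrow> (LINT w|unit_lborel. rep_l2 g w * indicator {..<d} w)"
    proof (rule integral_dominated_convergence[where w="\<lambda>w. \<bar>rep_l2 g w\<bar>"])
      have m: "(\<lambda>w. indicator {..<a} w :: real) \<in> borel_measurable unit_lborel" for a
        by (rule borel_imp_measurable_unit_lborel) simp
      show "(\<lambda>w. rep_l2 g w * indicator {..<d} w) \<in> borel_measurable unit_lborel"
        "(\<lambda>w. rep_l2 g w * indicator {..<real (k n) / 2 ^ n} w) \<in> borel_measurable unit_lborel" for n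
        by (intro borel_measurable_times m rep_l2_measurable)+
      show "AE w in unit_lborel. (\<lambda>n. rep_l2 g w * indicator {..<real (k n) / 2 ^ n} w) \<longlonglongrightarrow> rep_l2 g w * indicator {..<d} w"
      proof (rule AE_I2, rule tendsto_mult[OF tendsto_const])
        fix w :: real
        show "(\<lambda>n. indicator {..<real (k n) / 2 ^ n} w :: real) \<longlonglongrightarrow> indicator {..<d} w"
        proof (cases "w < d")
          case True
          have "\<forall>\<^sub>F n in sequentially. w < d - 1 / 2 ^ n" using order_tendstoD(1)[OF p True] .
          then have "\<forall>\<^sub>F n in sequentially. (indicator {..<real (k n) / 2 ^ n} w :: real) = indicator {..<d} w"
          proof eventually_elim
            case (elim n)
            then have "w < real (k n) / 2 ^ n" using k(2)[of n] by linarith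
            then show ?case using True by simp
          qed
          then show ?thesis by (rule tendsto_eventually)
        next
          case False
          then have "\<not> w < real (k n) / 2 ^ n" for n using k(1)[of n] by linarith
          then show ?thesis using False by simp
        qed
      qed
    qed (use gi in \<open>auto split: split_indicator\<close>)
    then have "(LINT w|unit_lborel. rep_l2 g w * indicator {..<d} w) = 0"
      by (simp add: dyadic LIMSEQ_const_iff)
    also have "(LINT w|unit_lborel. rep_l2 g w * indicator {..<d} w) = (LINT w|unit_lborel. rep_l2 g w * indicator {..c} w)"
    proof (rule integral_cong_AE)
      show "AE w in unit_lborel. rep_l2 g w * indicator {..<d} w = rep_l2 g w * indicator {..c} w"
        using AE_unit_lborel_neq[of c] AE_space by eventually_elim (auto simp: d_def max_def split: split_indicator if_splits)
    qed (intro borel_measurable_times rep_l2_measurable borel_imp_measurable_unit_lborel; simp)+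
    finally show ?thesis .
  qed
  define u where "u w = indicator {0<..<1} w *\<^sub>R rep_l2 y w" for w :: real
  have u: "u \<in> borel_measurable borel"
    using rep_l2_measurable[of y] borel_measurable_restrict_space_iff[of "{0<..<1}" lborel "rep_l2 y"]
    unfolding u_def unit_lborel_def by simp
  have eq: "(LINT w|unit_lborel. rep_l2 g w * u w) = inner g y"
    unfolding inner_rep_l2 by (rule Bochner_Integration.integral_cong) (auto simp: u_def)
  have "integrable unit_lborel (\<lambda>w. rep_l2 g w * u w) \<longleftrightarrow> integrable unit_lborel (\<lambda>w. rep_l2 g w * rep_l2 y w)"
    by (rule Bochner_Integration.integrable_cong) (auto simp: u_def)
  then have "(LINT w|unit_lborel. rep_l2 g w * u w) = 0"
    using square_integrable_mult[OF sq_rep_l2 sq_rep_l2] zero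
    by (intro integral_comp_eq_zero[OF gi id_measurable_unit_lborel _ u]) auto
  then show "inner g y = 0" using eq by simp
qed

text \<open>The spaces are nested and projections are best approximations, so an approximant found
  at one level bounds the error at all later levels.\<close>

lemma PH_grid_tendsto: "(\<lambda>n. PH (grid n) y) \<longlonglongrightarrow> y"
proof (rule metric_LIMSEQ_I)
  fix e :: real assume "e > 0"
  then obtain z where z: "z \<in> (\<Union>n. sub_H (grid n))" "dist z y < e"
    using closure_grids[of y] unfolding closure_approachable by blast
  then obtain k where k: "z \<in> sub_H (grid k)" by blast
  have "dist (PH (grid n) y) y < e" if "n \<ge> k" for n
  proof -
    have "z \<in> sub_H (grid n)" using k sub_H_grid_mono[OF that] by blast
    then have "norm (y - PH (grid n) y) \<le> norm (y - z)" by (rule PH_dist_le)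
    then show ?thesis using z(2) by (simp add: dist_norm norm_minus_commute)
  qed
  then show "\<exists>no. \<forall>n\<ge>no. dist (PH (grid n) y) y < e" by blast
qed

lemma norm_grid_le: "norm (grid n) \<le> 2 ^ n"
proof -
  interpret masses "2 ^ n" "\<lambda>_. 1 / 2 ^ n" by (rule uniform_masses)
  have "(norm (grid n))\<^sup>2 = (\<Sum>i<2 ^ n. 1 / 2 ^ n * real i * real i)"
    unfolding power2_norm_eq_inner grid_def by (rule inner_step_step)
  also have "\<dots> \<le> (\<Sum>i<2 ^ n::nat. 1 / 2 ^ n * 2 ^ n * 2 ^ n)"
  proof (intro sum_mono mult_mono)
    fix i :: nat assume "i \<in> {..<2 ^ n}"
    then have "i \<le> 2 ^ n" by simp
    then show "real i \<le> 2 ^ n" "real i \<le> 2 ^ n" by (metis of_nat_le_iff of_nat_numeral of_nat_power)+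
  qed simp_all
  also have "\<dots> = (2 ^ n)\<^sup>2" by (simp add: power2_eq_square)
  finally show ?thesis by (rule power2_le_imp_le) simp
qed

theorem discrete_states_dense:
  assumes x: "x \<in> cone_K"
  obtains N m c d where "\<And>n. discrete_data (N n) (m n) (c n)"
    "(\<lambda>n. step (N n) (m n) (c n)) \<longlonglongrightarrow> x" "(\<lambda>n. step (N n) (m n) (d n)) \<longlonglongrightarrow> y"
proof -
  define N where "N n = (2::nat) ^ n" for n :: nat
  define m where "m n = (\<lambda>i::nat. 1 / 2 ^ n :: real)" for n :: nat
  have ms: "masses (N n) (m n)" for n unfolding N_def m_def by (rule uniform_masses)
  have grid: "grid n = step (N n) (m n) real" for n by (simp add: grid_def N_def m_def)
  have "\<exists>c. PH (grid n) z = step (N n) (m n) c" for n z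
    using masses.sub_H_Grid_cases[OF ms] PH_mem[of "grid n" z] unfolding grid by metis
  then obtain cc where cc: "\<And>n z. PH (grid n) z = step (N n) (m n) (cc n z)"
    by metis
  define c0 where "c0 n = cc n x" for n
  define d where "d n = cc n y" for n
  have c0: "PH (grid n) x = step (N n) (m n) (c0 n)" and d: "PH (grid n) y = step (N n) (m n) (d n)" for n
    by (simp_all add: cc c0_def d_def)
  \<comment> \<open>Discrete data need strictly increasing positions, while cell averages are only
    nondecreasing. A multiple of the grid makes them strict; the factor \<open>(1/4) ^ n\<close>
    beats the bound \<open>2 ^ n\<close> on the norm of the grid.\<close>
  define c where "c n = (\<lambda>i. c0 n i + (1/4) ^ n * real i)" for n
  have c_eq: "step (N n) (m n) (c n) = PH (grid n) x + (1/4) ^ n *\<^sub>R grid n" for n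
    by (simp only: c0) (simp only: grid masses.step_scaleR[OF ms] masses.step_add[OF ms] c_def)
  have dd: "discrete_data (N n) (m n) (c n)" for n
    unfolding discrete_data_def
  proof (intro conjI allI impI)
    show "m n i > 0" for i by (simp add: m_def)
    show "(\<Sum>i<N n. m n i) = 1" by (simp add: m_def N_def)
    fix i j assume ij: "i < N n" "j < N n" "i < j"
    have "step (N n) (m n) (c0 n) \<in> cone_K" using PH_cone_K[OF grid_mem x, of n] c0 by simp
    then have "c0 n i \<le> c0 n j" using ij by (simp add: masses.step_in_cone_K_iff[OF ms])
    moreover have "(1/4) ^ n * real i < (1/4) ^ n * real j" using ij by (intro mult_strict_left_mono) auto
    ultimately show "c n i < c n j" unfolding c_def by (rule add_le_less_mono)
  qed
  have small: "(\<lambda>n. (1/4) ^ n *\<^sub>R grid n) \<longlonglongrightarrow> 0"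
  proof (rule Lim_null_comparison)
    have "norm ((1/4) ^ n *\<^sub>R grid n) \<le> (1/2) ^ n" for n
    proof -
      have "norm ((1/4) ^ n *\<^sub>R grid n) \<le> (1/4) ^ n * 2 ^ n" using norm_grid_le[of n] by (simp add: mult_left_mono)
      also have "\<dots> = (1/2) ^ n" by (simp add: power_mult_distrib[symmetric])
      finally show ?thesis .
    qed
    then show "\<forall>\<^sub>F n in sequentially. norm ((1/4) ^ n *\<^sub>R grid n) \<le> (1/2) ^ n" by simp
    show "(\<lambda>n. (1/2::real) ^ n) \<longlonglongrightarrow> 0" by (rule LIMSEQ_realpow_zero) auto
  qed
  have "(\<lambda>n. step (N n) (m n) (c n)) \<longlonglongrightarrow> x"
    unfolding c_eq using tendsto_add[OF PH_grid_tendsto[of x] small] by simp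
  moreover have "(\<lambda>n. step (N n) (m n) (d n)) \<longlonglongrightarrow> y"
    using PH_grid_tendsto[of y] by (simp add: d)
  ultimately show ?thesis using that dd by blast
qed

section \<open>The sticky particle semigroup\<close>

text \<open>The initial velocity stands in the second slot of \<open>eul\<close>, so both arguments
  depend continuously on the datum in \<open>L^2\<close>.\<close>

definition lagrangian_semigroup :: "real \<Rightarrow> state \<Rightarrow> state" where
  "lagrangian_semigroup t \<mu> = (if t \<ge> 0 \<and> \<mu> \<in> V2 then
     let x = rearr_l2 (fst \<mu>); y = lagrangian_velocity (fst \<mu>) (velocity \<mu>) in eul (PK (x + t *\<^sub>R y)) y
   else undefined)"

lemma lagrangian_semigroup_eul:
  assumes "t \<ge> 0" "x \<in> cone_K" "y \<in> sub_H x"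
  shows "lagrangian_semigroup t (eul x y) = eul (PK (x + t *\<^sub>R y)) y"
  using assms V2_iff_eul[of "eul x y"] by (auto simp: lagrangian_semigroup_def velocity_eul)

lemma discrete_state_lagrangian:
  assumes "discrete_data N m x0"
  shows "discrete_state N m x0 v0 = eul (step N m x0) (step N m v0)"
    "step N m x0 \<in> cone_K" "step N m v0 \<in> sub_H (step N m x0)"
proof -
  interpret masses N m by (rule discrete_data_masses[OF assms])
  show "discrete_state N m x0 v0 = eul (step N m x0) (step N m v0)" by (rule eul_step[symmetric])
  show "step N m x0 \<in> cone_K"
    using discrete_data_mono[OF assms] by (simp add: step_in_cone_K_iff)
  have "\<forall>i<N. \<forall>j<N. x0 i = x0 j \<longrightarrow> v0 i = v0 j"
    using discrete_data_inj[OF assms] by blast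
  then show "step N m v0 \<in> sub_H (step N m x0)"
    by (rule step_in_sub_H_step_iff[THEN iffD2, rotated]) (rule discrete_data_mono[OF assms])
qed

lemma D2_eul_tendsto_iff:
  assumes x: "\<And>n. x n \<in> cone_K" "\<And>n. y n \<in> sub_H (x n)" and x': "x' \<in> cone_K" "y' \<in> sub_H x'"
  shows "(\<lambda>n. D2 (eul (x n) (y n)) (eul x' y')) \<longlonglongrightarrow> 0 \<longleftrightarrow> x \<longlonglongrightarrow> x' \<and> y \<longlonglongrightarrow> y'"
proof -
  have D2: "D2 (eul (x n) (y n)) (eul x' y') = sqrt ((norm (x n - x'))\<^sup>2 + (norm (y n - y'))\<^sup>2)" for n
    by (rule D2_eul[OF x x'])
  show ?thesis
  proof
    assume D: "(\<lambda>n. D2 (eul (x n) (y n)) (eul x' y')) \<longlonglongrightarrow> 0"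
    have "(\<lambda>n. x n - x') \<longlonglongrightarrow> 0"
      by (rule Lim_null_comparison[OF _ D]) (simp add: D2)
    moreover have "(\<lambda>n. y n - y') \<longlonglongrightarrow> 0"
      by (rule Lim_null_comparison[OF _ D]) (simp add: D2)
    ultimately show "x \<longlonglongrightarrow> x' \<and> y \<longlonglongrightarrow> y'" by (simp add: LIM_zero_iff)
  next
    assume lim: "x \<longlonglongrightarrow> x' \<and> y \<longlonglongrightarrow> y'"
    have "(\<lambda>n. sqrt ((norm (x n - x'))\<^sup>2 + (norm (y n - y'))\<^sup>2)) \<longlonglongrightarrow> sqrt ((norm (x' - x'))\<^sup>2 + (norm (y' - y'))\<^sup>2)"
      using lim by (intro tendsto_intros) auto
    then show "(\<lambda>n. D2 (eul (x n) (y n)) (eul x' y')) \<longlonglongrightarrow> 0" by (simp add: D2)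
  qed
qed

lemma V2_eul_cases:
  assumes "\<mu> \<in> V2" obtains x y where "x \<in> cone_K" "y \<in> sub_H x" "\<mu> = eul x y"
  using assms V2_iff_eul by blast

lemma PK_path_tendsto:
  assumes "x \<longlonglongrightarrow> x'" "y \<longlonglongrightarrow> y'"
  shows "(\<lambda>n. PK (x n + t *\<^sub>R y n)) \<longlonglongrightarrow> PK (x' + t *\<^sub>R y')"
proof -
  have "(\<lambda>n. PK (x n + t *\<^sub>R y n) - PK (x' + t *\<^sub>R y')) \<longlonglongrightarrow> 0"
  proof (rule Lim_null_comparison)
    show "\<forall>\<^sub>F n in sequentially. norm (PK (x n + t *\<^sub>R y n) - PK (x' + t *\<^sub>R y')) \<le> norm ((x n + t *\<^sub>R y n) - (x' + t *\<^sub>R y'))"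
      by (simp only: PK_nonexpansive eventually_True)
    have "(\<lambda>n. norm ((x n + t *\<^sub>R y n) - (x' + t *\<^sub>R y'))) \<longlonglongrightarrow> norm ((x' + t *\<^sub>R y') - (x' + t *\<^sub>R y'))"
      by (intro tendsto_intros assms)
    then show "(\<lambda>n. norm ((x n + t *\<^sub>R y n) - (x' + t *\<^sub>R y'))) \<longlonglongrightarrow> 0" by simp
  qed
  then show ?thesis by (simp add: LIM_zero_iff)
qed

lemma W2_law_rep:
  "x \<in> cone_K \<Longrightarrow> x' \<in> cone_K \<Longrightarrow> W2 (fst (eul x y)) (fst (eul x' y')) = norm (x - x')"
  using W2_eq_norm law_rep_cone_K by (simp add: eul_def)

lemma eul_in_V2: "x \<in> cone_K \<Longrightarrow> eul x y \<in> V2"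
  using V2_iff_eul eul_PH PH_mem by metis

lemma is_sticky_semigroup_lagrangian: "is_sticky_semigroup lagrangian_semigroup"
  unfolding is_sticky_semigroup_def
proof (intro conjI allI impI ballI)
  fix t :: real and \<mu> assume "t \<ge> 0" "\<mu> \<in> V2"
  then show "lagrangian_semigroup t \<mu> \<in> V2"
    by (elim V2_eul_cases) (simp add: lagrangian_semigroup_eul eul_in_V2 PK_mem)
next
  fix t :: real and \<mu> assume "\<not> (t \<ge> 0 \<and> \<mu> \<in> V2)"
  then show "lagrangian_semigroup t \<mu> = undefined" unfolding lagrangian_semigroup_def by (rule if_not_P)
next
  fix N m x0 v0 x v and t :: real
  assume *: "discrete_data N m x0 \<and> sticky_trajectories N m x0 v0 x v" and t: "t \<ge> 0"
  interpret masses N m using * discrete_data_masses by blast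
  interpret sticky_discrete N m x0 v0 x v using * by unfold_locales auto
  show "lagrangian_semigroup t (discrete_state N m x0 v0) = discrete_state N m (\<lambda>i. x i t) (\<lambda>i. v i t)"
    unfolding discrete_state_lagrangian(1)[OF data]
      lagrangian_semigroup_eul[OF t discrete_state_lagrangian(2,3)[OF data]]
    by (rule eul_PK_step[OF t])
next
  fix t :: real and \<mu>n :: "nat \<Rightarrow> state" and \<mu>
  assume t: "t \<ge> 0" and \<mu>: "\<mu> \<in> V2" and *: "(\<forall>n. \<mu>n n \<in> V2) \<and> (\<lambda>n. D2 (\<mu>n n) \<mu>) \<longlonglongrightarrow> 0"
  obtain x' y' where x': "x' \<in> cone_K" "y' \<in> sub_H x'" "\<mu> = eul x' y'" using \<mu> V2_eul_cases by blast
  have "\<exists>x y. x \<in> cone_K \<and> y \<in> sub_H x \<and> \<mu>n n = eul x y" for n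
    using * V2_iff_eul by blast
  then obtain x y where x: "\<And>n. x n \<in> cone_K" "\<And>n. y n \<in> sub_H (x n)" "\<And>n. \<mu>n n = eul (x n) (y n)" by metis
  have lim: "x \<longlonglongrightarrow> x'" "y \<longlonglongrightarrow> y'"
    using * D2_eul_tendsto_iff[OF x(1,2) x'(1,2)] by (simp_all add: x(3) x'(3))
  note limP = PK_path_tendsto[OF lim, of t]
  have "(\<lambda>n. norm (PK (x n + t *\<^sub>R y n) - PK (x' + t *\<^sub>R y'))) \<longlonglongrightarrow> 0"
    using limP by (simp add: tendsto_norm_zero_iff LIM_zero)
  then show "(\<lambda>n. W2 (fst (lagrangian_semigroup t (\<mu>n n))) (fst (lagrangian_semigroup t \<mu>))) \<longlonglongrightarrow> 0"
    by (simp add: x(3) x'(3) lagrangian_semigroup_eul t x(1,2) x'(1,2) W2_law_rep PK_mem)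
  show "weak_conv_signed (\<lambda>n. snd (lagrangian_semigroup t (\<mu>n n))) (snd (lagrangian_semigroup t \<mu>))"
    using weak_conv_signed_eul[OF PK_mem PK_mem limP lim(2)]
    by (simp add: x(3) x'(3) lagrangian_semigroup_eul t x(1,2) x'(1,2))
qed

text \<open>Existing trajectories force agreement on discrete states, and these approximate any
  state in \<open>D2\<close>. In the limit the Wasserstein distance fixes the positions, and weak
  convergence then fixes the velocity inside \<open>sub_H\<close> of these positions.\<close>

lemma is_sticky_semigroup_unique:
  assumes S: "is_sticky_semigroup S"
  shows "S = lagrangian_semigroup"
proof (intro ext)
  fix t \<mu>
  note L = is_sticky_semigroup_lagrangian
  have V: "\<And>R t \<mu>. is_sticky_semigroup R \<Longrightarrow> t \<ge> 0 \<Longrightarrow> \<mu> \<in> V2 \<Longrightarrow> R t \<mu> \<in> V2"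
    unfolding is_sticky_semigroup_def by blast
  have disc: "S t (discrete_state N m x0 v0) = lagrangian_semigroup t (discrete_state N m x0 v0)"
    if dt: "discrete_data N m x0" "t \<ge> 0" for N m x0 v0 t
  proof -
    obtain x v where "sticky_trajectories N m x0 v0 x v" using sticky_trajectories_exist[OF dt(1)] by blast
    then have e: "R t (discrete_state N m x0 v0) = discrete_state N m (\<lambda>i. x i t) (\<lambda>i. v i t)"
      if "is_sticky_semigroup R" for R
      using that dt unfolding is_sticky_semigroup_def by blast
    show ?thesis using e[OF S] e[OF L] by simp
  qed
  show "S t \<mu> = lagrangian_semigroup t \<mu>"
  proof (cases "t \<ge> 0 \<and> \<mu> \<in> V2")
    case False
    have "R t \<mu> = undefined" if "is_sticky_semigroup R" for R
      using that False unfolding is_sticky_semigroup_def by blast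
    from this[OF S] this[OF L] show ?thesis by simp
  next
    case True
    then have t: "t \<ge> 0" and \<mu>: "\<mu> \<in> V2" by auto
    obtain x y where x: "x \<in> cone_K" "y \<in> sub_H x" "\<mu> = eul x y" using \<mu> V2_eul_cases by blast
    obtain N m c d where dd: "\<And>n. discrete_data (N n) (m n) (c n)"
      and lim: "(\<lambda>n. step (N n) (m n) (c n)) \<longlonglongrightarrow> x" "(\<lambda>n. step (N n) (m n) (d n)) \<longlonglongrightarrow> y"
      by (rule discrete_states_dense[OF x(1), of y], rule that)
    define \<mu>n where "\<mu>n n = discrete_state (N n) (m n) (c n) (d n)" for n
    have \<mu>n: "\<mu>n n = eul (step (N n) (m n) (c n)) (step (N n) (m n) (d n))" for n
      unfolding \<mu>n_def by (rule discrete_state_lagrangian(1)[OF dd])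
    have V2n: "\<mu>n n \<in> V2" for n
      unfolding \<mu>n by (rule eul_in_V2[OF discrete_state_lagrangian(2)[OF dd]])
    have D: "(\<lambda>n. D2 (\<mu>n n) \<mu>) \<longlonglongrightarrow> 0"
      unfolding \<mu>n x(3)
      by (rule D2_eul_tendsto_iff[THEN iffD2]) (use discrete_state_lagrangian[OF dd] x lim in auto)
    have conv: "(\<lambda>n. W2 (fst (R t (\<mu>n n))) (fst (R t \<mu>))) \<longlonglongrightarrow> 0 \<and> weak_conv_signed (\<lambda>n. snd (R t (\<mu>n n))) (snd (R t \<mu>))"
      if "is_sticky_semigroup R" for R
      using that t \<mu> V2n D unfolding is_sticky_semigroup_def by blast
    define \<nu> where "\<nu> n = lagrangian_semigroup t (\<mu>n n)" for n
    have \<nu>V: "\<nu> n \<in> V2" for n unfolding \<nu>_def by (rule V[OF L t V2n])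
    have S\<nu>: "S t (\<mu>n n) = \<nu> n" for n unfolding \<nu>_def \<mu>n_def by (rule disc[OF dd t])
    have cS: "(\<lambda>n. W2 (fst (\<nu> n)) (fst (S t \<mu>))) \<longlonglongrightarrow> 0" "weak_conv_signed (\<lambda>n. snd (\<nu> n)) (snd (S t \<mu>))"
      using conv[OF S] by (simp_all add: S\<nu>)
    have cL: "(\<lambda>n. W2 (fst (\<nu> n)) (fst (lagrangian_semigroup t \<mu>))) \<longlonglongrightarrow> 0" "weak_conv_signed (\<lambda>n. snd (\<nu> n)) (snd (lagrangian_semigroup t \<mu>))"
      using conv[OF L] by (simp_all add: \<nu>_def)
    obtain a b where a: "a \<in> cone_K" "b \<in> sub_H a" "S t \<mu> = eul a b" using V[OF S t \<mu>] V2_eul_cases by blast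
    obtain a' b' where a': "a' \<in> cone_K" "b' \<in> sub_H a'" "lagrangian_semigroup t \<mu> = eul a' b'" using V[OF L t \<mu>] V2_eul_cases by blast
    have "\<exists>p q. p \<in> cone_K \<and> q \<in> sub_H p \<and> \<nu> n = eul p q" for n
      using \<nu>V V2_iff_eul by blast
    then obtain p q where p: "\<And>n. p n \<in> cone_K" "\<And>n. \<nu> n = eul (p n) (q n)" by metis
    have "(\<lambda>n. norm (p n - a)) \<longlonglongrightarrow> 0" "(\<lambda>n. norm (p n - a')) \<longlonglongrightarrow> 0"
      using cS(1) cL(1) by (simp_all add: p a(1,3) a'(1,3) W2_law_rep)
    then have "p \<longlonglongrightarrow> a" "p \<longlonglongrightarrow> a'" by (simp_all add: tendsto_norm_zero_iff LIM_zero_iff)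
    then have aa: "a = a'" by (rule LIMSEQ_unique)
    have "b = b'"
      using weak_conv_signed_unique[OF a(1,2), of b'] a'(2) cS(2) cL(2) by (simp add: a(3) a'(3) aa)
    then show ?thesis using a(3) a'(3) aa by simp
  qed
qed

lemma sticky_semigroup_eq: "sticky_semigroup = lagrangian_semigroup"
  unfolding sticky_semigroup_def
  by (rule the_equality) (rule is_sticky_semigroup_lagrangian, rule is_sticky_semigroup_unique)

theorem theorem2p6:
  fixes \<rho>0 :: "real measure" and v0 :: "real \<Rightarrow> real"
    and \<rho> :: "real \<Rightarrow> real measure" and v :: "real \<Rightarrow> real \<Rightarrow> real"
    and X0 V0 :: l2 and X V :: "real \<Rightarrow> l2"
  assumes "\<rho>0 \<in> P2" and "square_integrable \<rho>0 v0"
    and "\<And>t. t \<ge> 0 \<Longrightarrow> \<rho> t \<in> P2" and "\<And>t. t \<ge> 0 \<Longrightarrow> square_integrable (\<rho> t) (v t)"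
  defines "X0 \<equiv> rearr_l2 \<rho>0" and "V0 \<equiv> lagrangian_velocity \<rho>0 v0"
    and "X \<equiv> \<lambda>t. rearr_l2 (\<rho> t)" and "V \<equiv> right_deriv X"
  defines "sticky \<equiv> \<forall>t\<ge>0. (\<rho> t, momentum (\<rho> t) (v t))
                             = sticky_semigroup t (\<rho>0, momentum \<rho>0 v0)"
    and "L_I \<equiv> unique_forward (subdiff_flow_solution X0 V0) X"
    and "L_II \<equiv> proj_formula X0 V0 X"
    and "L_III \<equiv> unique_forward (rescaled_flow_solution X0 V0) X"
    and "vel \<equiv> \<forall>t\<ge>0. lagrangian_velocity (\<rho> t) (v t) = V t"
  shows "X0 \<in> cone_K \<and> V0 \<in> sub_H X0 \<and> (\<forall>t\<ge>0. X t \<in> cone_K) \<and>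
    (L_I \<longleftrightarrow> L_II) \<and> (L_II \<longleftrightarrow> L_III) \<and>
    (sticky \<longleftrightarrow> L_I \<and> vel) \<and> (sticky \<longleftrightarrow> L_II \<and> vel) \<and> (sticky \<longleftrightarrow> L_III \<and> vel) \<and>
    (L_I \<or> L_II \<or> L_III \<longrightarrow>
      (\<exists>C. C-lipschitz_on {0..} X) \<and>
      (\<forall>t\<ge>0. (X has_vector_derivative V t) (at t within {t..}) \<and>
        V t = orth_proj (sub_H (X t)) V0 \<and> V t \<in> sub_H (X t) \<and>
        (\<exists>u. square_integrable (\<rho> t) u \<and> lagrangian_velocity (\<rho> t) u = V t)) \<and>
      (\<forall>s t. 0 \<le> s \<and> s \<le> t \<longrightarrow> sub_H (X t) \<subseteq> sub_H (X s)) \<and>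
      (\<forall>s t. 0 \<le> s \<and> s \<le> t \<longrightarrow>
        X t = metric_proj cone_K (X s + (t - s) *\<^sub>R V s) \<and>
        V t = orth_proj (sub_H (X t)) (V s)))"
proof -
  have X0: "X0 \<in> cone_K" unfolding X0_def by (rule rearr_l2_in_cone_K[OF assms(1)])
  have V0: "V0 \<in> sub_H X0" unfolding X0_def V0_def by (rule lagrangian_velocity_in_sub_H[OF assms(1,2)])
  have XK: "X t \<in> cone_K" if "t \<ge> 0" for t unfolding X_def by (rule rearr_l2_in_cone_K[OF assms(3)[OF that]])
  have vH: "lagrangian_velocity (\<rho> t) (v t) \<in> sub_H (X t)" if "t \<ge> 0" for t
    unfolding X_def by (rule lagrangian_velocity_in_sub_H[OF assms(3,4)[OF that]])
  interpret F: sticky_flow X0 V0 by standard (rule X0, rule V0)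
  \<comment> \<open>Each characterization becomes agreement with the projected flow at nonnegative
    times, so their equivalence is propositional.\<close>
  have I: "L_I \<longleftrightarrow> (\<forall>t\<ge>0. X t = F.X t)" unfolding L_I_def by (rule F.unique_subdiff_flow_iff)
  have II: "L_II \<longleftrightarrow> (\<forall>t\<ge>0. X t = F.X t)" unfolding L_II_def by (rule F.proj_formula_iff)
  have III: "L_III \<longleftrightarrow> (\<forall>t\<ge>0. X t = F.X t)" unfolding L_III_def by (rule F.unique_rescaled_flow_iff)
  have V: "V t = F.V t" if "\<forall>t\<ge>0. X t = F.X t" "t \<ge> 0" for t
    unfolding V_def by (rule F.right_deriv_eq(2)[OF that])
  have st: "(\<rho> t, momentum (\<rho> t) (v t)) = sticky_semigroup t (\<rho>0, momentum \<rho>0 v0)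
      \<longleftrightarrow> X t = F.X t \<and> lagrangian_velocity (\<rho> t) (v t) = F.V t" if t: "t \<ge> 0" for t
  proof -
    have "sticky_semigroup t (\<rho>0, momentum \<rho>0 v0) = eul (PK (X0 + t *\<^sub>R V0)) V0"
      unfolding sticky_semigroup_eq eul_lagrangian[OF assms(1,2)] X0_def[symmetric] V0_def[symmetric]
      by (rule lagrangian_semigroup_eul[OF t X0 V0])
    also have "\<dots> = eul (F.X t) (F.V t)"
      unfolding F.V_def F.X_def by (rule eul_PH[OF PK_mem, symmetric])
    finally have 1: "sticky_semigroup t (\<rho>0, momentum \<rho>0 v0) = eul (F.X t) (F.V t)" .
    have 2: "(\<rho> t, momentum (\<rho> t) (v t)) = eul (X t) (lagrangian_velocity (\<rho> t) (v t))"
      unfolding X_def by (rule eul_lagrangian[OF assms(3,4)[OF t]])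
    show ?thesis
      unfolding 1 2 using eul_inj[OF XK[OF t] vH[OF t] F.X_mem F.V_mem, of t] by auto
  qed
  \<comment> \<open>\<open>vel\<close> refers to the right derivative of \<open>X\<close>, which is
    identified with the velocity of the flow only after \<open>X\<close> agrees with the flow at all
    nonnegative times; the two conditions are therefore combined globally and not time by
    time.\<close>
  have sticky: "sticky \<longleftrightarrow> (\<forall>t\<ge>0. X t = F.X t) \<and> vel"
    unfolding sticky_def vel_def using st V by auto
  have main: "(\<exists>C. C-lipschitz_on {0..} X) \<and>
      (\<forall>t\<ge>0. (X has_vector_derivative V t) (at t within {t..}) \<and>
        V t = orth_proj (sub_H (X t)) V0 \<and> V t \<in> sub_H (X t) \<and>
        (\<exists>u. square_integrable (\<rho> t) u \<and> lagrangian_velocity (\<rho> t) u = V t)) \<and>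
      (\<forall>s t. 0 \<le> s \<and> s \<le> t \<longrightarrow> sub_H (X t) \<subseteq> sub_H (X s)) \<and>
      (\<forall>s t. 0 \<le> s \<and> s \<le> t \<longrightarrow>
        X t = metric_proj cone_K (X s + (t - s) *\<^sub>R V s) \<and>
        V t = orth_proj (sub_H (X t)) (V s))" if eq: "\<forall>t\<ge>0. X t = F.X t"
  proof (intro conjI allI impI)
    have "(norm V0)-lipschitz_on {0..} X"
      using F.lipschitz_on_X[of "{0..}"] by (rule lipschitz_on_transform) (use eq in auto)
    then show "\<exists>C. C-lipschitz_on {0..} X" ..
  next
    fix t :: real assume t: "t \<ge> 0"
    show "(X has_vector_derivative V t) (at t within {t..})"
      using F.right_deriv_eq(1)[OF eq t] V[OF eq t] by simp
    show "V t = orth_proj (sub_H (X t)) V0" using V[OF eq t] eq t by (simp add: F.V_def)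
    show VH: "V t \<in> sub_H (X t)" using V[OF eq t] eq t F.V_mem by simp
    have l: "law (rep_l2 (X t)) = \<rho> t"
      by (rule P2_eqI) (use law_rep_cone_K[OF XK[OF t]] assms(3)[OF t] in \<open>simp_all add: X_def\<close>)
    obtain u where "square_integrable (law (rep_l2 (X t))) u" "lagrangian_velocity (law (rep_l2 (X t))) u = V t"
      using eul_ex_velocity[OF XK[OF t] VH] by blast
    then show "\<exists>u. square_integrable (\<rho> t) u \<and> lagrangian_velocity (\<rho> t) u = V t"
      unfolding l by blast
  next
    fix s t :: real assume *: "0 \<le> s \<and> s \<le> t"
    then have t: "0 \<le> s" "s \<le> t" "0 \<le> t" by auto
    show "sub_H (X t) \<subseteq> sub_H (X s)" using F.sub_H_antimono[OF t(1,2)] eq t by simp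
    show "X t = metric_proj cone_K (X s + (t - s) *\<^sub>R V s)"
      using F.X_semigroup[OF t(1,2)] eq t V[OF eq t(1)] by simp
    show "V t = orth_proj (sub_H (X t)) (V s)"
      using F.V_semigroup[OF t(1,2)] eq t V[OF eq t(1)] V[OF eq t(3)] by simp
  qed
  show ?thesis
    using X0 V0 XK I II III sticky main by blast
qed

end
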